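(* Let $N\ge1$, $d\ge2$. For any $B\in\mathbb{R}$, the set $\{f\in\mathrm{Poly}_{N,d}(\mathbb{C}):G_{f,\infty}(C_f)\leq B\}$ is compact.
   Context: Multi-indices $I=(I_0,\dots,I_N)$, $|I|=\sum I_j$, $\mathbf{x}^I=\prod x_j^{I_j}$; $\mathrm{Ind}^*(N,d)$ is the set of $I$ with $|I|=d$ and $0<I_N<d$. $\mathrm{Poly}_{N,d}(\mathbb{C})$ is the affine space of tuples $(a_{i,I})_{0\le i<N,\,I\in\mathrm{Ind}^*(N,d)}$ of complex numbers (with its usual topology), each giving the morphism $f=[f_0:\cdots:f_N]$ of $\mathbb{P}^N$ with $f_i=x_i^d+\sum_{I\in\mathrm{Ind}^*(N,d)}a_{i,I}\mathbf{x}^I$ ($i<N$), $f_N=x_N^d$. $\mathrm{Div}^*(\mathbb{P}^N)$ denotes the effective divisors $D$ defined by a homogeneous form $F_D$ normalized so that $F_D(x_0,\dots,x_{N-1},0)=\prod_{i<N}x_i^{e_i}$ for some $e_i\ge0$. For such $D$ set \[\lambda_\infty(D)=\sup_{|\beta_0|=\cdots=|\beta_{N-1}|=1}\log^+\max\{|\beta_N|^{-1}:F_D(\beta_0,\dots,\beta_N)=0\}.\] $f_*(D)$ is the push-forward divisor, defined by $\mathrm{Res}(F_D,f)$ where $\mathrm{Res}(F,f)(y_0,\dots,y_{N-1},1)=\mathrm{Res}_{x_0,\dots,x_N}(F,y_0x_N^d-f_0,\dots,y_{N-1}x_N^d-f_{N-1})$ (Macaulay resultant); its support is $f(\mathrm{Supp}\,D)$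 and $f_*$ preserves $\mathrm{Div}^*$. Define $G_{f,\infty}(D)=\lim_{n\to\infty}d^{-n}\lambda_\infty(f^n_*(D))$ (the limit exists). $C_f$ is the divisor of $J_f=\det(\partial f_i/\partial x_j)_{0\le i,j<N}$. *)

theory Defs
  imports "HOL-Analysis.Analysis" "HOL-Combinatorics.Permutations"
begin

text \<open>Points of C^(N+1) are functions nat => complex whose coordinates 0..N are used.
  Multi-indices are functions nat => nat (only entries 0..N matter; entries beyond N are 0).\<close>

definition mono :: "nat \<Rightarrow> (nat \<Rightarrow> nat) \<Rightarrow> (nat \<Rightarrow> complex) \<Rightarrow> complex" where
  "mono N I x = (\<Prod>j\<le>N. x j ^ I j)"

definition IndStar :: "nat \<Rightarrow> nat \<Rightarrow> (nat \<Rightarrow> nat) set" where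
  "IndStar N d = {I. (\<forall>j>N. I j = 0) \<and> (\<Sum>j\<le>N. I j) = d \<and> 0 < I N \<and> I N < d}"

text \<open>Poly_{N,d}(C): coefficient tuples (a_{i,I}), i < N, I in Ind^*(N,d), as functions that
  vanish outside these indices (with the product topology on the function space).\<close>
definition PolySpace :: "nat \<Rightarrow> nat \<Rightarrow> (nat \<Rightarrow> (nat \<Rightarrow> nat) \<Rightarrow> complex) set" where
  "PolySpace N d = {a. \<forall>i I. (N \<le> i \<or> I \<notin> IndStar N d) \<longrightarrow> a i I = 0}"

definition polymap :: "nat \<Rightarrow> nat \<Rightarrow> (nat \<Rightarrow> (nat \<Rightarrow> nat) \<Rightarrow> complex)
    \<Rightarrow> (nat \<Rightarrow> complex) \<Rightarrow> (nat \<Rightarrow> complex)" where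
  "polymap N d a x = (\<lambda>i. if i < N then x i ^ d + (\<Sum>I\<in>IndStar N d. a i I * mono N I x)
                         else if i = N then x N ^ d else 0)"

definition detN :: "nat \<Rightarrow> (nat \<Rightarrow> nat \<Rightarrow> complex) \<Rightarrow> complex" where
  "detN n M = (\<Sum>p\<in>{p. p permutes {..<n}}. of_int (sign p) * (\<Prod>i<n. M i (p i)))"

definition jac :: "nat \<Rightarrow> nat \<Rightarrow> (nat \<Rightarrow> (nat \<Rightarrow> nat) \<Rightarrow> complex) \<Rightarrow> (nat \<Rightarrow> complex) \<Rightarrow> complex" where
  "jac N d a x = detN N (\<lambda>i j. deriv (\<lambda>t. polymap N d a (x(j := t)) i) (x j))"

text \<open>Cone over Supp C_f: nonzero points of C^(N+1) where J_f vanishes.\<close>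
definition critcone :: "nat \<Rightarrow> nat \<Rightarrow> (nat \<Rightarrow> (nat \<Rightarrow> nat) \<Rightarrow> complex) \<Rightarrow> (nat \<Rightarrow> complex) set" where
  "critcone N d a = {x. (\<forall>j>N. x j = 0) \<and> (\<exists>j\<le>N. x j \<noteq> 0) \<and> jac N d a x = 0}"

text \<open>lambda_infinity of an effective divisor, computed from the cone Z over its support
  (the zero set of F_D):  sup over beta in Z with |beta_0| = ... = |beta_{N-1}| = 1 of
  log^+ |beta_N|^{-1}  (0 if there is no such beta).\<close>
definition lambda_inf :: "nat \<Rightarrow> (nat \<Rightarrow> complex) set \<Rightarrow> real" where
  "lambda_inf N Z = Sup ({0} \<union> {max 0 (ln (inverse (cmod (b N)))) | b. b \<in> Z \<and> (\<forall>i<N. cmod (b i) = 1)})"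

text \<open>G_{f,infinity}(C_f) = lim d^{-n} lambda_infinity(f^n_* C_f); the support of f^n_* C_f
  is f^n(Supp C_f), whose cone is the image of the cone over Supp C_f under f^n.\<close>
definition G_inf_crit :: "nat \<Rightarrow> nat \<Rightarrow> (nat \<Rightarrow> (nat \<Rightarrow> nat) \<Rightarrow> complex) \<Rightarrow> real" where
  "G_inf_crit N d a = lim (\<lambda>n. lambda_inf N ((polymap N d a ^^ n) ` critcone N d a) / real d ^ n)"

end

theory Submission
  imports Defs "HOL-Complex_Analysis.Complex_Analysis" "Jordan_Normal_Form.Determinant"
begin

text \<open>Let \<open>v\<close> denote the first \<open>N\<close> coordinates of a point and \<open>t\<close> the last one. The lower terms of \<open>f\<close>
  are divisible by \<open>t\<close>, so near \<open>t = 0\<close> the map is a perturbation of \<open>v \<mapsto> v^d\<close>, the fibres have no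
  critical points, and through every point of the unit torus in \<open>t = 0\<close> there is a unique holomorphic disc
  that follows the orbit of its centre. The inequality \<open>\<lambda>\<^sub>\<infinity>(f\<^sup>n\<^sub>* C) \<le> d^n L\<close> says that
  no critical point with \<open>|t| < exp(- L)\<close> is mapped by \<open>f\<^sup>n\<close> to a point with \<open>|v\<^sub>i| = 1\<close>. There
  the discs can be pulled back once more: as long as the Jacobian does not vanish, all \<open>d^N\<close> inverse branches continue holomorphically over the whole disc,
  and together they fill the fibres. By Montel's and Hurwitz's theorems this property passes to limits
  of maps. This yields both the convergence of \<open>d^(-n) \<lambda>\<^sub>\<infinity>\<close> and its lower semicontinuity,
  hence closedness of the set.

  Boundedness follows by rescaling \<open>t\<close>. If the coefficients of maps with bounded \<open>G\<close> were unbounded,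
  normalizing the largest of them would give a limit map, not equal to \<open>v^d\<close>, that is constant along
  inverse branches defined on all of \<open>\<complex>\<close> and of linear growth, that is, along affine lines
  \<open>\<omega> + m t\<close> through each torus point \<open>\<omega>\<close>. Liouville's theorem shows that \<open>m\<close>, a bounded
  Laurent polynomial in \<open>\<omega>\<close>, is constant, and then all lower terms vanish, a contradiction.\<close>

section \<open>Determinants and derivatives\<close>

text \<open>After division by d^n the height of a critical point (v, t) that f^n sends to the unit
  torus is just log(1/|t|), because the last coordinate of the image is t^(d^n). The obstacle is
  that the condition "on the torus after n steps" changes with n: there is no monotonicity to use,
  and the condition does not survive a limit in n. It is therefore replaced by shadowing: staying
  within \<open>\<kappa>\<close> of an orbit on the torus at all times is a closed condition, and
  for small t it determines the point, because the map expands there. A point is brought to small t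
  by m iterates, since t becomes t^(d^m); there it is identified with a point of a limit disc, and
  this disc is pulled back m times. At stage j the disc has radius exp(- L d^j), so a bound d^j L on
  level n - j is enough. This slack lets one lemma, \<open>Lam_limit_transfer\<close>, give
  convergence for a single map as well as semicontinuity for a sequence. Convergence has to be
  proved because \<open>G_inf_crit\<close> is defined by \<open>lim\<close>, which says nothing
  about a divergent sequence.\<close>

lemma detN_eq_det: "detN n M = det (mat n n (\<lambda>(i, j). M i j))"
proof -
  have "det (mat n n (\<lambda>(i, j). M i j)) =
      (\<Sum>p\<in>{p. p permutes {0..<n}}. of_int (sign p) * (\<Prod>i = 0..<n. M i (p i)))"
    unfolding det_def by (auto intro!: sum.cong prod.cong)
  then show ?thesis
    by (simp add: detN_def atLeast0LessThan)
qed

lemma detN_nonzero_inverse: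
  assumes "detN n M \<noteq> 0"
  obtains B where "\<And>i k. i < n \<Longrightarrow> k < n \<Longrightarrow> (\<Sum>j<n. B i j * M j k) = (if i = k then 1 else 0)"
    and "\<And>i k. i < n \<Longrightarrow> k < n \<Longrightarrow> (\<Sum>j<n. M i j * B j k) = (if i = k then 1 else 0)"
proof -
  let ?A = "mat n n (\<lambda>(i, j). M i j)"
  have A: "?A \<in> carrier_mat n n" by simp
  have "det ?A \<noteq> 0" using assms by (simp add: detN_eq_det)
  then obtain C where C: "C \<in> carrier_mat n n" "C * ?A = 1\<^sub>m n" "?A * C = 1\<^sub>m n"
    using det_non_zero_imp_unit[OF A, where b = "TYPE(unit)"]
    by (auto simp: Units_def ring_mat_def)
  have 1: "(\<Sum>j<n. C $$ (i, j) * M j k) = (if i = k then 1 else 0)" if "i < n" "k < n" for i k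
  proof -
    have "(C * ?A) $$ (i, k) = (\<Sum>j<n. C $$ (i, j) * M j k)"
      using that C(1) by (auto simp: scalar_prod_def atLeast0LessThan intro!: sum.cong)
    then show ?thesis using C(2) that by simp
  qed
  have 2: "(\<Sum>j<n. M i j * C $$ (j, k)) = (if i = k then 1 else 0)" if "i < n" "k < n" for i k
  proof -
    have "(?A * C) $$ (i, k) = (\<Sum>j<n. M i j * C $$ (j, k))"
      using that C(1) by (auto simp: scalar_prod_def atLeast0LessThan intro!: sum.cong)
    then show ?thesis using C(3) that by simp
  qed
  show thesis
    using 1 2 by (rule that)
qed

text \<open>At the largest coordinate of a kernel vector the diagonal term cannot be cancelled by
  the rest of its row. The dominant diagonal c is kept apart from M because it will be d v_i^(d-1),
  while the lower terms also perturb the diagonal entries.\<close>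

lemma detN_diagonally_dominant:
  assumes dom: "\<And>i. i < n \<Longrightarrow> (\<Sum>j<n. cmod (M i j - (if i = j then c i else 0))) < cmod (c i)"
  shows "detN n M \<noteq> 0"
proof
  assume "detN n M = 0"
  let ?A = "mat n n (\<lambda>(i, j). M i j)"
  have "det ?A = 0" using \<open>detN n M = 0\<close> by (simp add: detN_eq_det)
  then obtain v where v: "v \<in> carrier_vec n" "v \<noteq> 0\<^sub>v n" "?A *\<^sub>v v = 0\<^sub>v n"
    using det_0_iff_vec_prod_zero[of ?A n] by auto
  define w where "w j = Matrix.vec_index v j" for j
  have eq: "(\<Sum>j<n. M i j * w j) = 0" if "i < n" for i
  proof -
    have "Matrix.vec_index (?A *\<^sub>v v) i = (\<Sum>j<n. M i j * w j)"
      using that v(1) by (auto simp: scalar_prod_def w_def atLeast0LessThan intro!: sum.cong)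
    then show ?thesis using v(3) that by simp
  qed
  have "\<exists>j<n. w j \<noteq> 0"
    using v(1,2) by (auto simp: w_def intro!: eq_vecI)
  then have n0: "n > 0" by auto
  define m where "m = Max ((\<lambda>j. cmod (w j)) ` {..<n})"
  have le: "cmod (w j) \<le> m" if "j < n" for j
    unfolding m_def using that by (intro Max_ge) auto
  have "m \<in> (\<lambda>j. cmod (w j)) ` {..<n}"
    unfolding m_def using n0 by (intro Max_in) auto
  then obtain i where i: "i < n" "m = cmod (w i)" by auto
  have m0: "m > 0" using \<open>\<exists>j<n. w j \<noteq> 0\<close> le by (meson less_le_trans zero_less_norm_iff)
  have "(\<Sum>j<n. (M i j - (if i = j then c i else 0)) * w j)
      = (\<Sum>j<n. M i j * w j) - (\<Sum>j<n. (if i = j then c i * w j else 0))"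
    unfolding sum_subtractf[symmetric] by (intro sum.cong) (auto simp: algebra_simps)
  also have "\<dots> = - c i * w i" using eq[OF i(1)] i(1) by simp
  finally have "cmod (c i * w i) = cmod (\<Sum>j<n. (M i j - (if i = j then c i else 0)) * w j)"
    by simp
  also have "\<dots> \<le> (\<Sum>j<n. cmod (M i j - (if i = j then c i else 0)) * m)"
    using le by (intro sum_norm_le) (auto simp: norm_mult intro!: mult_left_mono)
  also have "\<dots> < cmod (c i) * m"
    using dom[OF i(1)] m0 by (simp add: sum_distrib_right[symmetric])
  finally show False using i(2) by (simp add: norm_mult)
qed

section \<open>Points (v, t), iterates and partial derivatives\<close>

definition pt :: "nat \<Rightarrow> (nat \<Rightarrow> complex) \<Rightarrow> complex \<Rightarrow> nat \<Rightarrow> complex" where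
  "pt N v t = (\<lambda>j. if j < N then v j else if j = N then t else 0)"

text \<open>\<open>mapc\<close>, \<open>itc\<close> and \<open>dmapc\<close> are the first \<open>N\<close> coordinates of the map, of its iterates, and their
  partial derivatives, all at the point \<open>pt N v t\<close>.\<close>

definition mapc :: "nat \<Rightarrow> nat \<Rightarrow> (nat \<Rightarrow> (nat \<Rightarrow> nat) \<Rightarrow> complex) \<Rightarrow> (nat \<Rightarrow> complex) \<Rightarrow> complex
    \<Rightarrow> nat \<Rightarrow> complex" where
  "mapc N d a v t i = v i ^ d + (\<Sum>I\<in>IndStar N d. a i I * t ^ I N * (\<Prod>j<N. v j ^ I j))"

text \<open>Partial derivative of the monomial v^I with respect to v_j. For I j = 0 the truncated
  exponent is harmless because the first factor is 0.\<close>

definition dmonc :: "nat \<Rightarrow> (nat \<Rightarrow> nat) \<Rightarrow> (nat \<Rightarrow> complex) \<Rightarrow> nat \<Rightarrow> complex" where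
  "dmonc N I v j = of_nat (I j) * v j ^ (I j - 1) * (\<Prod>l\<in>{..<N} - {j}. v l ^ I l)"

definition dmapc :: "nat \<Rightarrow> nat \<Rightarrow> (nat \<Rightarrow> (nat \<Rightarrow> nat) \<Rightarrow> complex) \<Rightarrow> (nat \<Rightarrow> complex) \<Rightarrow> complex
    \<Rightarrow> nat \<Rightarrow> nat \<Rightarrow> complex" where
  "dmapc N d a v t i j = (if i = j then of_nat d * v i ^ (d - 1) else 0)
     + (\<Sum>I\<in>IndStar N d. a i I * t ^ I N * dmonc N I v j)"

definition itc :: "nat \<Rightarrow> nat \<Rightarrow> (nat \<Rightarrow> (nat \<Rightarrow> nat) \<Rightarrow> complex) \<Rightarrow> nat \<Rightarrow> (nat \<Rightarrow> complex) \<Rightarrow> complex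
    \<Rightarrow> nat \<Rightarrow> complex" where
  "itc N d a n v t = (polymap N d a ^^ n) (pt N v t)"

text \<open>The weight I_N is that of the substitution t -> t / R: the rescaled coefficients a_I /
  R^(I_N) are bounded by 1, and only the product R |t| enters the estimates.\<close>

definition coef_bound :: "nat \<Rightarrow> nat \<Rightarrow> real \<Rightarrow> (nat \<Rightarrow> (nat \<Rightarrow> nat) \<Rightarrow> complex) \<Rightarrow> bool" where
  "coef_bound N d R a \<longleftrightarrow> (\<forall>i<N. \<forall>I\<in>IndStar N d. cmod (a i I) \<le> R ^ I N)"

lemma finite_IndStar: "finite (IndStar N d)"
proof (rule finite_subset)
  show "IndStar N d \<subseteq> {I. \<forall>j. (j \<in> {..N} \<longrightarrow> I j \<in> {..d}) \<and> (j \<notin> {..N} \<longrightarrow> I j = 0)}"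
  proof
    fix I assume I: "I \<in> IndStar N d"
    have "I j \<le> d" if "j \<le> N" for j
      using I member_le_sum[of j "{..N}" I] that by (auto simp: IndStar_def)
    then show "I \<in> {I. \<forall>j. (j \<in> {..N} \<longrightarrow> I j \<in> {..d}) \<and> (j \<notin> {..N} \<longrightarrow> I j = 0)}"
      using I by (auto simp: IndStar_def)
  qed
  show "finite {I::nat\<Rightarrow>nat. \<forall>j. (j \<in> {..N} \<longrightarrow> I j \<in> {..d}) \<and> (j \<notin> {..N} \<longrightarrow> I j = 0)}"
    by (rule finite_set_of_finite_funs) auto
qed

lemma IndStar_sum: "I \<in> IndStar N d \<Longrightarrow> (\<Sum>j<N. I j) + I N = d"
  by (auto simp: IndStar_def lessThan_Suc_atMost[symmetric])

lemma pt_simps [simp]: "j < N \<Longrightarrow> pt N v t j = v j" "pt N v t N = t" "N < j \<Longrightarrow> pt N v t j = 0"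
  by (auto simp: pt_def)

lemma pt_cong: "(\<And>j. j < N \<Longrightarrow> v j = w j) \<Longrightarrow> pt N v t = pt N w t"
  by (auto simp: pt_def)

lemma mono_pt: "mono N I (pt N v t) = t ^ I N * (\<Prod>j<N. v j ^ I j)"
  unfolding mono_def lessThan_Suc_atMost[symmetric] by (simp add: mult.commute)

lemma polymap_pt: "polymap N d a (pt N v t) = pt N (mapc N d a v t) (t ^ d)"
proof
  fix i
  have "(\<Sum>I\<in>IndStar N d. a i I * mono N I (pt N v t)) = (\<Sum>I\<in>IndStar N d. a i I * t ^ I N * (\<Prod>j<N. v j ^ I j))"
    by (simp add: mono_pt mult.assoc)
  then show "polymap N d a (pt N v t) i = pt N (mapc N d a v t) (t ^ d) i"
    unfolding polymap_def by (auto simp: mapc_def pt_def)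
qed

lemma mapc_cong: "(\<And>j. j < N \<Longrightarrow> v j = w j) \<Longrightarrow> i < N \<Longrightarrow> mapc N d a v t i = mapc N d a w t i"
  by (simp add: mapc_def)

lemma itc_0: "i < N \<Longrightarrow> itc N d a 0 v t i = v i"
  by (simp add: itc_def)

lemma itc_Suc: "itc N d a (Suc n) v t = itc N d a n (mapc N d a v t) (t ^ d)"
  by (simp only: itc_def funpow_Suc_right comp_apply polymap_pt)

lemma itc_cong: "(\<And>j. j < N \<Longrightarrow> v j = w j) \<Longrightarrow> itc N d a n v t = itc N d a n w t"
  unfolding itc_def by (subst pt_cong[of N v w]) auto

lemma polymap_funpow_pt: "(polymap N d a ^^ n) (pt N v t) = pt N (itc N d a n v t) (t ^ (d ^ n))"
proof (induction n arbitrary: v t)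
  case 0
  show ?case by (auto simp: itc_def fun_eq_iff pt_def)
next
  case (Suc n)
  have "(polymap N d a ^^ Suc n) (pt N v t) = (polymap N d a ^^ n) (pt N (mapc N d a v t) (t ^ d))"
    by (simp only: funpow_Suc_right comp_apply polymap_pt)
  also have "\<dots> = pt N (itc N d a (Suc n) v t) (t ^ d ^ Suc n)"
    unfolding Suc itc_Suc by (simp add: power_mult[symmetric])
  finally show ?case .
qed

lemma itc_add: "itc N d a (m + n) v t = itc N d a m (itc N d a n v t) (t ^ (d ^ n))"
  unfolding itc_def[of N d a "m + n"] funpow_add comp_apply polymap_funpow_pt[where n = n]
  by (simp only: itc_def[of N d a m])

lemma itc_Suc': "i < N \<Longrightarrow> itc N d a (Suc n) v t i = mapc N d a (itc N d a n v t) (t ^ (d ^ n)) i"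
  using itc_add[of N d a 1 n v t] itc_Suc[of N d a 0 "itc N d a n v t" "t ^ (d ^ n)"] itc_0 by simp

lemma dmonc_has_derivative:
  assumes "\<And>j. j < N \<Longrightarrow> ((\<lambda>s. v s j) has_field_derivative v' j) (at s)"
  shows "((\<lambda>s. \<Prod>j<N. v s j ^ I j) has_field_derivative (\<Sum>j<N. dmonc N I (v s) j * v' j)) (at s)"
proof -
  have "((\<lambda>s. \<Prod>j<N. v s j ^ I j) has_field_derivative
      (\<Sum>j<N. (of_nat (I j) * (v' j * v s j ^ (I j - Suc 0))) * (\<Prod>l\<in>{..<N} - {j}. v s l ^ I l))) (at s)"
    by (rule has_field_derivative_prod) (auto intro!: DERIV_power assms simp: )
  then show ?thesis
    by (simp add: dmonc_def mult_ac)
qed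

lemma mapc_has_derivative:
  assumes v: "\<And>j. j < N \<Longrightarrow> ((\<lambda>s. v s j) has_field_derivative v' j) (at s)" and i: "i < N"
  shows "((\<lambda>s. mapc N d a (v s) t i) has_field_derivative (\<Sum>j<N. dmapc N d a (v s) t i j * v' j)) (at s)"
proof -
  have "((\<lambda>s. mapc N d a (v s) t i) has_field_derivative
      of_nat d * (v' i * v s i ^ (d - Suc 0))
      + (\<Sum>I\<in>IndStar N d. a i I * t ^ I N * (\<Sum>j<N. dmonc N I (v s) j * v' j))) (at s)"
    unfolding mapc_def
    by (intro DERIV_add DERIV_power v i DERIV_sum DERIV_cmult dmonc_has_derivative)
  moreover have "of_nat d * (v' i * v s i ^ (d - Suc 0))
      + (\<Sum>I\<in>IndStar N d. a i I * t ^ I N * (\<Sum>j<N. dmonc N I (v s) j * v' j))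
      = (\<Sum>j<N. dmapc N d a (v s) t i j * v' j)"
  proof -
    have "(\<Sum>j<N. (if i = j then of_nat d * v s i ^ (d - 1) else 0) * v' j) = of_nat d * (v' i * v s i ^ (d - Suc 0))"
    proof -
      have "(\<Sum>j<N. (if i = j then of_nat d * v s i ^ (d - 1) else 0) * v' j)
          = (\<Sum>j<N. if i = j then of_nat d * v s i ^ (d - 1) * v' j else 0)"
        by (intro sum.cong) auto
      then show ?thesis using i by (simp add: mult_ac)
    qed
    moreover have "(\<Sum>I\<in>IndStar N d. a i I * t ^ I N * (\<Sum>j<N. dmonc N I (v s) j * v' j))
       = (\<Sum>j<N. (\<Sum>I\<in>IndStar N d. a i I * t ^ I N * dmonc N I (v s) j) * v' j)"
      unfolding sum_distrib_left sum_distrib_right by (subst sum.swap) (simp add: mult_ac)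
    ultimately show ?thesis
      unfolding dmapc_def by (simp add: distrib_right sum.distrib)
  qed
  ultimately show ?thesis by simp
qed

text \<open>Turns the \<open>deriv\<close> terms of \<open>jac\<close> into the explicit polynomials
  \<open>dmapc\<close>, so that limits, holomorphy and bounds of the Jacobian concern only finite
  sums and products.\<close>

lemma jac_pt: "jac N d a (pt N v t) = detN N (dmapc N d a v t)"
proof -
  have "deriv (\<lambda>s. polymap N d a ((pt N v t)(j := s)) i) (pt N v t j) = dmapc N d a v t i j"
    if ij: "i < N" "j < N" for i j
  proof -
    have "((\<lambda>s. mapc N d a (v(j := s)) t i) has_field_derivative
        (\<Sum>l<N. dmapc N d a (v(j := v j)) t i l * (if l = j then 1 else 0))) (at (v j))"
    proof (rule mapc_has_derivative[where v = "\<lambda>s. v(j := s)"])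
      fix l assume "l < N"
      show "((\<lambda>s. (v(j := s)) l) has_field_derivative (if l = j then 1 else 0)) (at (v j))"
        by (cases "l = j") auto
    qed (use ij in auto)
    then have "((\<lambda>s. mapc N d a (v(j := s)) t i) has_field_derivative dmapc N d a v t i j) (at (v j))"
      using ij by (simp add: if_distrib[of "\<lambda>x. _ * x"] cong: if_cong)
    moreover have "(\<lambda>s. polymap N d a ((pt N v t)(j := s)) i) = (\<lambda>s. mapc N d a (v(j := s)) t i)"
    proof
      fix s
      have "(pt N v t)(j := s) = pt N (v(j := s)) t" using ij by (auto simp: pt_def)
      then show "polymap N d a ((pt N v t)(j := s)) i = mapc N d a (v(j := s)) t i"
        using ij by (simp add: polymap_pt)
    qed
    ultimately show ?thesis using ij by (simp add: DERIV_imp_deriv)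
  qed
  note deriv_eq = this
  have "detN N M = detN N M'" if eq: "\<And>i j. i < N \<Longrightarrow> j < N \<Longrightarrow> M i j = M' i j" for M M'
  proof -
    have "M i (p i) = M' i (p i)" if "p permutes {..<N}" "i < N" for p i
      using permutes_in_image[OF that(1), of i] that eq by auto
    then show ?thesis unfolding detN_def by (intro sum.cong refl) auto
  qed
  from this[OF deriv_eq] show ?thesis unfolding jac_def by simp
qed

section \<open>Joint continuity in coefficients and point, holomorphy along discs\<close>

lemma tendsto_mapc:
  assumes "\<And>I. ((\<lambda>k. a k i I) \<longlongrightarrow> a' i I) G" "\<And>j. j < N \<Longrightarrow> ((\<lambda>k. v k j) \<longlongrightarrow> v' j) G"
    "(t \<longlongrightarrow> t') G" "i < N"
  shows "((\<lambda>k. mapc N d (a k) (v k) (t k) i) \<longlongrightarrow> mapc N d a' v' t' i) G"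
  unfolding mapc_def by (intro tendsto_intros assms) (use assms in auto)

lemma tendsto_dmapc:
  assumes "\<And>I. ((\<lambda>k. a k i I) \<longlongrightarrow> a' i I) G" "\<And>j. j < N \<Longrightarrow> ((\<lambda>k. v k j) \<longlongrightarrow> v' j) G"
    "(t \<longlongrightarrow> t') G" "i < N" "j < N"
  shows "((\<lambda>k. dmapc N d (a k) (v k) (t k) i j) \<longlongrightarrow> dmapc N d a' v' t' i j) G"
proof -
  have *: "((\<lambda>k. if i = j then of_nat d * v k i ^ (d - 1) else (0::complex)) \<longlongrightarrow>
     (if i = j then of_nat d * v' i ^ (d - 1) else 0)) G"
    using assms(2)[OF assms(4)] by (cases "i = j") (auto intro!: tendsto_intros)
  show ?thesis
  unfolding dmapc_def dmonc_def by (intro tendsto_intros assms *) (use assms in auto)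
qed

lemma tendsto_jac:
  assumes "\<And>i I. ((\<lambda>k. a k i I) \<longlongrightarrow> a' i I) G" "\<And>j. j < N \<Longrightarrow> ((\<lambda>k. v k j) \<longlongrightarrow> v' j) G"
    "(t \<longlongrightarrow> t') G"
  shows "((\<lambda>k. jac N d (a k) (pt N (v k) (t k))) \<longlongrightarrow> jac N d a' (pt N v' t')) G"
proof -
  have "p i < N" if "p permutes {..<N}" "i < N" for p i
    using permutes_in_image[OF that(1), of i] that by auto
  then show ?thesis
    unfolding jac_pt detN_def by (intro tendsto_intros tendsto_dmapc assms) auto
qed

lemma tendsto_itc:
  assumes "\<And>i I. ((\<lambda>k. a k i I) \<longlongrightarrow> a' i I) G" "\<And>j. j < N \<Longrightarrow> ((\<lambda>k. v k j) \<longlongrightarrow> v' j) G"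
    "(t \<longlongrightarrow> t') G" "i < N"
  shows "((\<lambda>k. itc N d (a k) n (v k) (t k) i) \<longlongrightarrow> itc N d a' n v' t' i) G"
  using assms
proof (induction n arbitrary: v v' t t')
  case 0
  then show ?case by (simp add: itc_0)
next
  case (Suc n)
  show ?case
    unfolding itc_Suc by (rule Suc.IH) (intro Suc.prems tendsto_mapc tendsto_power | simp)+
qed

lemma holomorphic_mapc:
  assumes "\<And>j. j < N \<Longrightarrow> (\<lambda>s. v s j) holomorphic_on S" "h holomorphic_on S" "i < N"
  shows "(\<lambda>s. mapc N d a (v s) (h s) i) holomorphic_on S"
  unfolding mapc_def by (intro holomorphic_intros assms) (use assms in auto)

lemma holomorphic_jac:
  assumes "\<And>j. j < N \<Longrightarrow> (\<lambda>s. v s j) holomorphic_on S" "h holomorphic_on S"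
  shows "(\<lambda>s. jac N d a (pt N (v s) (h s))) holomorphic_on S"
proof -
  have "p i < N" if "p permutes {..<N}" "i < N" for p i
    using permutes_in_image[OF that(1), of i] that by auto
  moreover have "(\<lambda>s. dmapc N d a (v s) (h s) i j) holomorphic_on S" if "i < N" "j < N" for i j
  proof -
    have *: "(\<lambda>s. if i = j then of_nat d * v s i ^ (d - 1) else (0::complex)) holomorphic_on S"
      using assms(1)[OF that(1)] by (cases "i = j") (auto intro!: holomorphic_intros)
    show ?thesis
      unfolding dmapc_def dmonc_def by (intro holomorphic_intros assms *) (use assms that in auto)
  qed
  ultimately show ?thesis
    unfolding jac_pt detN_def by (intro holomorphic_intros) auto
qed

lemma norm_mult_le_mult:
  fixes x y :: "'a::real_normed_algebra"
  shows "norm x \<le> p \<Longrightarrow> norm y \<le> q \<Longrightarrow> norm (x * y) \<le> p * q"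
  by (meson mult_mono norm_ge_zero norm_mult_ineq order_trans)

lemma norm_prod_power_le:
  fixes v :: "'a \<Rightarrow> complex"
  assumes "\<And>j. j \<in> A \<Longrightarrow> cmod (v j) \<le> M"
  shows "cmod (\<Prod>j\<in>A. v j ^ I j) \<le> M ^ (\<Sum>j\<in>A. I j)"
proof -
  have "cmod (\<Prod>j\<in>A. v j ^ I j) \<le> (\<Prod>j\<in>A. M ^ I j)"
    unfolding prod_norm[symmetric] norm_power
    by (intro prod_mono) (auto intro!: power_mono assms)
  then show ?thesis by (simp add: power_sum)
qed

section \<open>Estimates on fibres\<close>

locale regular_family =
  fixes N d :: nat
  assumes N_pos: "N \<ge> 1" and d_ge_2: "d \<ge> 2"
begin

abbreviation "F \<equiv> mapc N d"
abbreviation "DF \<equiv> dmapc N d"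
abbreviation "it \<equiv> itc N d"
abbreviation "Jac a v t \<equiv> jac N d a (pt N v t)"

text \<open>Counts the lower terms; the extra 1 gives q >= 1 at once and pays for the leading term
  in \<open>dmapc_bound\<close>.\<close>

definition q :: real where "q = real (card (IndStar N d)) + 1"

lemma q_ge_1: "q \<ge> 1" by (simp add: q_def)

lemma coef_power_bound:
  assumes "coef_bound N d R a" "0 \<le> R" "i < N" "I \<in> IndStar N d" "R * cmod t \<le> e"
  shows "cmod (a i I * t ^ I N) \<le> e ^ I N"
proof -
  have "cmod (a i I * t ^ I N) \<le> R ^ I N * cmod t ^ I N"
    using assms by (simp add: norm_mult norm_power coef_bound_def mult_right_mono)
  also have "\<dots> \<le> e ^ I N"
    using assms by (simp add: power_mult_distrib[symmetric] power_mono)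
  finally show ?thesis .
qed

text \<open>Homogeneity of degree d: if R |t| \<le> s M, a lower term is at most s^(I_N) M^d, and
  I_N >= 1 leaves at least one factor s.\<close>

lemma lower_terms_bound:
  assumes a: "coef_bound N d R a" "0 \<le> R" "i < N" and v: "\<And>j. j < N \<Longrightarrow> cmod (v j) \<le> M"
    and t: "R * cmod t \<le> s * M" and s: "0 \<le> s" "s \<le> 1"
  shows "cmod (F a v t i - v i ^ d) \<le> q * s * M ^ d"
proof -
  have M0: "0 \<le> M" using v[OF a(3)] norm_ge_zero order_trans by blast
  have "cmod (a i I * t ^ I N * (\<Prod>j<N. v j ^ I j)) \<le> s * M ^ d" if I: "I \<in> IndStar N d" for I
  proof -
    have "cmod (a i I * t ^ I N * (\<Prod>j<N. v j ^ I j)) \<le> (s * M) ^ I N * M ^ (\<Sum>j<N. I j)"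
      by (intro norm_mult_le_mult coef_power_bound[OF a I t] norm_prod_power_le v) auto
    also have "\<dots> = s ^ I N * M ^ d"
      unfolding IndStar_sum[OF I, symmetric] by (simp add: power_add power_mult_distrib mult_ac)
    also have "s ^ I N \<le> s ^ 1"
      using I s by (intro power_decreasing) (auto simp: IndStar_def)
    then have "s ^ I N * M ^ d \<le> s * M ^ d" using M0 by (simp add: mult_right_mono)
    finally show ?thesis .
  qed
  then have "cmod (F a v t i - v i ^ d) \<le> of_nat (card (IndStar N d)) * (s * M ^ d)"
    unfolding mapc_def by (simp add: sum_norm_bound)
  also have "\<dots> \<le> q * s * M ^ d"
    using M0 s by (simp add: q_def distrib_right)
  finally show ?thesis .
qed

text \<open>Properness of the fibres. If the largest coordinate M exceeded 1, 2 U and 2 q R |t|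
  together, the lower terms would be at most half of M^d, hence M \<le> M^d \<le> 2 U. The bound
  grows only linearly in |t|, which later forces inverse branches on the whole plane to be
  affine.\<close>

lemma fibre_bound:
  assumes a: "coef_bound N d R a" "0 \<le> R" and U: "\<And>i. i < N \<Longrightarrow> cmod (F a v t i) \<le> U"
    and j: "j < N"
  shows "cmod (v j) \<le> max 1 (2 * U) + 2 * q * R * cmod t"
proof -
  define M where "M = Max ((\<lambda>j. cmod (v j)) ` {..<N})"
  have le: "cmod (v j) \<le> M" if "j < N" for j
    unfolding M_def using that by (intro Max_ge) auto
  have "M \<in> (\<lambda>j. cmod (v j)) ` {..<N}"
    unfolding M_def using j by (intro Max_in) auto
  then obtain i where i: "i < N" "M = cmod (v i)" by auto
  have "M \<le> max 1 (2 * U) + 2 * q * R * cmod t"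
  proof (rule ccontr)
    assume "\<not> ?thesis"
    moreover have "0 \<le> 2 * q * R * cmod t" using a q_ge_1 by simp
    ultimately have M: "M > 1" "M > 2 * U" "2 * q * R * cmod t \<le> M" by linarith+
    \<comment> \<open>The ratio s = 1 / (2 q) is chosen so that all lower terms together cost at
      most half of M^d.\<close>
    have "cmod (F a v t i - v i ^ d) \<le> q * (1 / (2 * q)) * M ^ d"
    proof (rule lower_terms_bound[OF a i(1) le])
      show "R * cmod t \<le> 1 / (2 * q) * M"
        using M(3) q_ge_1 by (simp add: field_simps)
    qed (use q_ge_1 in auto)
    then have "cmod (F a v t i - v i ^ d) \<le> M ^ d / 2"
      using q_ge_1 by simp
    moreover have "M ^ d \<le> cmod (F a v t i) + cmod (F a v t i - v i ^ d)"
      unfolding i(2) norm_power[symmetric]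
      using norm_triangle_ineq4[of "F a v t i" "F a v t i - v i ^ d"] by simp
    ultimately have "M ^ d \<le> 2 * U" using U[OF i(1)] by linarith
    moreover have "M ^ 1 \<le> M ^ d" using M d_ge_2 by (intro power_increasing) auto
    ultimately show False using M by simp
  qed
  then show ?thesis using le[OF j] by linarith
qed

lemma dmonc_bound:
  assumes I: "I \<in> IndStar N d" and v: "\<And>j. j < N \<Longrightarrow> cmod (v j) \<le> M" and M: "1 \<le> M" and j: "j < N"
  shows "cmod (dmonc N I v j) \<le> real d * M ^ d"
proof -
  have "I j \<le> d" using IndStar_sum[OF I] member_le_sum[of j "{..<N}" I] j by auto
  have "cmod (dmonc N I v j) \<le> real (I j) * M ^ (I j - 1) * M ^ (\<Sum>l\<in>{..<N} - {j}. I l)"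
    unfolding dmonc_def
    by (intro norm_mult_le_mult norm_prod_power_le) (auto intro!: v power_mono simp: norm_power j)
  also have "\<dots> \<le> real d * M ^ (I j) * M ^ (\<Sum>l\<in>{..<N} - {j}. I l)"
    using M \<open>I j \<le> d\<close> by (intro mult_mono power_increasing) auto
  also have "\<dots> = real d * M ^ (\<Sum>l<N. I l)"
    using j by (simp add: sum.remove[of "{..<N}" j] power_add)
  also have "\<dots> \<le> real d * M ^ d"
    using M IndStar_sum[OF I] by (intro mult_left_mono power_increasing) auto
  finally show ?thesis .
qed

lemma dmapc_lower_bound:
  assumes a: "coef_bound N d R a" "0 \<le> R" and ij: "i < N" "j < N" and v: "\<And>j. j < N \<Longrightarrow> cmod (v j) \<le> M"
    and M: "1 \<le> M" and t: "R * cmod t \<le> e" "e \<le> 1"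
  shows "cmod (DF a v t i j - (if i = j then of_nat d * v i ^ (d - 1) else 0)) \<le> q * (e * (real d * M ^ d))"
proof -
  have e0: "0 \<le> e" using t a by (meson mult_nonneg_nonneg norm_ge_zero order_trans)
  have "cmod (a i I * t ^ I N * dmonc N I v j) \<le> e * (real d * M ^ d)" if I: "I \<in> IndStar N d" for I
  proof -
    have "e ^ I N \<le> e ^ 1"
      using I t e0 by (intro power_decreasing) (auto simp: IndStar_def)
    then have "cmod (a i I * t ^ I N) \<le> e" using coef_power_bound[OF a ij(1) I t(1)] by simp
    then show ?thesis by (intro norm_mult_le_mult dmonc_bound[OF I v M ij(2)])
  qed
  then have "cmod (DF a v t i j - (if i = j then of_nat d * v i ^ (d - 1) else 0))
      \<le> of_nat (card (IndStar N d)) * (e * (real d * M ^ d))"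
    unfolding dmapc_def by (simp add: sum_norm_bound)
  also have "\<dots> \<le> q * (e * (real d * M ^ d))"
    using e0 M by (simp add: q_def distrib_right)
  finally show ?thesis .
qed

text \<open>Crude bound when R |t| need not be small, with e^(I_N) estimated by e^d. It serves to
  make the Jacobians a bounded family for \<open>hurwitz_pointwise\<close>.\<close>

lemma dmapc_bound:
  assumes a: "coef_bound N d R a" "0 \<le> R" and ij: "i < N" "j < N" and v: "\<And>j. j < N \<Longrightarrow> cmod (v j) \<le> M"
    and M: "1 \<le> M" and t: "R * cmod t \<le> e" "1 \<le> e"
  shows "cmod (DF a v t i j) \<le> (q + 1) * (e ^ d * (real d * M ^ d))"
proof -
  have "cmod (a i I * t ^ I N * dmonc N I v j) \<le> e ^ d * (real d * M ^ d)" if I: "I \<in> IndStar N d" for I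
  proof -
    have "e ^ I N \<le> e ^ d"
      using I t by (intro power_increasing) (auto simp: IndStar_def)
    then have "cmod (a i I * t ^ I N) \<le> e ^ d" using coef_power_bound[OF a ij(1) I t(1)] by simp
    then show ?thesis by (intro norm_mult_le_mult dmonc_bound[OF I v M ij(2)])
  qed
  then have 1: "cmod (\<Sum>I\<in>IndStar N d. a i I * t ^ I N * dmonc N I v j)
      \<le> of_nat (card (IndStar N d)) * (e ^ d * (real d * M ^ d))"
    by (simp add: sum_norm_bound)
  have "cmod (of_nat d * v i ^ (d - 1)) \<le> real d * M ^ (d - 1)"
    by (intro norm_mult_le_mult) (auto simp: norm_power ij intro!: power_mono v)
  also have "\<dots> \<le> 1 * (real d * M ^ d)" using M by (simp add: power_increasing mult_left_mono)
  also have "\<dots> \<le> e ^ d * (real d * M ^ d)" using M t by (intro mult_right_mono one_le_power) auto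
  finally have 2: "cmod (if i = j then of_nat d * v i ^ (d - 1) else 0) \<le> e ^ d * (real d * M ^ d)"
    using M t by auto
  have "cmod (DF a v t i j) \<le> e ^ d * (real d * M ^ d) + of_nat (card (IndStar N d)) * (e ^ d * (real d * M ^ d))"
    unfolding dmapc_def by (rule order_trans[OF norm_triangle_ineq add_mono[OF 2 1]])
  also have "\<dots> = q * (e ^ d * (real d * M ^ d))" by (simp add: q_def distrib_right)
  also have "\<dots> \<le> (q + 1) * (e ^ d * (real d * M ^ d))" using M t by (intro mult_right_mono) auto
  finally show ?thesis .
qed

lemma jac_bound:
  assumes a: "coef_bound N d R a" "0 \<le> R" and v: "\<And>j. j < N \<Longrightarrow> cmod (v j) \<le> M"
    and M: "1 \<le> M" and t: "R * cmod t \<le> e" "1 \<le> e"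
  shows "cmod (Jac a v t) \<le> fact N * ((q + 1) * (e ^ d * (real d * M ^ d))) ^ N"
proof -
  let ?C = "(q + 1) * (e ^ d * (real d * M ^ d))"
  have "cmod (of_int (sign p) * (\<Prod>i<N. DF a v t i (p i))) \<le> ?C ^ N" if p: "p permutes {..<N}" for p
  proof -
    have "p i < N" if "i < N" for i using permutes_in_image[OF p, of i] that by auto
    then have "cmod (\<Prod>i<N. DF a v t i (p i)) \<le> (\<Prod>i<N. ?C)"
      unfolding prod_norm[symmetric] by (intro prod_mono) (auto intro!: dmapc_bound[OF a _ _ v M t])
    then show ?thesis by (simp add: norm_mult sign_def)
  qed
  then have "cmod (Jac a v t) \<le> of_nat (card {p. p permutes {..<N}}) * ?C ^ N"
    unfolding jac_pt detN_def by (intro sum_norm_bound) auto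
  then show ?thesis by (simp add: card_permutations)
qed

text \<open>The diagonal d v_i^(d-1) dominates: its modulus is at least d / 10, because |v_i|^(d-1)
  >= |v_i|^d / 5, while the row sums of the perturbation are at most 1/10.\<close>

lemma jac_nonzero_near:
  assumes a: "coef_bound N d R a" "0 \<le> R"
    and v: "\<And>j. j < N \<Longrightarrow> cmod (v j) \<le> 5" "\<And>j. j < N \<Longrightarrow> 1 / 2 \<le> cmod (v j) ^ d"
    and t: "R * cmod t \<le> e" "real N * (q * (e * (real d * 5 ^ d))) \<le> 1 / 10"
  shows "Jac a v t \<noteq> 0"
proof -
  have e0: "0 \<le> e" using t a by (meson mult_nonneg_nonneg norm_ge_zero order_trans)
  have e1: "e \<le> 1"
  proof -
    have "1 * (1 * (e * (1 * 1))) \<le> real N * (q * (e * (real d * 5 ^ d)))"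
      using N_pos d_ge_2 q_ge_1 e0 by (intro mult_mono) auto
    then show ?thesis using t by simp
  qed
  show ?thesis unfolding jac_pt
  proof (rule detN_diagonally_dominant[where c = "\<lambda>i. of_nat d * v i ^ (d - 1)"])
    fix i assume i: "i < N"
    have "(\<Sum>j<N. cmod (DF a v t i j - (if i = j then of_nat d * v i ^ (d - 1) else 0)))
        \<le> of_nat (card {..<N}) * (q * (e * (real d * 5 ^ d)))"
      using i e1 by (intro sum_bounded_above dmapc_lower_bound[OF a _ _ v(1) _ t(1)]) auto
    also have "\<dots> \<le> 1 / 10" using t by simp
    also have "\<dots> < real d * (1 / 10)" using d_ge_2 by simp
    also have "1 / 10 \<le> cmod (v i) ^ (d - 1)"
    proof -
      have "1 / 2 \<le> cmod (v i) ^ (d - 1) * cmod (v i)"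
        using v(2)[OF i] d_ge_2 by (metis One_nat_def Suc_pred less_le_trans pos2 power_Suc2)
      also have "\<dots> \<le> cmod (v i) ^ (d - 1) * 5" using v(1)[OF i] by (intro mult_left_mono) auto
      finally show ?thesis by simp
    qed
    then have "real d * (1 / 10) \<le> cmod (of_nat d * v i ^ (d - 1))"
      unfolding norm_mult norm_power norm_of_nat by (intro mult_left_mono) auto
    finally show "(\<Sum>j<N. cmod (DF a v t i j - (if i = j then of_nat d * v i ^ (d - 1) else 0)))
        < cmod (of_nat d * v i ^ (d - 1))" .
  qed
qed

end

section \<open>Lifting discs\<close>

lemma bounded_sequence_extract:
  fixes v :: "nat \<Rightarrow> nat \<Rightarrow> complex"
  assumes "\<And>k j. j < n \<Longrightarrow> cmod (v k j) \<le> C"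
  obtains s v' where "strict_mono (s :: nat \<Rightarrow> nat)" "\<And>j. j < n \<Longrightarrow> (\<lambda>k. v (s k) j) \<longlonglongrightarrow> v' j"
  using assms
proof (induction n arbitrary: thesis)
  case 0
  show ?case by (rule 0(1)[of id]) (auto simp: strict_mono_def)
next
  case (Suc n)
  obtain s v' where s: "strict_mono (s :: nat \<Rightarrow> nat)" "\<And>j. j < n \<Longrightarrow> (\<lambda>k. v (s k) j) \<longlonglongrightarrow> v' j"
    using Suc.IH Suc.prems(2) by (metis less_SucI)
  have "bounded (range (\<lambda>k. v (s k) n))"
    using Suc.prems(2) by (auto simp: bounded_iff)
  then obtain l r where r: "strict_mono (r :: nat \<Rightarrow> nat)" "((\<lambda>k. v (s k) n) \<circ> r) \<longlonglongrightarrow> l"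
    using bounded_imp_convergent_subsequence by blast
  show ?case
  proof (rule Suc.prems(1)[of "s \<circ> r" "v'(n := l)"])
    show "strict_mono (s \<circ> r)" using s r by (simp add: strict_mono_o)
    show "(\<lambda>k. v ((s \<circ> r) k) j) \<longlonglongrightarrow> (v'(n := l)) j" if "j < Suc n" for j
      using that r(2) LIMSEQ_subseq_LIMSEQ[OF s(2) r(1)] by (cases "j = n") (auto simp: o_def)
  qed
qed

text \<open>Montel's theorem for one coordinate at a time, each time passing to a further
  subsequence. The limits are recorded pointwise; \<open>hurwitz_pointwise\<close> recovers local
  uniformity where it is needed.\<close>

lemma montel_tuple:
  fixes f :: "nat \<Rightarrow> nat \<Rightarrow> complex \<Rightarrow> complex"
  assumes S: "open S" and hol: "\<And>k j. j < n \<Longrightarrow> f k j holomorphic_on S"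
    and bd: "\<And>k j z. j < n \<Longrightarrow> z \<in> S \<Longrightarrow> cmod (f k j z) \<le> C"
  obtains s g where "strict_mono (s :: nat \<Rightarrow> nat)" "\<And>j. j < n \<Longrightarrow> g j holomorphic_on S"
    "\<And>j z. j < n \<Longrightarrow> z \<in> S \<Longrightarrow> (\<lambda>k. f (s k) j z) \<longlonglongrightarrow> g j z"
  using hol bd
proof (induction n arbitrary: thesis)
  case 0
  show ?case by (rule 0(1)[of id]) (auto simp: strict_mono_def)
next
  case (Suc n)
  obtain s g where s: "strict_mono (s :: nat \<Rightarrow> nat)" "\<And>j. j < n \<Longrightarrow> g j holomorphic_on S"
    "\<And>j z. j < n \<Longrightarrow> z \<in> S \<Longrightarrow> (\<lambda>k. f (s k) j z) \<longlonglongrightarrow> g j z"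
    using Suc.IH[OF _ Suc.prems(2,3)] by (metis less_SucI)
  obtain h r where h: "h holomorphic_on S" "strict_mono (r :: nat \<Rightarrow> nat)"
    "\<And>x. x \<in> S \<Longrightarrow> ((\<lambda>k. f (s (r k)) n x) \<longlongrightarrow> h x) sequentially"
    by (rule Montel[OF S, of "range (\<lambda>k. f (s k) n)" "\<lambda>k. f (s k) n"])
      (use Suc.prems(2,3) in \<open>auto intro!: exI[of _ C]\<close>)
  show ?case
  proof (rule Suc.prems(1)[of "s \<circ> r" "g(n := h)"])
    show "strict_mono (s \<circ> r)" using s h by (simp add: strict_mono_o)
    show "(g(n := h)) j holomorphic_on S" if "j < Suc n" for j
      using that s(2) h(1) by (cases "j = n") auto
    show "(\<lambda>k. f ((s \<circ> r) k) j z) \<longlonglongrightarrow> (g(n := h)) j z" if "j < Suc n" "z \<in> S" for j z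
      using that h(3) LIMSEQ_subseq_LIMSEQ[OF s(3) h(2)] by (cases "j = n") (auto simp: o_def)
  qed
qed

section \<open>Implicit functions on the fibres over a moving target\<close>

context regular_family
begin

text \<open>The target u is parametrized by the last coordinate z of the source. A disc \<eta> in
  the image therefore enters as u(z) = \<eta>(z^d), because the map sends z to z^d.\<close>

definition fibre :: "(nat \<Rightarrow> (nat \<Rightarrow> nat) \<Rightarrow> complex) \<Rightarrow> (nat \<Rightarrow> complex \<Rightarrow> complex) \<Rightarrow> complex
    \<Rightarrow> (nat \<Rightarrow> complex) \<Rightarrow> bool" where
  "fibre a u z v \<longleftrightarrow> (\<forall>i<N. F a v z i = u i z)"

lemma fibre_cong: "(\<And>j. j < N \<Longrightarrow> v j = w j) \<Longrightarrow> fibre a u z v \<longleftrightarrow> fibre a u z w"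
  unfolding fibre_def using mapc_cong[of N v w] by metis

text \<open>Simplified Newton method: B is the inverse of the derivative at (v0, z0) and stays
  fixed, so v - B (F v - u) contracts by 1/2 in a small box. The estimate is stated for differences,
  where the target u cancels. Injectivity of B makes the fixed points exactly the points of the
  fibre.\<close>

lemma newton_contraction:
  assumes J: "Jac a v0 z0 \<noteq> 0"
  obtains B \<epsilon> where "\<epsilon> > 0"
    "\<And>v w z C i. \<lbrakk>\<And>j. j < N \<Longrightarrow> cmod (v j - v0 j) \<le> \<epsilon>; \<And>j. j < N \<Longrightarrow> cmod (w j - v0 j) \<le> \<epsilon>;
       cmod (z - z0) \<le> \<epsilon>; \<And>j. j < N \<Longrightarrow> cmod (v j - w j) \<le> C; i < N\<rbrakk>
       \<Longrightarrow> cmod ((v i - w i) - (\<Sum>j<N. B i j * (F a v z j - F a w z j))) \<le> C / 2"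
    "\<And>x i. (\<And>i. i < N \<Longrightarrow> (\<Sum>j<N. B i j * x j) = 0) \<Longrightarrow> i < N \<Longrightarrow> x i = 0"
proof -
  obtain B where B1: "\<And>i k. i < N \<Longrightarrow> k < N \<Longrightarrow> (\<Sum>j<N. B i j * DF a v0 z0 j k) = (if i = k then 1 else 0)"
    and B2: "\<And>i k. i < N \<Longrightarrow> k < N \<Longrightarrow> (\<Sum>j<N. DF a v0 z0 i j * B j k) = (if i = k then 1 else 0)"
    using detN_nonzero_inverse[of N "DF a v0 z0"] J unfolding jac_pt by blast
  define E where "E v z i l = (if i = l then 1 else 0) - (\<Sum>j<N. B i j * DF a v z j l)" for v z i l
  \<comment> \<open>The sum of all entries bounds every row sum and is a single continuous quantity
    that vanishes at (v0, z0).\<close>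
  define S where "S v z = (\<Sum>i<N. \<Sum>l<N. cmod (E v z i l))" for v z
  have "\<exists>\<epsilon>>0. \<forall>v z. (\<forall>j<N. cmod (v j - v0 j) \<le> \<epsilon>) \<longrightarrow> cmod (z - z0) \<le> \<epsilon> \<longrightarrow> S v z \<le> 1 / 2"
  proof (rule ccontr)
    assume "\<not> ?thesis"
    then have "\<forall>k. \<exists>v z. (\<forall>j<N. cmod (v j - v0 j) \<le> inverse (real (Suc k))) \<and> cmod (z - z0) \<le> inverse (real (Suc k)) \<and> S v z > 1 / 2"
      by (metis inverse_positive_iff_positive not_le of_nat_0_less_iff zero_less_Suc)
    then obtain v z where vz: "\<And>k j. j < N \<Longrightarrow> cmod (v k j - v0 j) \<le> inverse (real (Suc k))"
      "\<And>k. cmod (z k - z0) \<le> inverse (real (Suc k))" "\<And>k. S (v k) (z k) > 1 / 2"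
      by metis
    have v: "(\<lambda>k. v k j) \<longlonglongrightarrow> v0 j" if "j < N" for j
      by (rule LIM_zero_cancel, rule Lim_null_comparison[OF _ LIMSEQ_inverse_real_of_nat])
        (use vz(1)[OF that] in simp)
    have z: "z \<longlonglongrightarrow> z0"
      by (rule LIM_zero_cancel, rule Lim_null_comparison[OF _ LIMSEQ_inverse_real_of_nat])
        (use vz(2) in simp)
    have "(\<lambda>k. S (v k) (z k)) \<longlonglongrightarrow> S v0 z0"
      unfolding S_def E_def by (intro tendsto_intros tendsto_dmapc v z) auto
    moreover have "S v0 z0 = 0" unfolding S_def E_def using B1 by simp
    ultimately have "(\<lambda>k. S (v k) (z k)) \<longlonglongrightarrow> 0" by simp
    then have "1 / 2 \<le> (0::real)"
      by (rule LIMSEQ_le_const) (use vz(3) less_imp_le in blast)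
    then show False by simp
  qed
  then obtain \<epsilon> where \<epsilon>: "\<epsilon> > 0"
    "\<And>v z. (\<And>j. j < N \<Longrightarrow> cmod (v j - v0 j) \<le> \<epsilon>) \<Longrightarrow> cmod (z - z0) \<le> \<epsilon> \<Longrightarrow> S v z \<le> 1 / 2"
    by blast
  show thesis
  proof (rule that[OF \<epsilon>(1)])
    fix v w z C i
    assume v: "\<And>j. j < N \<Longrightarrow> cmod (v j - v0 j) \<le> \<epsilon>" and w: "\<And>j. j < N \<Longrightarrow> cmod (w j - v0 j) \<le> \<epsilon>"
      and z: "cmod (z - z0) \<le> \<epsilon>" and C: "\<And>j. j < N \<Longrightarrow> cmod (v j - w j) \<le> C" and i: "i < N"
    \<comment> \<open>The segment from w to v gets a complex parameter, so that the mean value bound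
      for complex derivatives applies to \<phi>.\<close>
    define \<gamma> where "\<gamma> s l = w l + s * (v l - w l)" for s l
    define \<phi> where "\<phi> s = \<gamma> s i - (\<Sum>j<N. B i j * F a (\<gamma> s) z j)" for s
    have C0: "0 \<le> C" using C[OF i] norm_ge_zero order_trans by blast
    have d: "(\<phi> has_field_derivative (\<Sum>l<N. E (\<gamma> s) z i l * (v l - w l))) (at s)" for s
    proof -
      have \<gamma>: "((\<lambda>s. \<gamma> s l) has_field_derivative (v l - w l)) (at s)" for l
        unfolding \<gamma>_def by (auto intro!: derivative_eq_intros)
      have "(\<phi> has_field_derivative (v i - w i) - (\<Sum>j<N. B i j * (\<Sum>l<N. DF a (\<gamma> s) z j l * (v l - w l)))) (at s)"
        unfolding \<phi>_def by (intro DERIV_diff DERIV_sum DERIV_cmult mapc_has_derivative \<gamma>) auto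
      moreover have "(\<Sum>l<N. E (\<gamma> s) z i l * (v l - w l))
        = (\<Sum>l<N. (if i = l then 1 else 0) * (v l - w l)) - (\<Sum>l<N. (\<Sum>j<N. B i j * DF a (\<gamma> s) z j l) * (v l - w l))"
        unfolding E_def by (simp add: left_diff_distrib sum_subtractf)
      moreover have "(\<Sum>l<N. (if i = l then 1 else 0) * (v l - w l)) = v i - w i"
        using i by (simp add: if_distrib[of "\<lambda>x. x * _"] cong: if_cong)
      moreover have "(\<Sum>l<N. (\<Sum>j<N. B i j * DF a (\<gamma> s) z j l) * (v l - w l))
         = (\<Sum>j<N. B i j * (\<Sum>l<N. DF a (\<gamma> s) z j l * (v l - w l)))"
        unfolding sum_distrib_left sum_distrib_right by (subst sum.swap) (simp add: mult_ac)
      ultimately show ?thesis by simp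
    qed
    have "cmod (\<phi> 1 - \<phi> 0) \<le> C / 2 * cmod (1 - 0)"
    proof (rule field_differentiable_bound[where S = "closed_segment 0 1"])
      fix s :: complex assume "s \<in> closed_segment 0 1"
      then obtain r where r: "s = of_real r" "0 \<le> r" "r \<le> 1"
        by (auto simp: closed_segment_def scaleR_conv_of_real)
      show "(\<phi> has_field_derivative (\<Sum>l<N. E (\<gamma> s) z i l * (v l - w l))) (at s within closed_segment 0 1)"
        using d by (rule has_field_derivative_at_within)
      have "cmod (\<gamma> s j - v0 j) \<le> \<epsilon>" if "j < N" for j
      proof -
        have "\<gamma> s j - v0 j = of_real (1 - r) * (w j - v0 j) + of_real r * (v j - v0 j)"
          unfolding \<gamma>_def r by (simp add: algebra_simps)
        also have "cmod \<dots> \<le> (1 - r) * \<epsilon> + r * \<epsilon>"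
          using r v[OF that] w[OF that]
          by (intro norm_triangle_le add_mono) (auto simp: norm_mult intro!: mult_left_mono simp del: of_real_diff)
        finally show ?thesis by (simp add: algebra_simps)
      qed
      then have S: "S (\<gamma> s) z \<le> 1 / 2" using \<epsilon>(2)[OF _ z] by blast
      have "cmod (\<Sum>l<N. E (\<gamma> s) z i l * (v l - w l)) \<le> (\<Sum>l<N. cmod (E (\<gamma> s) z i l) * C)"
        by (intro sum_norm_le) (auto simp: norm_mult intro!: mult_left_mono C)
      also have "\<dots> = (\<Sum>l<N. cmod (E (\<gamma> s) z i l)) * C" by (simp add: sum_distrib_right)
      also have "\<dots> \<le> S (\<gamma> s) z * C"
        unfolding S_def using i C0
        by (intro mult_right_mono member_le_sum[of i "{..<N}" "\<lambda>i. \<Sum>l<N. cmod (E (\<gamma> s) z i l)"]) (auto intro: sum_nonneg)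
      also have "\<dots> \<le> 1 / 2 * C" using S C0 by (rule mult_right_mono)
      finally show "cmod (\<Sum>l<N. E (\<gamma> s) z i l * (v l - w l)) \<le> C / 2" by simp
    qed auto
    moreover have "\<phi> 1 - \<phi> 0 = (v i - w i) - (\<Sum>j<N. B i j * (F a v z j - F a w z j))"
    proof -
      have "\<gamma> 1 = v" "\<gamma> 0 = w" by (auto simp: \<gamma>_def)
      then show ?thesis unfolding \<phi>_def by (simp add: right_diff_distrib sum_subtractf)
    qed
    ultimately show "cmod ((v i - w i) - (\<Sum>j<N. B i j * (F a v z j - F a w z j))) \<le> C / 2" by simp
  next
    fix x i assume x: "\<And>i. i < N \<Longrightarrow> (\<Sum>j<N. B i j * x j) = 0" and i: "i < N"
    have "0 = (\<Sum>l<N. DF a v0 z0 i l * (\<Sum>j<N. B l j * x j))" using x by simp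
    also have "\<dots> = (\<Sum>j<N. (\<Sum>l<N. DF a v0 z0 i l * B l j) * x j)"
      unfolding sum_distrib_left sum_distrib_right by (subst sum.swap) (simp add: mult_ac)
    also have "\<dots> = (\<Sum>j<N. if i = j then x j else 0)"
      using i by (intro sum.cong) (auto simp: B2)
    also have "\<dots> = x i" using i by simp
    finally show "x i = 0" by simp
  qed
qed

text \<open>Holomorphic implicit function theorem with uniqueness in the whole closed box of size
  \<epsilon>. The Newton iterates are holomorphic in z and bounded, so Montel's theorem makes their
  limit holomorphic.\<close>

lemma local_section:
  assumes u: "\<And>i. i < N \<Longrightarrow> u i holomorphic_on ball 0 \<rho>" and z0: "z0 \<in> ball 0 \<rho>"
    and fib: "fibre a u z0 v0" and J: "Jac a v0 z0 \<noteq> 0"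
  obtains \<epsilon> \<kappa> s where "\<epsilon> > 0" "\<kappa> > 0" "ball z0 \<kappa> \<subseteq> ball 0 \<rho>" "\<And>i. i < N \<Longrightarrow> s i holomorphic_on ball z0 \<kappa>"
    "\<And>z v. \<lbrakk>z \<in> ball z0 \<kappa>; \<And>i. i < N \<Longrightarrow> cmod (v i - v0 i) \<le> \<epsilon>\<rbrakk> \<Longrightarrow> fibre a u z v \<longleftrightarrow> (\<forall>i<N. v i = s i z)"
    "\<And>z i. z \<in> ball z0 \<kappa> \<Longrightarrow> i < N \<Longrightarrow> cmod (s i z - v0 i) \<le> \<epsilon>"
proof -
  obtain B \<epsilon> where \<epsilon>: "\<epsilon> > 0" and contr:
    "\<And>v w z C i. \<lbrakk>\<And>j. j < N \<Longrightarrow> cmod (v j - v0 j) \<le> \<epsilon>; \<And>j. j < N \<Longrightarrow> cmod (w j - v0 j) \<le> \<epsilon>;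
       cmod (z - z0) \<le> \<epsilon>; \<And>j. j < N \<Longrightarrow> cmod (v j - w j) \<le> C; i < N\<rbrakk>
       \<Longrightarrow> cmod ((v i - w i) - (\<Sum>j<N. B i j * (F a v z j - F a w z j))) \<le> C / 2"
    and inj: "\<And>x i. (\<And>i. i < N \<Longrightarrow> (\<Sum>j<N. B i j * x j) = 0) \<Longrightarrow> i < N \<Longrightarrow> x i = 0"
    by (rule newton_contraction[OF J]) blast
  define T where "T z v i = v i - (\<Sum>j<N. B i j * (F a v z j - u j z))" for z v i
  have T_contr: "cmod (T z v i - T z w i) \<le> C / 2"
    if "\<And>j. j < N \<Longrightarrow> cmod (v j - v0 j) \<le> \<epsilon>" "\<And>j. j < N \<Longrightarrow> cmod (w j - v0 j) \<le> \<epsilon>"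
       "cmod (z - z0) \<le> \<epsilon>" "\<And>j. j < N \<Longrightarrow> cmod (v j - w j) \<le> C" "i < N" for z v w C i
  proof -
    have "T z v i - T z w i = (v i - w i) - (\<Sum>j<N. B i j * (F a v z j - F a w z j))"
      unfolding T_def by (simp add: algebra_simps sum_subtractf)
    then show ?thesis using contr[OF that] by simp
  qed
  have T_fix: "(\<forall>i<N. T z v i = v i) \<longleftrightarrow> fibre a u z v" for z v
    unfolding fibre_def using inj[of "\<lambda>j. F a v z j - u j z"] by (auto simp: T_def)
  have ev: "\<forall>\<^sub>F z in nhds z0. \<forall>i\<in>{..<N}. cmod (T z v0 i - v0 i) < \<epsilon> / 2"
  proof (intro eventually_ball_finite ballI)
    fix i assume i: "i \<in> {..<N}"
    have uc: "(u j \<longlongrightarrow> u j z0) (nhds z0)" if "j < N" for j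
      using holomorphic_on_imp_continuous_on[OF u[OF that]] z0
      by (simp add: continuous_on_eq_continuous_at isCont_def tendsto_at_iff_tendsto_nhds)
    have id: "((\<lambda>z. z) \<longlongrightarrow> z0) (nhds z0)" by (rule filterlim_ident)
    have "((\<lambda>z. T z v0 i - v0 i) \<longlongrightarrow> T z0 v0 i - v0 i) (nhds z0)"
      unfolding T_def by (intro tendsto_intros tendsto_mapc uc id) auto
    then have "((\<lambda>z. T z v0 i - v0 i) \<longlongrightarrow> 0) (nhds z0)"
      using T_fix[of z0 v0] fib i by auto
    from tendstoD[OF this, of "\<epsilon> / 2"] show "\<forall>\<^sub>F z in nhds z0. cmod (T z v0 i - v0 i) < \<epsilon> / 2"
      using \<epsilon> by simp
  qed auto
  have "\<forall>\<^sub>F z in nhds z0. z \<in> ball 0 \<rho>" using z0 by (intro eventually_nhds_in_open) auto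
  from eventually_conj[OF ev this] obtain \<kappa>' where \<kappa>': "\<kappa>' > 0"
    "\<And>z. dist z z0 < \<kappa>' \<Longrightarrow> (\<forall>i\<in>{..<N}. cmod (T z v0 i - v0 i) < \<epsilon> / 2) \<and> z \<in> ball 0 \<rho>"
    unfolding eventually_nhds_metric by blast
  define \<kappa> where "\<kappa> = min \<epsilon> \<kappa>'"
  have \<kappa>: "\<kappa> > 0" "\<kappa> \<le> \<epsilon>" using \<epsilon> \<kappa>' by (auto simp: \<kappa>_def)
  have start: "cmod (T z v0 i - v0 i) \<le> \<epsilon> / 2" if "z \<in> ball z0 \<kappa>" "i < N" for z i
    using \<kappa>'(2)[of z] that by (auto simp: \<kappa>_def dist_commute less_imp_le)
  have sub: "ball z0 \<kappa> \<subseteq> ball 0 \<rho>" using \<kappa>'(2) by (auto simp: \<kappa>_def dist_commute)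
  have zle: "cmod (z - z0) \<le> \<epsilon>" if "z \<in> ball z0 \<kappa>" for z
    using that \<kappa> by (auto simp: dist_norm norm_minus_commute)
  define X where "X = rec_nat (\<lambda>z. v0) (\<lambda>_ X z. T z (X z))"
  have X0: "X 0 z = v0" and XS: "X (Suc k) z = T z (X k z)" for k z
    by (auto simp: X_def)
  \<comment> \<open>The first step moves by at most \<epsilon>/2 and the bounds on the later ones
    halve each time, so the iterates never leave the box where the contraction holds.\<close>
  have X: "(\<forall>i<N. cmod (X k z i - v0 i) \<le> \<epsilon> * (1 - 1 / 2 ^ k)) \<and> (\<forall>i<N. cmod (X (Suc k) z i - X k z i) \<le> \<epsilon> / 2 ^ Suc k)"
    if z: "z \<in> ball z0 \<kappa>" for k z
  proof (induction k)
    case 0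
    show ?case using start[OF z] by (simp add: X0 XS)
  next
    case (Suc k)
    have box: "cmod (X (Suc k) z i - v0 i) \<le> \<epsilon> * (1 - 1 / 2 ^ Suc k)" if "i < N" for i
    proof -
      have "cmod (X (Suc k) z i - v0 i) \<le> \<epsilon> / 2 ^ Suc k + \<epsilon> * (1 - 1 / 2 ^ k)"
        using norm_triangle_ineq[of "X (Suc k) z i - X k z i" "X k z i - v0 i"] Suc that
        by (simp add: ) (smt (verit))
      also have "\<dots> = \<epsilon> * (1 - 1 / 2 ^ Suc k)" by (simp add: field_simps)
      finally show ?thesis .
    qed
    have le: "\<epsilon> * (1 - 1 / 2 ^ k) \<le> \<epsilon>" for k :: nat using \<epsilon> by (simp add: algebra_simps)
    have "cmod (T z (X (Suc k) z) i - T z (X k z) i) \<le> (\<epsilon> / 2 ^ Suc k) / 2" if "i < N" for i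
      by (rule T_contr[OF _ _ zle[OF z] _ that]) (use Suc box le order_trans in blast)+
    then show ?case using box by (simp add: XS)
  qed
  have Xbox: "cmod (X k z i - v0 i) \<le> \<epsilon>" if "z \<in> ball z0 \<kappa>" "i < N" for k z i
  proof -
    have "\<epsilon> * (1 - 1 / 2 ^ k) \<le> \<epsilon>" using \<epsilon> by (simp add: algebra_simps)
    then show ?thesis using X[OF that(1), of k] that(2) by (meson order_trans)
  qed
  have Xhol: "(\<lambda>z. X k z i) holomorphic_on ball z0 \<kappa>" if "i < N" for k i
    using that
  proof (induction k arbitrary: i)
    case 0
    show ?case by (simp add: X0)
  next
    case (Suc k)
    show ?case
      unfolding XS T_def
      by (intro holomorphic_intros holomorphic_mapc Suc holomorphic_on_subset[OF u sub]) auto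
  qed
  obtain r s where r: "strict_mono (r :: nat \<Rightarrow> nat)" and shol: "\<And>i. i < N \<Longrightarrow> s i holomorphic_on ball z0 \<kappa>"
    and lim: "\<And>i z. i < N \<Longrightarrow> z \<in> ball z0 \<kappa> \<Longrightarrow> (\<lambda>k. X (r k) z i) \<longlonglongrightarrow> s i z"
  proof (rule montel_tuple[of "ball z0 \<kappa>" N "\<lambda>k i z. X k z i" "Max ((\<lambda>i. cmod (v0 i)) ` {..<N}) + \<epsilon>"])
    fix k i z assume "i < N" "z \<in> ball z0 \<kappa>"
    moreover have "cmod (v0 i) \<le> Max ((\<lambda>i. cmod (v0 i)) ` {..<N})" using \<open>i < N\<close> by (intro Max_ge) auto
    ultimately show "cmod (X k z i) \<le> Max ((\<lambda>i. cmod (v0 i)) ` {..<N}) + \<epsilon>"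
      using Xbox[of z i k] norm_triangle_ineq[of "X k z i - v0 i" "v0 i"]
      unfolding diff_add_cancel by linarith
  qed (use Xhol in auto)
  have sbox: "cmod (s i z - v0 i) \<le> \<epsilon>" if "z \<in> ball z0 \<kappa>" "i < N" for z i
    by (rule Lim_norm_ubound[of sequentially "\<lambda>k. X (r k) z i - v0 i"])
      (use lim[OF that(2,1)] Xbox[OF that] in \<open>auto intro!: tendsto_intros\<close>)
  have sfix: "T z (\<lambda>i. s i z) i = s i z" if z: "z \<in> ball z0 \<kappa>" and i: "i < N" for z i
  proof -
    have "(\<lambda>k. T z (X (r k) z) i) \<longlonglongrightarrow> T z (\<lambda>i. s i z) i"
      unfolding T_def by (intro tendsto_intros tendsto_mapc lim z i) auto
    \<comment> \<open>Convergence is known along r only, while T produces X (Suc (r k)). The steps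
      tend to 0, so both sequences have the same limit.\<close>
    moreover have "(\<lambda>k. X (Suc (r k)) z i - X (r k) z i) \<longlonglongrightarrow> 0"
    proof (rule Lim_null_comparison)
      show "\<forall>\<^sub>F k in sequentially. norm (X (Suc (r k)) z i - X (r k) z i) \<le> \<epsilon> * (1 / 2) ^ Suc (r k)"
        using X[OF z] i by (simp add: power_one_over)
      have "(\<lambda>k. \<epsilon> * (1 / 2) ^ Suc k) \<longlonglongrightarrow> \<epsilon> * 0"
        by (intro tendsto_intros LIMSEQ_Suc LIMSEQ_power_zero) auto
      from LIMSEQ_subseq_LIMSEQ[OF this r] show "(\<lambda>k. \<epsilon> * (1 / 2) ^ Suc (r k)) \<longlonglongrightarrow> 0"
        by (simp add: o_def)
    qed
    from tendsto_add[OF this lim[OF i z]] have "(\<lambda>k. X (Suc (r k)) z i) \<longlonglongrightarrow> s i z" by simp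
    ultimately show ?thesis unfolding XS using LIMSEQ_unique by blast
  qed
  show thesis
  proof (rule that[OF \<epsilon> \<kappa>(1) sub shol _ sbox])
    fix z v assume z: "z \<in> ball z0 \<kappa>" and v: "\<And>i. i < N \<Longrightarrow> cmod (v i - v0 i) \<le> \<epsilon>"
    show "fibre a u z v \<longleftrightarrow> (\<forall>i<N. v i = s i z)"
    proof
      assume "fibre a u z v"
      then have Tv: "\<And>i. i < N \<Longrightarrow> T z v i = v i" using T_fix by blast
      \<comment> \<open>Two fixed points in the box differ by at most 2 \<epsilon>, and each
        application of T halves this bound.\<close>
      have "\<forall>i<N. cmod (v i - s i z) \<le> 2 * \<epsilon> * (1 / 2) ^ k" for k
      proof (induction k)
        case 0
        show ?case
          using v sbox[OF z] norm_triangle_ineq4[of "v i - v0 i" "s i z - v0 i" for i]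
          by simp (smt (verit))
      next
        case (Suc k)
        have "cmod (T z v i - T z (\<lambda>i. s i z) i) \<le> (2 * \<epsilon> * (1 / 2) ^ k) / 2" if "i < N" for i
          by (rule T_contr[OF v sbox[OF z] zle[OF z] _ that]) (use Suc in auto)
        then show ?case using Tv sfix[OF z] by simp
      qed
      moreover have "(\<lambda>k. 2 * \<epsilon> * (1 / 2) ^ k) \<longlonglongrightarrow> 2 * \<epsilon> * 0"
        by (intro tendsto_intros LIMSEQ_power_zero) auto
      ultimately have "cmod (v i - s i z) \<le> 0" if "i < N" for i
        using that LIMSEQ_le_const[of "\<lambda>k. 2 * \<epsilon> * (1 / 2) ^ k" 0 "cmod (v i - s i z)"] by simp
      then show "\<forall>i<N. v i = s i z" by simp
    next
      assume "\<forall>i<N. v i = s i z"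
      then have "fibre a u z v \<longleftrightarrow> fibre a u z (\<lambda>i. s i z)" by (intro fibre_cong) auto
      then show "fibre a u z v" using T_fix sfix[OF z] by blast
    qed
  qed
qed

section \<open>Lifts of discs: uniqueness, continuation, existence\<close>

definition is_lift :: "(nat \<Rightarrow> (nat \<Rightarrow> nat) \<Rightarrow> complex) \<Rightarrow> (nat \<Rightarrow> complex \<Rightarrow> complex) \<Rightarrow> complex set
    \<Rightarrow> (nat \<Rightarrow> complex \<Rightarrow> complex) \<Rightarrow> bool" where
  "is_lift a u S \<xi> \<longleftrightarrow> (\<forall>i<N. \<xi> i holomorphic_on S) \<and> (\<forall>z\<in>S. fibre a u z (\<lambda>i. \<xi> i z))"

lemma is_lift_subset: "is_lift a u S \<xi> \<Longrightarrow> T \<subseteq> S \<Longrightarrow> is_lift a u T \<xi>"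
  unfolding is_lift_def by (meson holomorphic_on_subset subsetD)

text \<open>Near p both lifts coincide with the local section, by its uniqueness in a box; the
  identity theorem carries the equality through the connected set S.\<close>

lemma lift_unique:
  assumes u: "\<And>i. i < N \<Longrightarrow> u i holomorphic_on ball 0 \<rho>"
    and J: "\<And>z v. z \<in> ball 0 \<rho> \<Longrightarrow> fibre a u z v \<Longrightarrow> Jac a v z \<noteq> 0"
    and S: "open S" "connected S" "S \<subseteq> ball 0 \<rho>"
    and l: "is_lift a u S \<xi>" "is_lift a u S \<eta>" and p: "p \<in> S" "\<And>i. i < N \<Longrightarrow> \<xi> i p = \<eta> i p"
    and z: "z \<in> S" "i < N"
  shows "\<xi> i z = \<eta> i z"
proof -
  have p\<rho>: "p \<in> ball 0 \<rho>" and fp: "fibre a u p (\<lambda>i. \<xi> i p)"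
    using p S l by (auto simp: is_lift_def)
  obtain \<epsilon> \<kappa> s where s: "\<epsilon> > 0" "\<kappa> > 0"
    "\<And>z v. \<lbrakk>z \<in> ball p \<kappa>; \<And>i. i < N \<Longrightarrow> cmod (v i - \<xi> i p) \<le> \<epsilon>\<rbrakk> \<Longrightarrow> fibre a u z v \<longleftrightarrow> (\<forall>i<N. v i = s i z)"
    by (rule local_section[OF u p\<rho> fp J[OF p\<rho> fp]]) blast+
  have near: "\<forall>\<^sub>F z in nhds p. \<forall>i\<in>{..<N}. dist (\<zeta> i z) (\<xi> i p) < \<epsilon>"
    if "is_lift a u S \<zeta>" "\<And>i. i < N \<Longrightarrow> \<zeta> i p = \<xi> i p" for \<zeta>
  proof (intro eventually_ball_finite ballI)
    fix i assume i: "i \<in> {..<N}"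
    then have "continuous_on S (\<zeta> i)"
      using that by (auto simp: is_lift_def holomorphic_on_imp_continuous_on)
    then have "isCont (\<zeta> i) p" using continuous_on_eq_continuous_at[OF S(1)] p(1) by blast
    then have "(\<zeta> i \<longlongrightarrow> \<xi> i p) (nhds p)"
      using that(2)[of i] i by (simp add: isCont_def tendsto_at_iff_tendsto_nhds)
    then show "\<forall>\<^sub>F z in nhds p. dist (\<zeta> i z) (\<xi> i p) < \<epsilon>" using s(1) tendstoD by blast
  qed auto
  have "\<forall>\<^sub>F z in nhds p. z \<in> S \<inter> ball p \<kappa>" using p S s by (intro eventually_nhds_in_open) auto
  from eventually_conj[OF this eventually_conj[OF near[OF l(1)] near[OF l(2)]]] p(2)
  obtain W where W: "open W" "p \<in> W"
    "\<And>z. z \<in> W \<Longrightarrow> z \<in> S \<inter> ball p \<kappa> \<and> (\<forall>i\<in>{..<N}. dist (\<xi> i z) (\<xi> i p) < \<epsilon>) \<and> (\<forall>i\<in>{..<N}. dist (\<eta> i z) (\<xi> i p) < \<epsilon>)"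
    unfolding eventually_nhds by (smt (verit))
  have "\<xi> i z = \<eta> i z" if zW: "z \<in> W" for z
  proof -
    have "\<forall>i<N. \<xi> i z = s i z"
      using s(3)[of z "\<lambda>i. \<xi> i z"] W(3)[OF zW] l(1) by (auto simp: is_lift_def dist_norm less_imp_le)
    moreover have "\<forall>i<N. \<eta> i z = s i z"
      using s(3)[of z "\<lambda>i. \<eta> i z"] W(3)[OF zW] l(2) by (auto simp: is_lift_def dist_norm less_imp_le)
    ultimately show ?thesis using z by simp
  qed
  then show ?thesis
    using analytic_continuation_open[of W S "\<xi> i" "\<eta> i" z] W S z l by (auto simp: is_lift_def)
qed

text \<open>By \<open>fibre_bound\<close> the fibre points over |z| \<le> r form a compact set, so
  local sections exist with one common radius. This rules out a lift that breaks off inside the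
  disc.\<close>

lemma uniform_section:
  assumes a: "coef_bound N d R a" "0 \<le> R"
    and u: "\<And>i. i < N \<Longrightarrow> u i holomorphic_on ball 0 \<rho>"
    and J: "\<And>z v. z \<in> ball 0 \<rho> \<Longrightarrow> fibre a u z v \<Longrightarrow> Jac a v z \<noteq> 0" and r: "r < \<rho>"
  shows "\<exists>\<kappa>>0. \<forall>z v. cmod z \<le> r \<longrightarrow> fibre a u z v \<longrightarrow>
    ball z \<kappa> \<subseteq> ball 0 \<rho> \<and> (\<exists>s. is_lift a u (ball z \<kappa>) s \<and> (\<forall>i<N. s i z = v i))"
proof -
  define P where "P \<kappa> z v \<longleftrightarrow> ball z \<kappa> \<subseteq> ball 0 \<rho> \<and> (\<exists>s. is_lift a u (ball z \<kappa>) s \<and> (\<forall>i<N. s i z = v i))" for \<kappa> z v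
  have "\<exists>\<kappa>>0. \<forall>z v. cmod z \<le> r \<longrightarrow> fibre a u z v \<longrightarrow> P \<kappa> z v"
  proof (rule ccontr)
    assume "\<not> ?thesis"
    then have "\<forall>k. \<exists>z v. cmod z \<le> r \<and> fibre a u z v \<and> \<not> P (inverse (real (Suc k))) z v"
      by (metis inverse_positive_iff_positive of_nat_0_less_iff zero_less_Suc)
    then obtain z v where zv: "\<And>k. cmod (z k) \<le> r" "\<And>k. fibre a u (z k) (v k)"
      "\<And>k. \<not> P (inverse (real (Suc k))) (z k) (v k)" by metis
    have r0: "0 \<le> r" using zv(1)[of 0] norm_ge_zero order_trans by blast
    have sub: "cball 0 r \<subseteq> ball 0 \<rho>" using r by auto
    have "\<exists>U. \<forall>i\<in>{..<N}. \<forall>z\<in>cball 0 r. cmod (u i z) \<le> U"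
    proof -
      have "\<exists>U. \<forall>z\<in>cball 0 r. cmod (u i z) \<le> U" if "i < N" for i
      proof -
        have "compact (u i ` cball 0 r)"
          by (rule compact_continuous_image[OF holomorphic_on_imp_continuous_on[OF holomorphic_on_subset[OF u[OF that] sub]]]) auto
        then have "bounded (u i ` cball 0 r)" by (rule compact_imp_bounded)
        then show ?thesis by (simp add: bounded_iff)
      qed
      then have "\<forall>i. \<exists>U. i < N \<longrightarrow> (\<forall>z\<in>cball 0 r. cmod (u i z) \<le> U)" by blast
      from choice[OF this] obtain U where U: "\<forall>i. i < N \<longrightarrow> (\<forall>z\<in>cball 0 r. cmod (u i z) \<le> U i)" ..
      have "cmod (u i z) \<le> Max (U ` {..<N})" if "i < N" "z \<in> cball 0 r" for i z
      proof -
        have "cmod (u i z) \<le> U i" using U that by blast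
        also have "U i \<le> Max (U ` {..<N})" using that by (intro Max_ge) auto
        finally show ?thesis .
      qed
      then show ?thesis by blast
    qed
    then obtain U where U: "\<And>i z. i < N \<Longrightarrow> cmod z \<le> r \<Longrightarrow> cmod (u i z) \<le> U"
      unfolding lessThan_iff mem_cball_0 Ball_def by blast
    define C where "C = max 1 (2 * U) + 2 * q * R * r + r"
    have C: "cmod (v k j) \<le> C" if "j < N" for k j
    proof -
      have "cmod (v k j) \<le> max 1 (2 * U) + 2 * q * R * cmod (z k)"
        by (rule fibre_bound[OF a _ that]) (use zv(2)[of k] U[OF _ zv(1)[of k]] in \<open>simp add: fibre_def\<close>)
      also have "\<dots> \<le> max 1 (2 * U) + 2 * q * R * r"
        using zv(1) q_ge_1 a by (intro add_mono mult_left_mono) auto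
      finally show ?thesis using r0 by (simp add: C_def)
    qed
    \<comment> \<open>v k and z k are packed into one tuple, so that a single extraction makes both
      converge.\<close>
    define w where "w k j = (if j < N then v k j else z k)" for k j
    have w: "cmod (w k j) \<le> C" if "j < Suc N" for k j
    proof (cases "j < N")
      case False
      have "0 \<le> 2 * q * R * r" using q_ge_1 a r0 by simp
      moreover have "1 \<le> max 1 (2 * U)" by simp
      ultimately have "r \<le> C" unfolding C_def by linarith
      then show ?thesis using False zv(1)[of k] by (simp add: w_def)
    qed (simp add: w_def C)
    obtain s w' where s: "strict_mono (s :: nat \<Rightarrow> nat)" "\<And>j. j < Suc N \<Longrightarrow> (\<lambda>k. w (s k) j) \<longlonglongrightarrow> w' j"
      by (rule bounded_sequence_extract[of "Suc N" w C]) (use w in auto)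
    define z' where "z' = w' N"
    have zlim: "(\<lambda>k. z (s k)) \<longlonglongrightarrow> z'" using s(2)[of N] by (simp add: w_def z'_def)
    have vlim: "(\<lambda>k. v (s k) j) \<longlonglongrightarrow> w' j" if "j < N" for j using s(2)[of j] that by (simp add: w_def)
    have z'r: "cmod z' \<le> r" by (rule Lim_norm_ubound[OF _ zlim]) (use zv in auto)
    have z'\<rho>: "z' \<in> ball 0 \<rho>" using z'r r by auto
    have fib: "fibre a u z' w'"
      unfolding fibre_def
    proof (intro allI impI)
      fix i assume i: "i < N"
      have c: "isCont (u i) z'"
        by (rule continuous_on_interior[OF holomorphic_on_imp_continuous_on[OF u[OF i]]]) (use z'\<rho> in \<open>simp add: interior_open\<close>)
      have 1: "(\<lambda>k. u i (z (s k))) \<longlonglongrightarrow> u i z'"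
        by (rule isCont_tendsto_compose[where g = "u i" and f = "\<lambda>k. z (s k)", OF c zlim])
      have 2: "(\<lambda>k. F a (v (s k)) (z (s k)) i) \<longlonglongrightarrow> F a w' z' i"
        by (rule tendsto_mapc) (use vlim zlim i in auto)
      have "F a (v (s k)) (z (s k)) i = u i (z (s k))" for k
        using zv(2) i by (simp add: fibre_def)
      then have "(\<lambda>k. F a (v (s k)) (z (s k)) i) \<longlonglongrightarrow> u i z'" using 1 by simp
      with 2 show "F a w' z' i = u i z'" by (rule LIMSEQ_unique)
    qed
    obtain \<epsilon> \<kappa> \<sigma> where \<sigma>: "\<epsilon> > 0" "\<kappa> > 0" "ball z' \<kappa> \<subseteq> ball 0 \<rho>" "\<And>i. i < N \<Longrightarrow> \<sigma> i holomorphic_on ball z' \<kappa>"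
      "\<And>z v. \<lbrakk>z \<in> ball z' \<kappa>; \<And>i. i < N \<Longrightarrow> cmod (v i - w' i) \<le> \<epsilon>\<rbrakk> \<Longrightarrow> fibre a u z v \<longleftrightarrow> (\<forall>i<N. v i = \<sigma> i z)"
      "\<And>z i. z \<in> ball z' \<kappa> \<Longrightarrow> i < N \<Longrightarrow> cmod (\<sigma> i z - w' i) \<le> \<epsilon>"
      by (rule local_section[OF u z'\<rho> fib J[OF z'\<rho> fib]]) blast+
    have l: "is_lift a u (ball z' \<kappa>) \<sigma>"
      unfolding is_lift_def
    proof (intro conjI allI impI ballI)
      fix y assume "y \<in> ball z' \<kappa>"
      then show "fibre a u y (\<lambda>i. \<sigma> i y)" using \<sigma>(5)[of y "\<lambda>i. \<sigma> i y"] \<sigma>(6) by blast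
    qed (rule \<sigma>(4))
    have "\<forall>\<^sub>F k in sequentially. dist (v (s k) j) (w' j) < \<epsilon>" if "j < N" for j
      by (rule tendstoD[OF vlim[OF that] \<sigma>(1)])
    then have ev1: "\<forall>\<^sub>F k in sequentially. \<forall>j\<in>{..<N}. dist (v (s k) j) (w' j) < \<epsilon>"
      by (simp add: eventually_ball_finite_distrib)
    have \<kappa>2: "0 < \<kappa> / 2" using \<sigma>(2) by simp
    have ev2: "\<forall>\<^sub>F k in sequentially. dist (z (s k)) z' < \<kappa> / 2"
      by (rule tendstoD[OF zlim \<kappa>2])
    have ev3: "\<forall>\<^sub>F k in sequentially. inverse (real (Suc k)) < \<kappa> / 2"
      by (rule order_tendstoD(2)[OF LIMSEQ_inverse_real_of_nat \<kappa>2])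
    from eventually_happens'[OF sequentially_bot eventually_conj[OF ev1 eventually_conj[OF ev2 ev3]]] obtain k where
      "(\<forall>j\<in>{..<N}. dist (v (s k) j) (w' j) < \<epsilon>) \<and> dist (z (s k)) z' < \<kappa> / 2 \<and> inverse (real (Suc k)) < \<kappa> / 2" ..
    then have k: "\<And>j. j < N \<Longrightarrow> dist (v (s k) j) (w' j) < \<epsilon>" "dist (z (s k)) z' < \<kappa> / 2"
        "inverse (real (Suc k)) < \<kappa> / 2"
      by auto
    have le: "inverse (real (Suc (s k))) \<le> inverse (real (Suc k))"
      using seq_suble[OF s(1), of k] by (simp add: le_imp_inverse_le)
    then have sub2: "ball (z (s k)) (inverse (real (Suc (s k)))) \<subseteq> ball z' \<kappa>"
    proof (intro subsetI)
      fix y assume "y \<in> ball (z (s k)) (inverse (real (Suc (s k))))"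
      then have "dist (z (s k)) y < inverse (real (Suc (s k)))" by (simp only: mem_ball)
      then have "dist (z (s k)) y < \<kappa> / 2" using k(3) le by linarith
      then show "y \<in> ball z' \<kappa>"
        using k(2) dist_triangle[of z' y "z (s k)"] by (simp add: dist_commute)
    qed
    have zk: "z (s k) \<in> ball z' \<kappa>" using k \<sigma>(2) by (auto simp: dist_commute)
    have "fibre a u (z (s k)) (v (s k)) \<longleftrightarrow> (\<forall>i<N. v (s k) i = \<sigma> i (z (s k)))"
      by (rule \<sigma>(5)[OF zk]) (use k(1) in \<open>simp add: dist_norm less_imp_le\<close>)
    then have eq: "\<forall>i<N. \<sigma> i (z (s k)) = v (s k) i" using zv(2)[of "s k"] by simp
    \<comment> \<open>The section at the limit point, restricted to the small ball, passes through a
      point that was assumed to have no such section.\<close>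
    have "P (inverse (real (Suc (s k)))) (z (s k)) (v (s k))"
      unfolding P_def
      by (rule conjI[OF subset_trans[OF sub2 \<sigma>(3)] exI[of _ \<sigma>]]) (rule conjI[OF is_lift_subset[OF l sub2] eq])
    with zv(3)[of "s k"] show False by contradiction
  qed
  then show ?thesis unfolding P_def .
qed

text \<open>Local sections at the points of the old ball are glued. Two of them agree on their
  overlap: the midpoint of their centres lies in both balls and in the old one, where both equal
  \<xi>, and an intersection of balls is connected.\<close>

lemma lift_extend:
  assumes u: "\<And>i. i < N \<Longrightarrow> u i holomorphic_on ball 0 \<rho>"
    and J: "\<And>z v. z \<in> ball 0 \<rho> \<Longrightarrow> fibre a u z v \<Longrightarrow> Jac a v z \<noteq> 0"
    and sec: "\<And>z v. cmod z \<le> r \<Longrightarrow> fibre a u z v \<Longrightarrow> ball z \<kappa> \<subseteq> ball 0 \<rho> \<and> (\<exists>s. is_lift a u (ball z \<kappa>) s \<and> (\<forall>i<N. s i z = v i))"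
    and \<kappa>: "\<kappa> > 0" and s: "0 < s" "s \<le> s'" "s' \<le> r" "s' \<le> s + \<kappa> / 2" and r: "r < \<rho>" and l: "is_lift a u (ball 0 s) \<xi>"
  shows "\<exists>\<eta>. is_lift a u (ball 0 s') \<eta> \<and> (\<forall>i<N. \<eta> i 0 = \<xi> i 0)"
proof -
  have "\<exists>\<sigma>. is_lift a u (ball p \<kappa>) \<sigma> \<and> (\<forall>i<N. \<sigma> i p = \<xi> i p) \<and> ball p \<kappa> \<subseteq> ball 0 \<rho>"
    if "p \<in> ball 0 s" for p
  proof -
    have "cmod p \<le> r" "fibre a u p (\<lambda>i. \<xi> i p)" using that l s by (auto simp: is_lift_def)
    from sec[OF this] show ?thesis by blast
  qed
  then have "\<forall>p\<in>ball 0 s. \<exists>\<sigma>. is_lift a u (ball p \<kappa>) \<sigma> \<and> (\<forall>i<N. \<sigma> i p = \<xi> i p) \<and> ball p \<kappa> \<subseteq> ball 0 \<rho>"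
    by blast
  from bchoice[OF this] obtain \<sigma> where "\<forall>p\<in>ball 0 s. is_lift a u (ball p \<kappa>) (\<sigma> p) \<and>
      (\<forall>i<N. \<sigma> p i p = \<xi> i p) \<and> ball p \<kappa> \<subseteq> ball 0 \<rho>" ..
  then have \<sigma>: "\<And>p. p \<in> ball 0 s \<Longrightarrow> is_lift a u (ball p \<kappa>) (\<sigma> p)"
    "\<And>p i. p \<in> ball 0 s \<Longrightarrow> i < N \<Longrightarrow> \<sigma> p i p = \<xi> i p"
    "\<And>p::complex. p \<in> ball 0 s \<Longrightarrow> ball p \<kappa> \<subseteq> ball 0 \<rho>"
    by blast+
  have s\<rho>: "ball 0 s \<subseteq> ball (0::complex) \<rho>" using s r by auto
  have eq\<xi>: "\<sigma> p i z = \<xi> i z" if p: "p \<in> ball 0 s" and z: "z \<in> ball p \<kappa> \<inter> ball 0 s" and i: "i < N" for p z i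
  proof (rule lift_unique[OF u J _ _ _ _ _ _ _ z i, where p = p and \<xi> = "\<sigma> p" and \<eta> = \<xi>])
    show "connected (ball p \<kappa> \<inter> ball 0 s)" by (intro convex_connected convex_Int convex_ball)
    show "is_lift a u (ball p \<kappa> \<inter> ball 0 s) (\<sigma> p)" "is_lift a u (ball p \<kappa> \<inter> ball 0 s) \<xi>"
      using is_lift_subset[OF \<sigma>(1)[OF p]] is_lift_subset[OF l] by auto
    show "ball p \<kappa> \<inter> ball 0 s \<subseteq> ball 0 \<rho>" using s\<rho> by blast
    show "p \<in> ball p \<kappa> \<inter> ball 0 s" using p \<kappa> by simp
    show "\<sigma> p i p = \<xi> i p" if "i < N" for i using \<sigma>(2)[OF p that] .
  qed auto
  have overlap: "\<sigma> p i z = \<sigma> p' i z"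
    if p: "p \<in> ball 0 s" "p' \<in> ball 0 s" and z: "z \<in> ball p \<kappa> \<inter> ball p' \<kappa>" and i: "i < N" for p p' z i
  proof (rule lift_unique[OF u J _ _ _ _ _ _ _ z i, where p = "midpoint p p'" and \<xi> = "\<sigma> p" and \<eta> = "\<sigma> p'"])
    have "dist p p' < 2 * \<kappa>"
      using z dist_triangle2[of p p' z] by (auto simp: dist_commute)
    then have m: "midpoint p p' \<in> ball p \<kappa> \<inter> ball p' \<kappa>"
      by (simp add: dist_midpoint)
    moreover have "midpoint p p' \<in> ball 0 s"
      using p convex_contains_segment[of "ball 0 s"] midpoint_in_closed_segment[of p p'] convex_ball by blast
    ultimately show "\<sigma> p i (midpoint p p') = \<sigma> p' i (midpoint p p')" if "i < N" for i
      using eq\<xi> p that by simp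
    show "midpoint p p' \<in> ball p \<kappa> \<inter> ball p' \<kappa>" by (rule m)
    show "connected (ball p \<kappa> \<inter> ball p' \<kappa>)" by (intro convex_connected convex_Int convex_ball)
    show "is_lift a u (ball p \<kappa> \<inter> ball p' \<kappa>) (\<sigma> p)" "is_lift a u (ball p \<kappa> \<inter> ball p' \<kappa>) (\<sigma> p')"
      using is_lift_subset[OF \<sigma>(1)[OF p(1)]] is_lift_subset[OF \<sigma>(1)[OF p(2)]] by auto
    show "ball p \<kappa> \<inter> ball p' \<kappa> \<subseteq> ball 0 \<rho>" using \<sigma>(3)[OF p(1)] by blast
  qed auto
  \<comment> \<open>Shrinking by s / s' assigns to each point of the larger ball a centre in the old
    ball at distance at most s' - s < \<kappa>.\<close>
  define c where "c z = of_real (s / s') * z" for z :: complex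
  have c: "c z \<in> ball 0 s \<and> z \<in> ball (c z) \<kappa>" if z: "z \<in> ball 0 s'" for z
  proof
    have "cmod (c z) = s / s' * cmod z" unfolding c_def using s by (simp add: norm_mult norm_divide)
    also have "\<dots> < s / s' * s'" using z s by (intro mult_strict_left_mono) auto
    finally show "c z \<in> ball 0 s" using s by simp
    have "c z - z = of_real (s / s' - 1) * z" unfolding c_def by (simp add: algebra_simps)
    then have "dist (c z) z = (1 - s / s') * cmod z"
      unfolding dist_norm using s by (simp add: norm_mult abs_if del: of_real_diff of_real_divide)
    also have "\<dots> \<le> (1 - s / s') * s'" using z s by (intro mult_left_mono) auto
    also have "\<dots> = s' - s" using s by (simp add: field_simps)
    also have "\<dots> < \<kappa>" using s \<kappa> by linarith
    finally show "z \<in> ball (c z) \<kappa>" by simp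
  qed
  define \<eta> where "\<eta> i z = \<sigma> (c z) i z" for i z
  have \<eta>: "\<eta> i z = \<sigma> (c w) i z" if "z \<in> ball 0 s' \<inter> ball (c w) \<kappa>" "w \<in> ball 0 s'" "i < N" for i z w
    unfolding \<eta>_def using that c by (intro overlap) auto
  have hol: "\<eta> i holomorphic_on ball 0 s'" if i: "i < N" for i
    unfolding holomorphic_on_open[OF open_ball]
  proof (intro ballI)
    fix w :: complex assume w: "w \<in> ball 0 s'"
    have "\<sigma> (c w) i holomorphic_on ball (c w) \<kappa>" using \<sigma>(1) c[OF w] i by (auto simp: is_lift_def)
    then obtain D where "(\<sigma> (c w) i has_field_derivative D) (at w)"
      using c[OF w] unfolding holomorphic_on_open[OF open_ball] by blast
    then have "(\<eta> i has_field_derivative D) (at w)"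
      by (rule has_field_derivative_transform_within_open[where S = "ball 0 s' \<inter> ball (c w) \<kappa>"])
        (use w c[OF w] \<eta> i in auto)
    then show "\<exists>D. (\<eta> i has_field_derivative D) (at w)" by blast
  qed
  have "fibre a u z (\<lambda>i. \<eta> i z)" if "z \<in> ball 0 s'" for z
    unfolding \<eta>_def using \<sigma>(1) c[OF that] by (auto simp: is_lift_def)
  moreover have "\<eta> i 0 = \<xi> i 0" if "i < N" for i
    unfolding \<eta>_def c_def using \<sigma>(2)[of 0 i] that s by simp
  ultimately show ?thesis using hol unfolding is_lift_def by blast
qed

text \<open>Steps of the uniform length \<kappa> / 2 reach any r < \<rho> after finitely many
  extensions, and uniqueness lets the lifts for all r < \<rho> be combined into one.\<close>

lemma lift_exists:
  assumes a: "coef_bound N d R a" "0 \<le> R"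
    and u: "\<And>i. i < N \<Longrightarrow> u i holomorphic_on ball 0 \<rho>" and \<rho>: "0 < \<rho>"
    and J: "\<And>z v. z \<in> ball 0 \<rho> \<Longrightarrow> fibre a u z v \<Longrightarrow> Jac a v z \<noteq> 0" and x: "fibre a u 0 x"
  shows "\<exists>\<xi>. is_lift a u (ball 0 \<rho>) \<xi> \<and> (\<forall>i<N. \<xi> i 0 = x i)"
proof -
  have *: "\<exists>\<xi>. is_lift a u (ball 0 r) \<xi> \<and> (\<forall>i<N. \<xi> i 0 = x i)" if r: "0 < r" "r < \<rho>" for r
  proof -
    from uniform_section[where u = u, OF a u J r(2)] obtain \<kappa> where \<kappa>: "\<kappa> > 0"
      "\<forall>z v. cmod z \<le> r \<longrightarrow> fibre a u z v \<longrightarrow> ball z \<kappa> \<subseteq> ball 0 \<rho> \<and> (\<exists>s. is_lift a u (ball z \<kappa>) s \<and> (\<forall>i<N. s i z = v i))"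
      by auto
    have sec: "ball z \<kappa> \<subseteq> ball 0 \<rho> \<and> (\<exists>s. is_lift a u (ball z \<kappa>) s \<and> (\<forall>i<N. s i z = v i))"
      if "cmod z \<le> r" "fibre a u z v" for z v using \<kappa>(2)[rule_format, OF that] .
    have steps: "\<exists>\<xi>. is_lift a u (ball 0 (min r (real (Suc m) * (\<kappa> / 2)))) \<xi> \<and> (\<forall>i<N. \<xi> i 0 = x i)" for m
    proof (induction m)
      case 0
      have "cmod 0 \<le> r" using r by simp
      from sec[OF this x] obtain s where s: "is_lift a u (ball 0 \<kappa>) s" "\<forall>i<N. s i 0 = x i" by blast
      have "ball 0 (min r (real (Suc 0) * (\<kappa> / 2))) \<subseteq> ball (0::complex) \<kappa>" using \<kappa>(1) by (intro subset_ball) simp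
      from is_lift_subset[OF s(1) this]
      have "is_lift a u (ball 0 (min r (real (Suc 0) * (\<kappa> / 2)))) s" .
      then show ?case using s by blast
    next
      case (Suc m)
      then obtain \<xi> where \<xi>: "is_lift a u (ball 0 (min r (real (Suc m) * (\<kappa> / 2)))) \<xi>" "\<forall>i<N. \<xi> i 0 = x i"
        by blast
      define A where "A = real (Suc m) * (\<kappa> / 2)"
      have A: "0 < A" "real (Suc (Suc m)) * (\<kappa> / 2) = A + \<kappa> / 2"
        using \<kappa>(1) by (simp_all add: A_def field_simps add_pos_nonneg)
      have "\<exists>\<eta>. is_lift a u (ball 0 (min r (real (Suc (Suc m)) * (\<kappa> / 2)))) \<eta> \<and> (\<forall>i<N. \<eta> i 0 = \<xi> i 0)"
        unfolding A(2)
        by (rule lift_extend[where u = u, OF u J sec \<kappa>(1) _ _ _ _ r(2) \<xi>(1)[folded A_def]])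
          (use r \<kappa>(1) A(1) in \<open>auto simp: min_def\<close>)
      then show ?case using \<xi>(2) by auto
    qed
    obtain m where "r < real m * (\<kappa> / 2)" using reals_Archimedean3[of "\<kappa> / 2"] \<kappa>(1) half_gt_zero by blast
    then have "min r (real (Suc m) * (\<kappa> / 2)) = r" using \<kappa>(1) by (simp add: algebra_simps)
    then show ?thesis using steps[of m] by simp
  qed
  then have "\<forall>r. \<exists>\<xi>. 0 < r \<and> r < \<rho> \<longrightarrow> is_lift a u (ball 0 r) \<xi> \<and> (\<forall>i<N. \<xi> i 0 = x i)" by blast
  from choice[OF this] obtain X where
    "\<forall>r. 0 < r \<and> r < \<rho> \<longrightarrow> is_lift a u (ball 0 r) (X r) \<and> (\<forall>i<N. X r i 0 = x i)" ..
  then have X: "\<And>r. 0 < r \<Longrightarrow> r < \<rho> \<Longrightarrow> is_lift a u (ball 0 r) (X r)"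
    "\<And>r i. 0 < r \<Longrightarrow> r < \<rho> \<Longrightarrow> i < N \<Longrightarrow> X r i 0 = x i" by blast+
  have eq: "X r i z = X r' i z" if r: "r < \<rho>" "r' < \<rho>" "z \<in> ball 0 r" "z \<in> ball 0 r'" "i < N" for r r' i z
  proof (rule lift_unique[OF u J, where S = "ball 0 r \<inter> ball 0 r'" and p = 0 and \<xi> = "X r" and \<eta> = "X r'"])
    have r0: "0 < r" "0 < r'" using r(3,4) by (metis mem_ball_0 norm_ge_zero le_less_trans)+
    show "is_lift a u (ball 0 r \<inter> ball 0 r') (X r)" "is_lift a u (ball 0 r \<inter> ball 0 r') (X r')"
      using is_lift_subset[OF X(1)[OF r0(1) r(1)]] is_lift_subset[OF X(1)[OF r0(2) r(2)]] by auto
    show "connected (ball 0 r \<inter> ball (0::complex) r')" by (intro convex_connected convex_Int convex_ball)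
    show "X r i 0 = X r' i 0" if "i < N" for i using X(2) r r0 that by simp
    show "ball 0 r \<inter> ball 0 r' \<subseteq> ball (0::complex) \<rho>" using r by auto
    show "0 \<in> ball 0 r \<inter> ball (0::complex) r'" using r0 by simp
    show "z \<in> ball 0 r \<inter> ball 0 r'" "i < N" using r by auto
  qed auto
  \<comment> \<open>A radius strictly between |z| and \<rho>; it selects the lift that is used at
    z.\<close>
  define h where "h z = (cmod z + \<rho>) / 2" for z :: complex
  have h: "0 < h z" "h z < \<rho>" "cmod z < h z" if "z \<in> ball 0 \<rho>" for z
  proof -
    have "cmod z < \<rho>" using that by simp
    then show "0 < h z" "h z < \<rho>" "cmod z < h z"
      unfolding h_def using norm_ge_zero[of z] \<rho> by (simp_all add: add_nonneg_pos)
  qed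
  define \<xi> where "\<xi> i z = X (h z) i z" for i z
  have loc: "\<xi> i z = X (h w) i z" if "w \<in> ball 0 \<rho>" "z \<in> ball 0 (h w)" "i < N" for i z w
  proof -
    have "z \<in> ball 0 \<rho>" using that h(2)[OF that(1)] by auto
    then show ?thesis unfolding \<xi>_def using that h[of z] h[of w] by (intro eq) auto
  qed
  show ?thesis
  proof (intro exI conjI allI impI)
    show "is_lift a u (ball 0 \<rho>) \<xi>"
      unfolding is_lift_def
    proof (intro conjI allI impI ballI)
      fix i assume i: "i < N"
      show "\<xi> i holomorphic_on ball 0 \<rho>"
        unfolding holomorphic_on_open[OF open_ball]
      proof (intro ballI)
        fix w :: complex assume w: "w \<in> ball 0 \<rho>"
        have "X (h w) i holomorphic_on ball 0 (h w)" using X(1) h[OF w] i by (auto simp: is_lift_def)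
        then obtain D where "(X (h w) i has_field_derivative D) (at w)"
          using h[OF w] unfolding holomorphic_on_open[OF open_ball] by force
        then have "(\<xi> i has_field_derivative D) (at w)"
          by (rule has_field_derivative_transform_within_open[where S = "ball 0 (h w)"])
            (use h[OF w] loc[OF w _ i] in auto)
        then show "\<exists>D. (\<xi> i has_field_derivative D) (at w)" by blast
      qed
    next
      fix z :: complex assume z: "z \<in> ball 0 \<rho>"
      then show "fibre a u z (\<lambda>i. \<xi> i z)" using X(1) h[OF z] by (auto simp: is_lift_def \<xi>_def)
    qed
    show "\<xi> i 0 = x i" if "i < N" for i
      unfolding \<xi>_def using X(2)[OF h(1,2)[of 0] that] \<rho> by simp
  qed
qed

end

section \<open>Completeness of the inverse branches\<close>

definition unity :: "nat \<Rightarrow> nat \<Rightarrow> complex" where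
  "unity d l = cis (2 * pi * real l / real d)"

lemma unity_simps: "cmod (unity d l) = 1" "d > 0 \<Longrightarrow> unity d l ^ d = 1" "unity d l ^ m = unity d m ^ l"
proof -
  show "cmod (unity d l) = 1" by (simp add: unity_def)
  show "unity d l ^ m = unity d m ^ l" unfolding unity_def Complex.DeMoivre by (simp add: mult_ac)
  show "unity d l ^ d = 1" if "d > 0"
  proof -
    have "unity d l ^ d = cis (2 * pi * real l)" using that unfolding unity_def Complex.DeMoivre by simp
    also have "\<dots> = 1" using cis_multiple_2pi[of "real l"] by simp
    finally show ?thesis .
  qed
qed

lemma unity_inj: "d > 0 \<Longrightarrow> k < d \<Longrightarrow> m < d \<Longrightarrow> unity d k = unity d m \<Longrightarrow> k = m"
  using bij_betw_imp_inj_on[OF Complex.bij_betw_roots_unity[of d]] unfolding unity_def inj_on_def by blast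

lemma sum_unity:
  assumes "d > 0" "k < d" "m < d"
  shows "(\<Sum>l<d. cnj (unity d l) ^ k * unity d l ^ m) = (if k = m then of_nat d else 0)"
proof (cases "k = m")
  case True
  have "cnj (unity d l) ^ k * unity d l ^ k = 1" for l
  proof -
    have "unity d l * cnj (unity d l) = 1" by (simp add: complex_norm_square[symmetric] unity_simps(1))
    then show ?thesis unfolding power_mult_distrib[symmetric] by (simp add: mult.commute)
  qed
  then show ?thesis using True by simp
next
  case False
  define r where "r = cnj (unity d k) * unity d m"
  have "cnj (unity d l) ^ k * unity d l ^ m = r ^ l" for l
    by (simp only: r_def power_mult_distrib complex_cnj_power[symmetric] unity_simps(3)[of d l m] unity_simps(3)[of d l k])
  moreover have "r ^ d = 1"
    by (simp only: r_def power_mult_distrib complex_cnj_power[symmetric] unity_simps(2)[OF assms(1)]) simp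
  moreover have "r \<noteq> 1"
  proof
    assume "r = 1"
    then have "unity d k * r = unity d k" by simp
    moreover have "unity d k * r = unity d m"
    proof -
      have "unity d k * cnj (unity d k) = 1" by (simp add: complex_norm_square[symmetric] unity_simps(1))
      then show ?thesis unfolding r_def by (simp add: mult.assoc[symmetric])
    qed
    ultimately have "unity d k = unity d m" by simp
    then show False using unity_inj[OF assms] False by blast
  qed
  ultimately show ?thesis using False by (simp add: sum_gp_strict)
qed

lemma complex_root_exists:
  assumes "d > 0" "cmod z = 1"
  obtains w where "cmod w = 1" "w ^ d = z"
proof (rule that)
  show "cmod (cis (Arg z / d)) = 1" by simp
  have "cis (Arg z / d) ^ d = cis (Arg z)" using assms unfolding Complex.DeMoivre by simp
  also have "\<dots> = z" using rcis_cmod_Arg[of z] assms by (simp add: rcis_def)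
  finally show "cis (Arg z / d) ^ d = z" .
qed

section \<open>Interpolation at the d^N points of the fibre over z = 0\<close>

context regular_family
begin

abbreviation digits :: "(nat \<Rightarrow> nat) set" where "digits \<equiv> {..<N} \<rightarrow>\<^sub>E {..<d}"

lemma finite_digits: "finite digits" by (intro finite_PiE) auto

lemma card_digits: "card digits = d ^ N" by (simp add: card_PiE)

text \<open>Orthogonality of the characters of (Z/d)^N: the d^N points obtained from \<omega> by
  multiplying coordinates with d-th roots of unity separate the d^N monomials with exponents below
  d.\<close>

lemma fourier_coefficient:
  assumes J: "J \<in> digits"
  shows "(\<Sum>e\<in>digits. (\<Prod>i<N. cnj (unity d (e i)) ^ J i) * (\<Sum>K\<in>digits. c K * (\<Prod>i<N. (\<omega> i * unity d (e i)) ^ K i)))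
    = of_nat (d ^ N) * (c J * (\<Prod>i<N. \<omega> i ^ J i))"
proof -
  have d0: "d > 0" using d_ge_2 by simp
  have inner: "(\<Sum>e\<in>digits. \<Prod>i<N. cnj (unity d (e i)) ^ J i * unity d (e i) ^ K i) = (if K = J then of_nat (d ^ N) else 0)"
    if K: "K \<in> digits" for K
  proof -
    have "(\<Sum>e\<in>digits. \<Prod>i<N. cnj (unity d (e i)) ^ J i * unity d (e i) ^ K i)
        = (\<Prod>i<N. \<Sum>l<d. cnj (unity d l) ^ J i * unity d l ^ K i)"
      by (subst prod_sum_PiE) auto
    also have "\<dots> = (\<Prod>i<N. if J i = K i then of_nat d else 0)"
      using J K by (intro prod.cong refl sum_unity d0) (auto simp: PiE_iff)
    also have "\<dots> = (if K = J then of_nat (d ^ N) else 0)"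
    proof (cases "K = J")
      case False
      have "\<exists>i<N. J i \<noteq> K i"
      proof (rule ccontr)
        assume "\<not> ?thesis"
        then have "K i = J i" if "i \<in> {..<N}" for i using that by simp
        from PiE_ext[OF K J this] show False using False by simp
      qed
      then obtain i where "i < N" "J i \<noteq> K i" by blast
      then show ?thesis using False by (auto intro!: prod_zero)
    qed simp
    finally show ?thesis .
  qed
  have "(\<Sum>e\<in>digits. (\<Prod>i<N. cnj (unity d (e i)) ^ J i) * (\<Sum>K\<in>digits. c K * (\<Prod>i<N. (\<omega> i * unity d (e i)) ^ K i)))
      = (\<Sum>e\<in>digits. \<Sum>K\<in>digits. c K * (\<Prod>i<N. \<omega> i ^ K i) * (\<Prod>i<N. cnj (unity d (e i)) ^ J i * unity d (e i) ^ K i))"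
    unfolding sum_distrib_left by (simp add: power_mult_distrib prod.distrib mult_ac)
  also have "\<dots> = (\<Sum>K\<in>digits. c K * (\<Prod>i<N. \<omega> i ^ K i) * (\<Sum>e\<in>digits. \<Prod>i<N. cnj (unity d (e i)) ^ J i * unity d (e i) ^ K i))"
    unfolding sum_distrib_left by (rule sum.swap)
  also have "\<dots> = (\<Sum>K\<in>digits. if K = J then c K * (\<Prod>i<N. \<omega> i ^ K i) * of_nat (d ^ N) else 0)"
    using inner by (intro sum.cong) auto
  also have "\<dots> = of_nat (d ^ N) * (c J * (\<Prod>i<N. \<omega> i ^ J i))"
    using J finite_digits by (simp add: mult_ac)
  finally show ?thesis .
qed

text \<open>Stability of this inversion: if the nodes move so little that the monomials change by at
  most \<eta>, every coefficient is at most \<eta> T, where T is the sum of all |c_K|. Summation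
  gives T \<le> d^N \<eta> T, so T = 0.\<close>

lemma interpolation_unique:
  assumes x: "\<And>e K. e \<in> digits \<Longrightarrow> K \<in> digits \<Longrightarrow>
      cmod ((\<Prod>i<N. (\<omega> i * unity d (e i)) ^ K i) - (\<Prod>i<N. x e i ^ K i)) \<le> \<eta>"
    and \<omega>: "\<And>i. i < N \<Longrightarrow> cmod (\<omega> i) = 1" and \<eta>: "real (d ^ N) * \<eta> < 1"
    and zero: "\<And>e. e \<in> digits \<Longrightarrow> (\<Sum>K\<in>digits. c K * (\<Prod>i<N. x e i ^ K i)) = 0"
    and J: "J \<in> digits"
  shows "c J = 0"
proof -
  define T where "T = (\<Sum>K\<in>digits. cmod (c K))"
  have dN: "real (d ^ N) > 0" using d_ge_2 by simp
  have le: "cmod (c J) \<le> \<eta> * T" if J: "J \<in> digits" for J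
  proof -
    have "cmod (\<Prod>i<N. \<omega> i ^ J i) = 1" using \<omega> by (simp add: prod_norm[symmetric] norm_power)
    then have "real (d ^ N) * cmod (c J) = cmod (of_nat (d ^ N) * (c J * (\<Prod>i<N. \<omega> i ^ J i)))"
      by (simp add: norm_mult norm_power)
    also have "\<dots> \<le> (\<Sum>e\<in>digits. \<eta> * T)"
      unfolding fourier_coefficient[OF J, symmetric]
    proof (rule sum_norm_le)
      fix e assume e: "e \<in> digits"
      have "(\<Sum>K\<in>digits. c K * (\<Prod>i<N. (\<omega> i * unity d (e i)) ^ K i))
          = (\<Sum>K\<in>digits. c K * ((\<Prod>i<N. (\<omega> i * unity d (e i)) ^ K i) - (\<Prod>i<N. x e i ^ K i)))"
        unfolding right_diff_distrib sum_subtractf zero[OF e] by simp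
      also have "cmod \<dots> \<le> (\<Sum>K\<in>digits. cmod (c K) * \<eta>)"
        using x[OF e] by (intro sum_norm_le) (simp add: norm_mult mult_left_mono)
      also have "\<dots> = \<eta> * T" by (simp add: T_def sum_distrib_left mult.commute)
      finally have 1: "cmod (\<Sum>K\<in>digits. c K * (\<Prod>i<N. (\<omega> i * unity d (e i)) ^ K i)) \<le> \<eta> * T" .
      have 2: "cmod (\<Prod>i<N. cnj (unity d (e i)) ^ J i) = 1"
        by (simp add: prod_norm[symmetric] norm_power unity_simps)
      show "cmod ((\<Prod>i<N. cnj (unity d (e i)) ^ J i) * (\<Sum>K\<in>digits. c K * (\<Prod>i<N. (\<omega> i * unity d (e i)) ^ K i))) \<le> \<eta> * T"
        unfolding norm_mult 2 using 1 by simp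
    qed
    also have "\<dots> = real (d ^ N) * (\<eta> * T)" by (simp add: card_digits)
    finally show ?thesis using dN mult_le_cancel_left_pos by blast
  qed
  have "T \<le> (\<Sum>K\<in>digits. \<eta> * T)" unfolding T_def using le by (intro sum_mono) (simp add: T_def)
  also have "\<dots> = real (d ^ N) * \<eta> * T" by (simp add: card_digits)
  finally have "T * (1 - real (d ^ N) * \<eta>) \<le> 0" by (simp add: algebra_simps)
  then have "T \<le> 0" using \<eta> by (simp add: mult_le_0_iff)
  moreover have "cmod (c J) \<le> T" unfolding T_def using J finite_digits by (intro member_le_sum) auto
  ultimately have "cmod (c J) \<le> 0" by linarith
  then show ?thesis by simp
qed

section \<open>Division with remainder modulo the fibre equations\<close>

definition reducible :: "(nat \<Rightarrow> (nat \<Rightarrow> nat) \<Rightarrow> complex) \<Rightarrow> (nat \<Rightarrow> complex \<Rightarrow> complex) \<Rightarrow> complex set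
    \<Rightarrow> (complex \<Rightarrow> (nat \<Rightarrow> complex) \<Rightarrow> complex) \<Rightarrow> bool" where
  "reducible a u B P \<longleftrightarrow> (\<exists>c. (\<forall>J\<in>digits. c J holomorphic_on B) \<and>
     (\<forall>z\<in>B. \<forall>v. fibre a u z v \<longrightarrow> P z v = (\<Sum>J\<in>digits. c J z * (\<Prod>j<N. v j ^ J j))))"

lemma reducible_sum:
  assumes "finite A" "\<And>k. k \<in> A \<Longrightarrow> reducible a u B (P k)" "\<And>k. k \<in> A \<Longrightarrow> h k holomorphic_on B"
  shows "reducible a u B (\<lambda>z v. \<Sum>k\<in>A. h k z * P k z v)"
proof -
  have "\<forall>k\<in>A. \<exists>c. (\<forall>J\<in>digits. c J holomorphic_on B) \<and>
     (\<forall>z\<in>B. \<forall>v. fibre a u z v \<longrightarrow> P k z v = (\<Sum>J\<in>digits. c J z * (\<Prod>j<N. v j ^ J j)))"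
    using assms(2) unfolding reducible_def by blast
  from bchoice[OF this] obtain c where c: "\<forall>k\<in>A. (\<forall>J\<in>digits. c k J holomorphic_on B) \<and>
     (\<forall>z\<in>B. \<forall>v. fibre a u z v \<longrightarrow> P k z v = (\<Sum>J\<in>digits. c k J z * (\<Prod>j<N. v j ^ J j)))" ..
  have hol: "\<forall>J\<in>digits. (\<lambda>z. \<Sum>k\<in>A. h k z * c k J z) holomorphic_on B"
    using c assms(3) by (intro ballI holomorphic_intros) auto
  have "(\<Sum>k\<in>A. h k z * P k z v) = (\<Sum>J\<in>digits. (\<Sum>k\<in>A. h k z * c k J z) * (\<Prod>j<N. v j ^ J j))"
    if "z \<in> B" "fibre a u z v" for z v
  proof -
    have "(\<Sum>k\<in>A. h k z * P k z v) = (\<Sum>k\<in>A. \<Sum>J\<in>digits. h k z * (c k J z * (\<Prod>j<N. v j ^ J j)))"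
      unfolding sum_distrib_left[symmetric] using c that by (intro sum.cong) auto
    also have "\<dots> = (\<Sum>J\<in>digits. \<Sum>k\<in>A. h k z * (c k J z * (\<Prod>j<N. v j ^ J j)))" by (rule sum.swap)
    also have "\<dots> = (\<Sum>J\<in>digits. (\<Sum>k\<in>A. h k z * c k J z) * (\<Prod>j<N. v j ^ J j))"
      by (intro sum.cong refl) (simp add: sum_distrib_right mult.assoc)
    finally show ?thesis .
  qed
  then show ?thesis unfolding reducible_def using hol by (intro exI[of _ "\<lambda>J z. \<Sum>k\<in>A. h k z * c k J z"]) blast
qed

lemma reducible_cong:
  assumes "reducible a u B P" "\<And>z v. z \<in> B \<Longrightarrow> fibre a u z v \<Longrightarrow> Q z v = P z v"
  shows "reducible a u B Q"
proof -
  obtain c where "\<forall>J\<in>digits. c J holomorphic_on B"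
    "\<forall>z\<in>B. \<forall>v. fibre a u z v \<longrightarrow> P z v = (\<Sum>J\<in>digits. c J z * (\<Prod>j<N. v j ^ J j))"
    using assms(1) unfolding reducible_def by blast
  then show ?thesis
    unfolding reducible_def by (intro exI[of _ c]) (simp add: assms(2))
qed

text \<open>A factor v_i^d is replaced by u_i minus the lower terms. Each lower term has degree d -
  I_N < d in v, so the total degree drops and the recursion ends with exponents below d.
  Algebraically, these d^N monomials span the polynomials on the fibres over the holomorphic
  functions of z.\<close>

lemma reducible_monomial:
  assumes u: "\<And>i. i < N \<Longrightarrow> u i holomorphic_on B"
  shows "reducible a u B (\<lambda>z v. \<Prod>j<N. v j ^ K j)"
proof (induction "\<Sum>j<N. K j" arbitrary: K rule: less_induct)
  case less
  show ?case
  proof (cases "\<forall>j<N. K j < d")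
    case True
    define K' where "K' = restrict K {..<N}"
    have K': "K' \<in> digits" using True by (auto simp: K'_def)
    have eq: "(\<Sum>J\<in>digits. (if J = K' then 1 else 0) * (\<Prod>j<N. v j ^ J j)) = (\<Prod>j<N. v j ^ K j)" for v :: "nat \<Rightarrow> complex"
    proof -
      have "(\<Sum>J\<in>digits. (if J = K' then 1 else 0) * (\<Prod>j<N. v j ^ J j)) = (\<Sum>J\<in>digits. if J = K' then (\<Prod>j<N. v j ^ J j) else 0)"
        by (intro sum.cong) auto
      also have "\<dots> = (\<Prod>j<N. v j ^ K' j)" using K' finite_digits by simp
      finally show ?thesis by (simp add: K'_def)
    qed
    show ?thesis
      unfolding reducible_def by (intro exI[of _ "\<lambda>J z. if J = K' then 1 else 0"]) (simp add: eq)
  next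
    case False
    then obtain i where i: "i < N" "d \<le> K i" by (auto simp: not_less)
    define K' where "K' = K(i := K i - d)"
    have K'sum: "(\<Sum>j<N. K' j) + d = (\<Sum>j<N. K j)"
      using i by (simp add: sum.remove[of "{..<N}" i] K'_def)
    have Kprod: "(\<Prod>j<N. v j ^ K j) = v i ^ d * (\<Prod>j<N. v j ^ K' j)" for v :: "nat \<Rightarrow> complex"
      using i by (simp add: prod.remove[of "{..<N}" i] K'_def mult.assoc[symmetric] power_add[symmetric])
    \<comment> \<open>\<open>None\<close> stands for the summand u_i, \<open>Some I\<close> for the
      lower term with index I.\<close>
    define T where "T = insert None (Some ` IndStar N d)"
    define P where "P k = (\<lambda>(z::complex) (v::nat \<Rightarrow> complex). \<Prod>j<N. v j ^ (K' j + (case k of None \<Rightarrow> 0 | Some I \<Rightarrow> I j)))" for k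
    define h where "h k = (\<lambda>z. case k of None \<Rightarrow> u i z | Some I \<Rightarrow> - (a i I * z ^ I N))" for k
    have "reducible a u B (\<lambda>z v. \<Sum>k\<in>T. h k z * P k z v)"
    proof (rule reducible_sum)
      show "finite T" by (simp add: T_def finite_IndStar)
      fix k assume k: "k \<in> T"
      have "(\<Sum>j<N. K' j + (case k of None \<Rightarrow> 0 | Some I \<Rightarrow> I j)) < (\<Sum>j<N. K j)"
      proof (cases k)
        case None
        then show ?thesis using K'sum d_ge_2 by simp
      next
        case (Some I)
        then have "I \<in> IndStar N d" using k by (auto simp: T_def)
        then have "(\<Sum>j<N. I j) < d" using IndStar_sum[of I N d] by (auto simp: IndStar_def)
        then show ?thesis using K'sum Some by (simp add: sum.distrib)
      qed
      from less[OF this] show "reducible a u B (P k)" unfolding P_def .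
      show "h k holomorphic_on B"
        unfolding h_def by (cases k) (auto intro!: holomorphic_intros u i)
    qed
    then show ?thesis
    proof (rule reducible_cong)
      fix z v assume fib: "fibre a u z v"
      have "v i ^ d = u i z - (\<Sum>I\<in>IndStar N d. a i I * z ^ I N * (\<Prod>j<N. v j ^ I j))"
        using fib i by (auto simp: fibre_def mapc_def algebra_simps)
      then have "(\<Prod>j<N. v j ^ K j) = u i z * (\<Prod>j<N. v j ^ K' j)
          + (\<Sum>I\<in>IndStar N d. - (a i I * z ^ I N) * (\<Prod>j<N. v j ^ (K' j + I j)))"
        unfolding Kprod by (simp add: left_diff_distrib sum_distrib_right sum_negf power_add prod.distrib mult.assoc mult.commute[of "\<Prod>j<N. v j ^ K' j"])
      also have "\<dots> = (\<Sum>k\<in>T. h k z * P k z v)"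
        unfolding T_def by (simp add: finite_IndStar sum.reindex h_def P_def)
      finally show "(\<Prod>j<N. v j ^ K j) = (\<Sum>k\<in>T. h k z * P k z v)" .
    qed
  qed
qed

lemma reducible_coordinate_mult:
  assumes u: "\<And>i. i < N \<Longrightarrow> u i holomorphic_on B" and P: "reducible a u B P" and i: "i < N"
  shows "reducible a u B (\<lambda>z v. v i * P z v)"
proof -
  obtain c where c: "\<forall>J\<in>digits. c J holomorphic_on B"
    "\<forall>z\<in>B. \<forall>v. fibre a u z v \<longrightarrow> P z v = (\<Sum>J\<in>digits. c J z * (\<Prod>j<N. v j ^ J j))"
    using P unfolding reducible_def by blast
  have "reducible a u B (\<lambda>z v. \<Sum>J\<in>digits. c J z * (\<Prod>j<N. v j ^ (J(i := Suc (J i))) j))"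
    by (rule reducible_sum[OF finite_digits reducible_monomial[where u = u, OF u]]) (use c(1) in auto)
  then show ?thesis
  proof (rule reducible_cong)
    fix z v assume zv: "z \<in> B" "fibre a u z v"
    have "(\<Prod>j<N. v j ^ (J(i := Suc (J i))) j) = v i * (\<Prod>j<N. v j ^ J j)" for J
      using i by (simp add: prod.remove[of "{..<N}" i])
    then show "v i * P z v = (\<Sum>J\<in>digits. c J z * (\<Prod>j<N. v j ^ (J(i := Suc (J i))) j))"
      using c(2) zv by (simp add: sum_distrib_left mult_ac)
  qed
qed

lemma reducible_prod:
  assumes u: "\<And>i. i < N \<Longrightarrow> u i holomorphic_on B" and "finite A"
    and "\<And>e. e \<in> A \<Longrightarrow> \<iota> e < N" "\<And>e. e \<in> A \<Longrightarrow> h e holomorphic_on B"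
  shows "reducible a u B (\<lambda>z v. \<Prod>e\<in>A. v (\<iota> e) - h e z)"
  using assms(2-)
proof (induction A rule: finite_induct)
  case empty
  show ?case using reducible_monomial[where K = "\<lambda>_. 0", OF u] by simp
next
  case (insert e A)
  let ?Q = "\<lambda>z v. \<Prod>e\<in>A. v (\<iota> e) - h e z"
  have Q: "reducible a u B ?Q" using insert by auto
  \<comment> \<open>The expansion of (v - h) Q into v Q - h Q, written as a sum over two indices to
    fit \<open>reducible_sum\<close>.\<close>
  have "reducible a u B (\<lambda>z v. \<Sum>k\<in>{True, False}. (if k then 1 else - h e z) * (if k then v (\<iota> e) * ?Q z v else ?Q z v))"
  proof (rule reducible_sum[where h = "\<lambda>k z. if k then 1 else - h e z" and P = "\<lambda>k z v. if k then v (\<iota> e) * ?Q z v else ?Q z v"])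
    have e: "\<iota> e < N" "h e holomorphic_on B" using insert.prems by auto
    show "reducible a u B (\<lambda>z v. if k then v (\<iota> e) * ?Q z v else ?Q z v)" for k
      using reducible_coordinate_mult[where u = u, OF u Q e(1)] Q by (cases k) simp_all
    show "(\<lambda>z. if k then 1 else - h e z) holomorphic_on B" for k
      using e(2) by (cases k) (auto intro!: holomorphic_intros)
  qed simp
  then show ?case
    by (rule reducible_cong) (use insert in \<open>simp add: algebra_simps\<close>)
qed

lemma mapc_at_0: "F a v 0 i = v i ^ d"
proof -
  have "(\<Sum>I\<in>IndStar N d. a i I * 0 ^ I N * (\<Prod>j<N. v j ^ I j)) = 0"
    by (intro sum.neutral) (auto simp: IndStar_def)
  then show ?thesis by (simp add: mapc_def)
qed

text \<open>The \<open>d^N\<close> branches starting at \<open>z = 0\<close> exhaust the fibres: a product of coordinate differences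
  vanishing on all branches reduces to a combination of \<open>d^N\<close> monomials, whose coefficients vanish near \<open>0\<close>.\<close>

lemma fibre_point_on_lift:
  assumes u: "\<And>i. i < N \<Longrightarrow> u i holomorphic_on ball 0 \<rho>" and u0: "\<And>i. i < N \<Longrightarrow> cmod (u i 0) = 1"
    and lifts: "\<And>x. (\<And>i. i < N \<Longrightarrow> x i ^ d = u i 0) \<Longrightarrow> \<exists>\<xi>. is_lift a u (ball 0 \<rho>) \<xi> \<and> (\<forall>i<N. \<xi> i 0 = x i) \<and> Q \<xi>"
    and z: "z \<in> ball 0 \<rho>" and v: "fibre a u z v"
  shows "\<exists>\<xi>. is_lift a u (ball 0 \<rho>) \<xi> \<and> (\<forall>i<N. \<xi> i z = v i) \<and> Q \<xi>"
proof (rule ccontr)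
  assume contra: "\<not> ?thesis"
  have d0: "d > 0" using d_ge_2 by simp
  have \<rho>: "\<rho> > 0" using z by (metis mem_ball_0 norm_ge_zero le_less_trans)
  have "\<forall>i. \<exists>w. i < N \<longrightarrow> cmod w = 1 \<and> w ^ d = u i 0"
  proof
    fix i
    show "\<exists>w. i < N \<longrightarrow> cmod w = 1 \<and> w ^ d = u i 0"
    proof (cases "i < N")
      case True
      show ?thesis by (rule complex_root_exists[OF d0 u0[OF True]]) blast
    qed simp
  qed
  from choice[OF this] obtain \<omega> where \<omega>: "\<forall>i. i < N \<longrightarrow> cmod (\<omega> i) = 1 \<and> \<omega> i ^ d = u i 0" ..
  have "\<exists>\<xi>. is_lift a u (ball 0 \<rho>) \<xi> \<and> (\<forall>i<N. \<xi> i 0 = \<omega> i * unity d (e i)) \<and> Q \<xi>" for e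
    by (rule lifts) (simp add: power_mult_distrib unity_simps(2)[OF d0] \<omega>)
  then have "\<forall>e. \<exists>\<xi>. is_lift a u (ball 0 \<rho>) \<xi> \<and> (\<forall>i<N. \<xi> i 0 = \<omega> i * unity d (e i)) \<and> Q \<xi>" by blast
  from choice[OF this] obtain X where
    "\<forall>e. is_lift a u (ball 0 \<rho>) (X e) \<and> (\<forall>i<N. X e i 0 = \<omega> i * unity d (e i)) \<and> Q (X e)" ..
  then have X: "\<And>e. is_lift a u (ball 0 \<rho>) (X e)" "\<And>e i. i < N \<Longrightarrow> X e i 0 = \<omega> i * unity d (e i)" "\<And>e. Q (X e)" by blast+
  \<comment> \<open>Each branch misses v in some coordinate \<iota> e. The product of the
    corresponding differences is nonzero at v, but on every branch one of its factors vanishes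
    identically.\<close>
  have "\<forall>e. \<exists>i. i < N \<and> X e i z \<noteq> v i" using contra X(1,3) by blast
  from choice[OF this] obtain \<iota> where \<iota>: "\<forall>e. \<iota> e < N \<and> X e (\<iota> e) z \<noteq> v (\<iota> e)" ..
  have Xhol: "X e i holomorphic_on ball 0 \<rho>" if "i < N" for e i using X(1) that unfolding is_lift_def by blast
  have "reducible a u (ball 0 \<rho>) (\<lambda>z v. \<Prod>e\<in>digits. v (\<iota> e) - X e (\<iota> e) z)"
    by (rule reducible_prod[OF u finite_digits]) (use \<iota> Xhol in auto)
  then obtain c where c: "\<forall>J\<in>digits. c J holomorphic_on ball 0 \<rho>"
    "\<forall>z\<in>ball 0 \<rho>. \<forall>v. fibre a u z v \<longrightarrow> (\<Prod>e\<in>digits. v (\<iota> e) - X e (\<iota> e) z) = (\<Sum>J\<in>digits. c J z * (\<Prod>j<N. v j ^ J j))"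
    unfolding reducible_def by blast
  \<comment> \<open>Any \<eta> with d^N \<eta> < 1 would serve in
    \<open>interpolation_unique\<close>.\<close>
  define \<eta> where "\<eta> = 1 / (2 * real (d ^ N))"
  have \<eta>: "\<eta> > 0" "real (d ^ N) * \<eta> < 1" using d0 by (auto simp: \<eta>_def)
  have "\<forall>\<^sub>F z in nhds 0. \<forall>e\<in>digits. \<forall>K\<in>digits. dist (\<Prod>i<N. X e i z ^ K i) (\<Prod>i<N. (\<omega> i * unity d (e i)) ^ K i) < \<eta>"
  proof (intro eventually_ball_finite ballI finite_digits)
    fix e K :: "nat \<Rightarrow> nat"
    have "(X e i \<longlongrightarrow> \<omega> i * unity d (e i)) (nhds 0)" if "i < N" for i
    proof -
      have "isCont (X e i) 0"
        by (rule continuous_on_interior[OF holomorphic_on_imp_continuous_on[OF Xhol[OF that]]]) (use \<rho> in \<open>simp add: interior_open\<close>)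
      then have "(X e i \<longlongrightarrow> X e i 0) (nhds 0)"
        unfolding isCont_def tendsto_at_iff_tendsto_nhds .
      then show ?thesis unfolding X(2)[OF that] .
    qed
    then have "((\<lambda>z. \<Prod>i<N. X e i z ^ K i) \<longlongrightarrow> (\<Prod>i<N. (\<omega> i * unity d (e i)) ^ K i)) (nhds 0)"
      by (intro tendsto_intros) auto
    then show "\<forall>\<^sub>F z in nhds 0. dist (\<Prod>i<N. X e i z ^ K i) (\<Prod>i<N. (\<omega> i * unity d (e i)) ^ K i) < \<eta>"
      using \<eta>(1) by (rule tendstoD)
  qed
  moreover have "\<forall>\<^sub>F z in nhds 0. z \<in> ball 0 \<rho>" using \<rho> by (intro eventually_nhds_in_open) auto
  ultimately have "\<forall>\<^sub>F z in nhds 0. z \<in> ball 0 \<rho> \<and> (\<forall>e\<in>digits. \<forall>K\<in>digits. dist (\<Prod>i<N. X e i z ^ K i) (\<Prod>i<N. (\<omega> i * unity d (e i)) ^ K i) < \<eta>)"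
    by eventually_elim auto
  then obtain W where W: "open W" "0 \<in> W"
    "\<forall>z\<in>W. z \<in> ball 0 \<rho> \<and> (\<forall>e\<in>digits. \<forall>K\<in>digits. dist (\<Prod>i<N. X e i z ^ K i) (\<Prod>i<N. (\<omega> i * unity d (e i)) ^ K i) < \<eta>)"
    unfolding eventually_nhds by blast
  have zero: "c J y = 0" if y: "y \<in> W" and J: "J \<in> digits" for y J
  proof (rule interpolation_unique[where x = "\<lambda>e i. X e i y" and \<omega> = \<omega> and \<eta> = \<eta> and c = "\<lambda>J. c J y"])
    show "cmod ((\<Prod>i<N. (\<omega> i * unity d (e i)) ^ K i) - (\<Prod>i<N. X e i y ^ K i)) \<le> \<eta>" if "e \<in> digits" "K \<in> digits" for e K
    proof -
      have "dist (\<Prod>i<N. X e i y ^ K i) (\<Prod>i<N. (\<omega> i * unity d (e i)) ^ K i) < \<eta>"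
        using W(3) y that by blast
      then show ?thesis by (simp add: dist_norm norm_minus_commute)
    qed
    show "(\<Sum>K\<in>digits. c K y * (\<Prod>i<N. X e i y ^ K i)) = 0" if e: "e \<in> digits" for e
    proof -
      have yb: "y \<in> ball 0 \<rho>" using W(3) y by blast
      then have "fibre a u y (\<lambda>i. X e i y)" using X(1)[of e] unfolding is_lift_def by blast
      from c(2)[rule_format, OF yb this] have "(\<Sum>K\<in>digits. c K y * (\<Prod>i<N. X e i y ^ K i)) = (\<Prod>e'\<in>digits. X e (\<iota> e') y - X e' (\<iota> e') y)"
        by (rule sym)
      also have "\<dots> = 0" using e finite_digits by (intro prod_zero) auto
      finally show ?thesis .
    qed
  qed (use \<omega> \<eta> J in auto)
  \<comment> \<open>The coefficients vanish near 0 and, being holomorphic on the disc, also at the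
    given z, however far from 0 it lies.\<close>
  have "c J z = 0" if J: "J \<in> digits" for J
  proof (rule analytic_continuation_open[of W "ball 0 \<rho>" "c J" "\<lambda>_. 0" z])
    show "W \<noteq> {}" "W \<subseteq> ball 0 \<rho>" using W by blast+
    show "c J holomorphic_on ball 0 \<rho>" using c(1) J by blast
    show "c J y = 0" if "y \<in> W" for y using zero[OF that J] .
  qed (use W(1) z in auto)
  then have "(\<Prod>e\<in>digits. v (\<iota> e) - X e (\<iota> e) z) = 0"
    using c(2)[rule_format, OF z v] by simp
  then obtain e where "v (\<iota> e) = X e (\<iota> e) z" using finite_digits by auto
  then show False using \<iota>[rule_format, of e] by simp
qed

end

section \<open>Discs through the unit torus\<close>

lemma norm_mult_minus_one_le:
  fixes A B :: complex
  assumes "cmod (A - 1) \<le> a" "cmod (B - 1) \<le> b"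
  shows "cmod (A * B - 1) \<le> (1 + a) * (1 + b) - 1"
proof -
  have "A * B - 1 = (A - 1) * (B - 1) + (A - 1) + (B - 1)" by (simp add: algebra_simps)
  also have "cmod \<dots> \<le> a * b + a + b"
    by (intro norm_triangle_le add_mono assms norm_mult_le_mult)
  finally show ?thesis by (simp add: algebra_simps)
qed

lemma norm_power_minus_one_le:
  fixes e :: complex
  assumes "cmod e \<le> \<kappa>"
  shows "cmod ((1 + e) ^ n - 1) \<le> (1 + \<kappa>) ^ n - 1"
proof (induction n)
  case (Suc n)
  have "cmod ((1 + e) - 1) \<le> \<kappa>" using assms by simp
  from norm_mult_minus_one_le[OF this Suc] show ?case by simp
qed simp

context regular_family
begin

text \<open>The constants make \<open>v \<mapsto> v^d\<close> plus the lower terms an expansion on the \<open>\<kappa>\<close>-neighbourhood of the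
  torus as long as \<open>R * |t| \<le> \<delta>\<close>, where \<open>R\<close> is a bound for the coefficients.\<close>

definition \<kappa> :: real where "\<kappa> = 1 / (16 * real d)"

definition \<delta> :: real where "\<delta> = 1 / (32 * real N * q * real d * 5 ^ d)"

lemma kappa: "0 < \<kappa>" "\<kappa> \<le> 1 / 32" "real d * \<kappa> = 1 / 16"
  using d_ge_2 by (auto simp: \<kappa>_def field_simps)

text \<open>Since d \<kappa> = 1/16, powers up to d of numbers within \<kappa> of 1 deviate from 1
  by at most exp(1/16) - 1 \<le> 1/8.\<close>

lemma kappa_power: "n \<le> d \<Longrightarrow> (1 + \<kappa>) ^ n \<le> 9 / 8"
proof -
  assume n: "n \<le> d"
  have "(1 + \<kappa>) ^ n \<le> (1 + \<kappa>) ^ d" using n kappa(1) by (intro power_increasing) auto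
  also have "\<dots> \<le> exp \<kappa> ^ d" using kappa(1) by (intro power_mono exp_ge_add_one_self) auto
  also have "\<dots> = exp (1 / 16)" unfolding exp_of_nat_mult[symmetric] kappa(3) ..
  also have "\<dots> \<le> 1 + 1 / 16 + (1 / 16)\<^sup>2" by (rule exp_bound) auto
  also have "\<dots> \<le> 9 / 8" by (simp add: power2_eq_square)
  finally show ?thesis .
qed

text \<open>\<delta> is normalized by N q \<delta> d 5^d = 1/32, where 5 is the size of |v_i| in
  \<open>near_fibre\<close>. This gives the margin 1/10 required by \<open>jac_nonzero_near\<close>
  and makes the lower terms at most \<kappa>/2.\<close>

lemma delta: "0 < \<delta>" "\<delta> \<le> 1" "q * \<delta> * 5 ^ d \<le> \<kappa> / 2" "real N * (q * (\<delta> * (real d * 5 ^ d))) \<le> 1 / 10" "2 * q * \<delta> \<le> 1"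
proof -
  have N: "real N \<ge> 1" and d: "real d \<ge> 2" and p: "(5::real) ^ d \<ge> 1" using N_pos d_ge_2 by auto
  note q = q_ge_1
  show 0: "0 < \<delta>" using N d p q by (simp add: \<delta>_def)
  have eq: "real N * (q * (\<delta> * (real d * 5 ^ d))) = 1 / 32" using N d p q by (simp add: \<delta>_def)
  then show "real N * (q * (\<delta> * (real d * 5 ^ d))) \<le> 1 / 10" by simp
  have "q * \<delta> * 5 ^ d = 1 / (32 * real N * real d)" using N d p q by (simp add: \<delta>_def)
  also have "\<dots> \<le> 1 / (32 * 1 * real d)" using N d by (intro divide_left_mono mult_right_mono mult_left_mono) auto
  also have "\<dots> = \<kappa> / 2" by (simp add: \<kappa>_def)
  finally show "q * \<delta> * 5 ^ d \<le> \<kappa> / 2" .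
  have "1 * (q * (\<delta> * (2 * 1))) \<le> real N * (q * (\<delta> * (real d * 5 ^ d)))"
    using N d p q 0 by (intro mult_mono mult_nonneg_nonneg) auto
  then have "2 * q * \<delta> \<le> 1 / 32" unfolding eq by simp
  then show "2 * q * \<delta> \<le> 1" by simp
  have "1 * \<delta> \<le> q * \<delta>" using q 0 by (intro mult_right_mono) auto
  moreover have "2 * (q * \<delta>) \<le> 1" using \<open>2 * q * \<delta> \<le> 1\<close> by (simp only: mult.assoc)
  ultimately show "\<delta> \<le> 1" using 0 by linarith
qed

lemma near_fibre:
  assumes a: "coef_bound N d R a" "0 \<le> R" and t: "R * cmod t \<le> \<delta>"
    and F: "\<And>i. i < N \<Longrightarrow> cmod (F a v t i) \<le> 2" and i: "i < N"
  shows "cmod (v i) \<le> 5" "cmod (v i ^ d - F a v t i) \<le> \<kappa> / 2"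
proof -
  have 5: "cmod (v j) \<le> 5" if "j < N" for j
  proof -
    \<comment> \<open>Origin of the constant 5: targets of size at most 2 contribute 4, and the term
      2 q R |t| contributes at most 1.\<close>
    have "cmod (v j) \<le> max 1 (2 * 2) + 2 * q * R * cmod t"
      by (rule fibre_bound[OF a F that])
    also have "2 * q * R * cmod t \<le> 2 * q * \<delta>" using t q_ge_1 by simp
    also have "\<dots> \<le> 1" by (rule delta)
    finally show ?thesis by simp
  qed
  then show "cmod (v i) \<le> 5" using i .
  have "cmod (F a v t i - v i ^ d) \<le> q * (\<delta> / 5) * 5 ^ d"
    by (rule lower_terms_bound[OF a i 5]) (use t delta in auto)
  also have "\<dots> \<le> q * \<delta> * 5 ^ d" using q_ge_1 delta(1) by simp
  also have "\<dots> \<le> \<kappa> / 2" by (rule delta)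
  finally show "cmod (v i ^ d - F a v t i) \<le> \<kappa> / 2" by (simp add: norm_minus_commute)
qed

text \<open>The closeness to the torus is that of the image point; \<open>near_torus_jac\<close> is
  the version for the source. Here |v_j|^d >= 1 - \<kappa>/2 - \<kappa> >= 1/2.\<close>

lemma near_fibre_jac:
  assumes a: "coef_bound N d R a" "0 \<le> R" and t: "R * cmod t \<le> \<delta>"
    and F: "\<And>i. i < N \<Longrightarrow> cmod (F a v t i - \<omega> i) \<le> \<kappa>" and \<omega>: "\<And>i. i < N \<Longrightarrow> cmod (\<omega> i) = 1"
  shows "Jac a v t \<noteq> 0"
proof (rule jac_nonzero_near[OF a _ _ t delta(4)])
  have F2: "cmod (F a v t i) \<le> 2" if "i < N" for i
    using norm_triangle_ineq[of "F a v t i - \<omega> i" "\<omega> i"] F[OF that] \<omega>[OF that] kappa(2) by simp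
  fix j assume j: "j < N"
  show "cmod (v j) \<le> 5" by (rule near_fibre[OF a t F2 j])
  have "1 \<le> cmod (v j ^ d) + cmod (v j ^ d - F a v t j) + cmod (F a v t j - \<omega> j)"
    unfolding \<omega>[OF j, symmetric]
    using norm_triangle_ineq4[of "v j ^ d" "v j ^ d - \<omega> j"] norm_triangle_ineq[of "v j ^ d - F a v t j" "F a v t j - \<omega> j"]
    by simp
  then show "1 / 2 \<le> cmod (v j) ^ d"
    using near_fibre(2)[OF a t F2 j] F[OF j] kappa(2) by (simp add: norm_power)
qed

lemma near_torus_jac:
  assumes a: "coef_bound N d R a" "0 \<le> R" and t: "R * cmod t \<le> \<delta>"
    and v: "\<And>i. i < N \<Longrightarrow> cmod (v i - \<omega> i) \<le> \<kappa>" and \<omega>: "\<And>i. i < N \<Longrightarrow> cmod (\<omega> i) = 1"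
  shows "Jac a v t \<noteq> 0"
proof (rule jac_nonzero_near[OF a _ _ t delta(4)])
  fix j assume j: "j < N"
  show "cmod (v j) \<le> 5"
    using norm_triangle_ineq[of "v j - \<omega> j" "\<omega> j"] v[OF j] \<omega>[OF j] kappa(2) by simp
  have "1 - \<kappa> \<le> cmod (v j)"
    using norm_triangle_ineq4[of "v j" "v j - \<omega> j"] v[OF j] \<omega>[OF j] by simp
  then have "(1 - \<kappa>) ^ d \<le> cmod (v j) ^ d" using kappa(2) by (intro power_mono) auto
  moreover have "1 + real d * (- \<kappa>) \<le> (1 + - \<kappa>) ^ d"
    by (rule Bernoulli_inequality) (use kappa(2) in simp)
  ultimately show "1 / 2 \<le> cmod (v j) ^ d" using kappa(3) by simp
qed

text \<open>In x^d - y^d = (x - y) T each of the d summands of T is within 1/8 of w^(d-1), hence |T|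
  >= 7 d / 8 >= 7/4 as d >= 2.\<close>

lemma power_diff_near:
  assumes x: "cmod (x - w) \<le> \<kappa>" and y: "cmod (y - w) \<le> \<kappa>" and w: "cmod w = 1"
  shows "7 / 4 * cmod (x - y) \<le> cmod (x ^ d - y ^ d)"
proof -
  obtain n where n: "d = Suc n" using d_ge_2 by (cases d) auto
  have w0: "w \<noteq> 0" using w by auto
  define e f where "e = (x - w) / w" and "f = (y - w) / w"
  have ef: "cmod e \<le> \<kappa>" "cmod f \<le> \<kappa>" "x = w * (1 + e)" "y = w * (1 + f)"
    using x y w w0 by (auto simp: e_def f_def norm_divide field_simps)
  define T where "T = (\<Sum>p<Suc n. x ^ p * y ^ (n - p))"
  have "cmod (x ^ p * y ^ (n - p) - w ^ n) \<le> 1 / 8" if p: "p < Suc n" for p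
  proof -
    have "x ^ p * y ^ (n - p) - w ^ n = w ^ n * ((1 + e) ^ p * (1 + f) ^ (n - p) - 1)"
    proof -
      have "w ^ n = w ^ p * w ^ (n - p)" using p by (simp add: power_add[symmetric])
      then show ?thesis unfolding ef(3,4) power_mult_distrib by (simp add: algebra_simps)
    qed
    then have "cmod (x ^ p * y ^ (n - p) - w ^ n) = cmod ((1 + e) ^ p * (1 + f) ^ (n - p) - 1)"
      by (simp add: norm_mult norm_power w)
    also have "\<dots> \<le> (1 + ((1 + \<kappa>) ^ p - 1)) * (1 + ((1 + \<kappa>) ^ (n - p) - 1)) - 1"
      by (intro norm_mult_minus_one_le norm_power_minus_one_le ef)
    also have "\<dots> = (1 + \<kappa>) ^ n - 1" using p by (simp add: power_add[symmetric])
    also have "\<dots> \<le> 1 / 8" using kappa_power[of n] n by simp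
    finally show ?thesis .
  qed
  then have "cmod (\<Sum>p<Suc n. x ^ p * y ^ (n - p) - w ^ n) \<le> (\<Sum>p<Suc n. 1 / 8)"
    by (intro sum_norm_le) auto
  then have "cmod (T - of_nat d * w ^ n) \<le> real d / 8"
    by (simp only: sum_subtractf T_def[symmetric]) (simp add: n)
  moreover have "real d \<le> cmod T + cmod (T - of_nat d * w ^ n)"
    using norm_triangle_ineq4[of T "T - of_nat d * w ^ n"] by (simp add: norm_mult norm_power w)
  ultimately have "7 / 4 \<le> cmod T" using d_ge_2 by linarith
  then have "7 / 4 * cmod (x - y) \<le> cmod T * cmod (x - y)" by (rule mult_right_mono) simp
  moreover have "x ^ d - y ^ d = (x - y) * T" unfolding n T_def by (rule diff_power_eq_sum)
  ultimately show ?thesis by (simp add: norm_mult mult.commute)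
qed

text \<open>The powers separate by 7/4 C and the lower terms change by at most C / 10, which leaves
  more than 3/2 C. The coordinate i is one where the maximum C is attained, since the lower terms
  mix all coordinates.\<close>

lemma near_expansion:
  assumes a: "coef_bound N d R a" "0 \<le> R" and t: "R * cmod t \<le> \<delta>" and \<omega>: "\<And>i. i < N \<Longrightarrow> cmod (\<omega> i) = 1"
    and v: "\<And>i. i < N \<Longrightarrow> cmod (v i - \<omega> i) \<le> \<kappa>" and w: "\<And>i. i < N \<Longrightarrow> cmod (w i - \<omega> i) \<le> \<kappa>"
    and C: "\<And>j. j < N \<Longrightarrow> cmod (v j - w j) \<le> C" and i: "i < N" and eq: "cmod (v i - w i) = C"
  shows "3 / 2 * C \<le> cmod (F a v t i - F a w t i)"
proof -
  define \<gamma> where "\<gamma> s l = w l + s * (v l - w l)" for s l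
  define \<phi> where "\<phi> s = F a (\<gamma> s) t i - \<gamma> s i ^ d" for s
  define E where "E s j = DF a (\<gamma> s) t i j - (if i = j then of_nat d * \<gamma> s i ^ (d - 1) else 0)" for s j
  have C0: "0 \<le> C" using eq by auto
  have d: "(\<phi> has_field_derivative (\<Sum>j<N. E s j * (v j - w j))) (at s)" for s
  proof -
    have \<gamma>: "((\<lambda>s. \<gamma> s l) has_field_derivative (v l - w l)) (at s)" for l
      unfolding \<gamma>_def by (auto intro!: derivative_eq_intros)
    have "(\<phi> has_field_derivative (\<Sum>j<N. DF a (\<gamma> s) t i j * (v j - w j)) - of_nat d * ((v i - w i) * \<gamma> s i ^ (d - Suc 0))) (at s)"
      unfolding \<phi>_def by (intro DERIV_diff mapc_has_derivative \<gamma> i DERIV_power)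
    moreover have "(\<Sum>j<N. (if i = j then of_nat d * \<gamma> s i ^ (d - 1) else 0) * (v j - w j)) = of_nat d * ((v i - w i) * \<gamma> s i ^ (d - Suc 0))"
    proof -
      have "(\<Sum>j<N. (if i = j then of_nat d * \<gamma> s i ^ (d - 1) else 0) * (v j - w j))
        = (\<Sum>j<N. if i = j then of_nat d * \<gamma> s i ^ (d - 1) * (v j - w j) else 0)"
        by (intro sum.cong) auto
      then show ?thesis using i by (simp add: mult_ac)
    qed
    ultimately show ?thesis unfolding E_def left_diff_distrib sum_subtractf by simp
  qed
  have "cmod (\<phi> 1 - \<phi> 0) \<le> C / 10 * cmod (1 - 0)"
  proof (rule field_differentiable_bound[where S = "closed_segment 0 1"])
    fix s :: complex assume "s \<in> closed_segment 0 1"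
    then obtain r where r: "s = of_real r" "0 \<le> r" "r \<le> 1"
      by (auto simp: closed_segment_def scaleR_conv_of_real)
    show "(\<phi> has_field_derivative (\<Sum>j<N. E s j * (v j - w j))) (at s within closed_segment 0 1)"
      using d by (rule has_field_derivative_at_within)
    have 5: "cmod (\<gamma> s j) \<le> 5" if j: "j < N" for j
    proof -
      have "cmod (v j) \<le> 5" "cmod (w j) \<le> 5"
        using norm_triangle_ineq[of "v j - \<omega> j" "\<omega> j"] norm_triangle_ineq[of "w j - \<omega> j" "\<omega> j"]
          v[OF j] w[OF j] \<omega>[OF j] kappa(2) by simp_all
      moreover have "\<gamma> s j = of_real (1 - r) * w j + of_real r * v j"
        unfolding \<gamma>_def r by (simp add: algebra_simps)
      moreover have "cmod (of_real (1 - r) * w j + of_real r * v j) \<le> (1 - r) * cmod (w j) + r * cmod (v j)"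
        using r norm_triangle_ineq[of "of_real (1 - r) * w j" "of_real r * v j"]
        by (simp add: norm_mult del: of_real_diff)
      moreover have "(1 - r) * cmod (w j) + r * cmod (v j) \<le> (1 - r) * 5 + r * 5"
        using r calculation(1,2) by (intro add_mono mult_left_mono) auto
      ultimately show ?thesis by simp
    qed
    have "cmod (\<Sum>j<N. E s j * (v j - w j)) \<le> (\<Sum>j<N. q * (\<delta> * (real d * 5 ^ d)) * C)"
      unfolding E_def
      by (intro sum_norm_le norm_mult_le_mult dmapc_lower_bound[OF a i _ 5 _ t delta(2)] C) auto
    also have "\<dots> = (real N * (q * (\<delta> * (real d * 5 ^ d)))) * C" by simp
    also have "\<dots> \<le> 1 / 10 * C" by (rule mult_right_mono[OF delta(4) C0])
    finally show "cmod (\<Sum>j<N. E s j * (v j - w j)) \<le> C / 10" by simp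
  qed auto
  moreover have "\<gamma> 1 = v" "\<gamma> 0 = w" by (auto simp: \<gamma>_def)
  ultimately have "cmod ((F a v t i - v i ^ d) - (F a w t i - w i ^ d)) \<le> C / 10"
    by (simp add: \<phi>_def)
  moreover have "7 / 4 * C \<le> cmod (v i ^ d - w i ^ d)"
    using power_diff_near[OF v[OF i] w[OF i] \<omega>[OF i]] eq by simp
  moreover have "cmod (v i ^ d - w i ^ d) \<le> cmod (F a v t i - F a w t i) + cmod ((F a v t i - v i ^ d) - (F a w t i - w i ^ d))"
    using norm_triangle_ineq4[of "F a v t i - F a w t i" "(F a v t i - v i ^ d) - (F a w t i - w i ^ d)"] by (simp add: algebra_simps)
  ultimately show ?thesis using C0 by linarith
qed

text \<open>Two orbits over the same t that shadow the same torus orbit stay within 2 \<kappa> of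
  each other, but the lower bound for their distance grows by 3/2 at each step. This identifies
  points of limit discs in \<open>Lam_limit_transfer\<close>.\<close>

lemma near_orbit_unique:
  assumes a: "coef_bound N d R a" "0 \<le> R" and t: "R * cmod t \<le> \<delta>" "cmod t \<le> 1"
    and \<omega>: "\<And>i. i < N \<Longrightarrow> cmod (\<omega> i) = 1"
    and v: "\<And>n i. i < N \<Longrightarrow> cmod (it a n v t i - \<omega> i ^ (d ^ n)) \<le> \<kappa>"
    and w: "\<And>n i. i < N \<Longrightarrow> cmod (it a n w t i - \<omega> i ^ (d ^ n)) \<le> \<kappa>"
    and i: "i < N"
  shows "v i = w i"
proof (rule ccontr)
  assume "v i \<noteq> w i"
  define c where "c = cmod (v i - w i)"
  have c: "c > 0" using \<open>v i \<noteq> w i\<close> by (simp add: c_def)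
  have "\<exists>j<N. (3 / 2) ^ n * c \<le> cmod (it a n v t j - it a n w t j)" for n
  proof (induction n)
    case 0
    show ?case using i by (intro exI[of _ i]) (simp add: itc_0 c_def)
  next
    case (Suc n)
    define D where "D = (\<lambda>j. cmod (it a n v t j - it a n w t j)) ` {..<N}"
    have D: "finite D" "D \<noteq> {}" using i by (auto simp: D_def)
    from Max_in[OF D] obtain k where k: "k < N" "Max D = cmod (it a n v t k - it a n w t k)"
      unfolding D_def by auto
    have le: "cmod (it a n v t j - it a n w t j) \<le> Max D" if "j < N" for j
      using that D(1) by (intro Max_ge) (auto simp: D_def)
    \<comment> \<open>As |t| \<le> 1, the parameter only shrinks along the orbit and stays in the
      range of the expansion estimate.\<close>
    have "R * cmod (t ^ (d ^ n)) \<le> R * cmod t"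
    proof (intro mult_left_mono a)
      have "cmod t ^ (d ^ n) \<le> cmod t ^ 1" using t(2) d_ge_2 by (intro power_decreasing) auto
      then show "cmod (t ^ (d ^ n)) \<le> cmod t" by (simp add: norm_power)
    qed
    then have tn: "R * cmod (t ^ (d ^ n)) \<le> \<delta>" using t(1) by linarith
    have "3 / 2 * Max D \<le> cmod (F a (it a n v t) (t ^ (d ^ n)) k - F a (it a n w t) (t ^ (d ^ n)) k)"
      by (rule near_expansion[OF a tn, where \<omega> = "\<lambda>i. \<omega> i ^ (d ^ n)"])
        (use \<omega> v w le k in \<open>simp_all add: norm_power\<close>)
    moreover have "(3 / 2) ^ n * c \<le> Max D" using Suc le by force
    ultimately have "(3 / 2) ^ Suc n * c \<le> cmod (it a (Suc n) v t k - it a (Suc n) w t k)"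
      by (simp add: itc_Suc'[OF k(1)])
    then show ?case using k(1) by blast
  qed
  moreover have "cmod (it a n v t j - it a n w t j) \<le> 2 * \<kappa>" if "j < N" for n j
    using norm_triangle_ineq4[of "it a n v t j - \<omega> j ^ (d ^ n)" "it a n w t j - \<omega> j ^ (d ^ n)"] v[OF that] w[OF that]
    by (simp add: ) (smt (verit))
  ultimately have bd: "(3 / 2) ^ n * c \<le> 2 * \<kappa>" for n by (meson order_trans)
  obtain n where "2 * \<kappa> / c < (3 / 2) ^ n" using real_arch_pow[of "3 / 2" "2 * \<kappa> / c"] by auto
  then show False using bd[of n] c by (simp add: field_simps)
qed

text \<open>Barrier on the segment from 0 to z: where |\<xi>_i - \<omega>_i| equals \<kappa>,
  expansion puts the d-th powers at distance at least 7/4 \<kappa>, while the fibre equation allows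
  at most 3/2 \<kappa>.\<close>

lemma lift_stays_near:
  assumes a: "coef_bound N d R a" "0 \<le> R" and \<rho>: "R * \<rho> \<le> \<delta>"
    and \<omega>: "\<And>i. i < N \<Longrightarrow> cmod (\<omega> i) = 1"
    and u: "\<And>i z. i < N \<Longrightarrow> z \<in> ball 0 \<rho> \<Longrightarrow> cmod (u i z - \<omega> i ^ d) \<le> \<kappa>"
    and l: "is_lift a u (ball 0 \<rho>) \<xi>" and x: "\<And>i. i < N \<Longrightarrow> \<xi> i 0 = \<omega> i"
    and z: "z \<in> ball 0 \<rho>" and i: "i < N"
  shows "cmod (\<xi> i z - \<omega> i) \<le> \<kappa>"
proof (rule ccontr)
  assume contra: "\<not> ?thesis"
  define g where "g s = cmod (\<xi> i (of_real s * z) - \<omega> i)" for s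
  have sz: "of_real s * z \<in> ball 0 \<rho>" if "0 \<le> s" "s \<le> 1" for s
  proof -
    have "s * cmod z \<le> 1 * cmod z" using that by (intro mult_right_mono) auto
    then show ?thesis using z that by (simp add: norm_mult)
  qed
  have hol: "\<xi> i holomorphic_on ball 0 \<rho>" using l i by (simp add: is_lift_def)
  have "continuous_on {0..1} (\<lambda>s. \<xi> i (of_real s * z))"
    by (rule continuous_on_compose2[OF holomorphic_on_imp_continuous_on[OF hol]])
      (use sz in \<open>auto intro!: continuous_intros\<close>)
  then have "continuous_on {0..1} g" unfolding g_def by (intro continuous_intros)
  moreover have "g 0 \<le> \<kappa>" using x[OF i] kappa(1) by (simp add: g_def)
  moreover have "\<kappa> \<le> g 1" using contra by (simp add: g_def)
  ultimately obtain s where s: "0 \<le> s" "s \<le> 1" "g s = \<kappa>"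
    using IVT'[of g 0 \<kappa> 1] by auto
  define y where "y = of_real s * z"
  have y: "y \<in> ball 0 \<rho>" unfolding y_def by (rule sz[OF s(1,2)])
  have fib: "fibre a u y (\<lambda>i. \<xi> i y)" using l y by (simp add: is_lift_def)
  have Fu: "F a (\<lambda>i. \<xi> i y) y j = u j y" if "j < N" for j using fib that by (simp add: fibre_def)
  have F2: "cmod (F a (\<lambda>i. \<xi> i y) y j) \<le> 2" if "j < N" for j
    using norm_triangle_ineq[of "u j y - \<omega> j ^ d" "\<omega> j ^ d"] u[OF that y] \<omega>[OF that] kappa(2) Fu[OF that]
    by (simp add: norm_power)
  have "R * cmod y \<le> R * \<rho>" using y a(2) by (intro mult_left_mono) auto
  then have t: "R * cmod y \<le> \<delta>" using \<rho> by linarith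
  have "cmod (\<xi> i y ^ d - u i y) \<le> \<kappa> / 2"
    using near_fibre(2)[OF a t F2 i] Fu[OF i] by simp
  then have "cmod (\<xi> i y ^ d - \<omega> i ^ d) \<le> \<kappa> / 2 + \<kappa>"
    using norm_triangle_ineq[of "\<xi> i y ^ d - u i y" "u i y - \<omega> i ^ d"] u[OF i y] by simp
  moreover have "7 / 4 * cmod (\<xi> i y - \<omega> i) \<le> cmod (\<xi> i y ^ d - \<omega> i ^ d)"
    by (rule power_diff_near[OF _ _ \<omega>[OF i]]) (use s kappa(1) in \<open>simp_all add: g_def y_def\<close>)
  moreover have "cmod (\<xi> i y - \<omega> i) = \<kappa>" using s(3) by (simp add: g_def y_def)
  ultimately show False using kappa(1) by linarith
qed

text \<open>Level-n substitute for the disc that follows the orbit of \<omega>: the first N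
  coordinates of the n-th iterate are constant on it, so the torus condition holds exactly at time
  n, and up to then its orbits shadow that of \<omega>. Finite levels arise by lifting
  alone.\<close>

definition slice :: "(nat \<Rightarrow> (nat \<Rightarrow> nat) \<Rightarrow> complex) \<Rightarrow> real \<Rightarrow> nat \<Rightarrow> (nat \<Rightarrow> complex) \<Rightarrow> (nat \<Rightarrow> complex \<Rightarrow> complex) \<Rightarrow> bool" where
  "slice a \<rho> n \<omega> \<eta> \<longleftrightarrow> (\<forall>i<N. cmod (\<omega> i) = 1) \<and> (\<forall>i<N. \<eta> i holomorphic_on ball 0 \<rho>) \<and> (\<forall>i<N. \<eta> i 0 = \<omega> i) \<and>
    (\<forall>z\<in>ball 0 \<rho>. \<forall>i<N. it a n (\<lambda>i. \<eta> i z) z i = \<omega> i ^ (d ^ n)) \<and>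
    (\<forall>z\<in>ball 0 \<rho>. \<forall>j\<le>n. \<forall>i<N. cmod (it a j (\<lambda>i. \<eta> i z) z i - \<omega> i ^ (d ^ j)) \<le> \<kappa>)"

lemma slice_near:
  assumes "slice a \<rho> n \<omega> \<eta>" "z \<in> ball 0 \<rho>" "i < N"
  shows "cmod (\<eta> i z - \<omega> i) \<le> \<kappa>"
proof -
  have "\<forall>j\<le>n. \<forall>i<N. cmod (it a j (\<lambda>i. \<eta> i z) z i - \<omega> i ^ (d ^ j)) \<le> \<kappa>"
    using assms unfolding slice_def by blast
  then have "cmod (it a 0 (\<lambda>i. \<eta> i z) z i - \<omega> i ^ (d ^ 0)) \<le> \<kappa>" using assms(3) by blast
  then show ?thesis using assms(3) by (simp add: itc_0)
qed

lemma ball_power_subset: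
  assumes "z \<in> ball (0::complex) \<rho>" "\<rho> \<le> 1"
  shows "z ^ d \<in> ball 0 \<rho>"
proof -
  have "cmod z ^ d \<le> cmod z ^ 1" using assms d_ge_2 by (intro power_decreasing) auto
  then show ?thesis using assms by (simp add: norm_power)
qed

text \<open>The slice stays within \<kappa> of the torus and R |z| is below \<delta>, so the fibres
  over it contain no critical point and every choice of d-th roots of the centre starts a lift. In
  the last part the lift is arbitrary and its centre is read off as \<xi>(0), since
  \<open>point_on_slice\<close> does not know the branch in advance.\<close>

lemma slice_pullback:
  assumes a: "coef_bound N d R a" "0 \<le> R" and \<rho>: "R * \<rho> \<le> \<delta>" "0 < \<rho>" "\<rho> \<le> 1"
    and s: "slice a \<rho> n \<omega> \<eta>"
  shows slice_pullback_hol: "\<And>i. i < N \<Longrightarrow> (\<lambda>z. \<eta> i (z ^ d)) holomorphic_on ball 0 \<rho>"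
    and slice_pullback_jac: "\<And>z v. z \<in> ball 0 \<rho> \<Longrightarrow> fibre a (\<lambda>i z. \<eta> i (z ^ d)) z v \<Longrightarrow> Jac a v z \<noteq> 0"
    and slice_pullback_lift: "\<And>x. (\<And>i. i < N \<Longrightarrow> x i ^ d = \<omega> i) \<Longrightarrow>
      \<exists>\<xi>. is_lift a (\<lambda>i z. \<eta> i (z ^ d)) (ball 0 \<rho>) \<xi> \<and> (\<forall>i<N. \<xi> i 0 = x i)"
    and slice_pullback_slice: "\<And>\<xi>. is_lift a (\<lambda>i z. \<eta> i (z ^ d)) (ball 0 \<rho>) \<xi> \<Longrightarrow> slice a \<rho> (Suc n) (\<lambda>i. \<xi> i 0) \<xi>"
proof -
  let ?u = "\<lambda>i z. \<eta> i (z ^ d)"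
  have s1: "\<And>i. i < N \<Longrightarrow> cmod (\<omega> i) = 1" "\<And>i. i < N \<Longrightarrow> \<eta> i holomorphic_on ball 0 \<rho>" "\<And>i. i < N \<Longrightarrow> \<eta> i 0 = \<omega> i"
    using s unfolding slice_def by auto
  have z0: "(0::complex) ^ d = 0" using d_ge_2 by (simp add: zero_power)
  note pw = ball_power_subset[OF _ \<rho>(3)]
  show hol: "?u i holomorphic_on ball 0 \<rho>" if i: "i < N" for i
  proof -
    have "\<eta> i \<circ> (\<lambda>z. z ^ d) holomorphic_on ball 0 \<rho>"
      by (rule holomorphic_on_compose_gen[OF _ s1(2)[OF i]]) (use pw in \<open>auto intro!: holomorphic_intros\<close>)
    then show ?thesis by (simp add: o_def)
  qed
  have near: "cmod (?u i z - \<omega> i) \<le> \<kappa>" if "z \<in> ball 0 \<rho>" "i < N" for i z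
    by (rule slice_near[OF s pw[OF that(1)] that(2)])
  show jac: "Jac a v z \<noteq> 0" if z: "z \<in> ball 0 \<rho>" and f: "fibre a ?u z v" for z v
  proof -
    have "R * cmod z \<le> R * \<rho>" using z a(2) by (intro mult_left_mono) auto
    then have t: "R * cmod z \<le> \<delta>" using \<rho> by linarith
    have nf: "cmod (F a v z i - \<omega> i) \<le> \<kappa>" if "i < N" for i
      using f near[OF z that] that by (simp add: fibre_def)
    show ?thesis by (rule near_fibre_jac[where \<omega> = \<omega>, OF a t]) (rule nf s1(1), assumption)+
  qed
  show "\<exists>\<xi>. is_lift a ?u (ball 0 \<rho>) \<xi> \<and> (\<forall>i<N. \<xi> i 0 = x i)" if x: "\<And>i. i < N \<Longrightarrow> x i ^ d = \<omega> i" for x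
  proof -
    have "fibre a ?u 0 x" unfolding fibre_def z0 using x s1(3) by (simp add: mapc_at_0)
    show ?thesis
      by (rule lift_exists[where u = ?u, OF a hol \<rho>(2) jac \<open>fibre a ?u 0 x\<close>])
  qed
  show "slice a \<rho> (Suc n) (\<lambda>i. \<xi> i 0) \<xi>" if l: "is_lift a ?u (ball 0 \<rho>) \<xi>" for \<xi>
  proof -
    have fib: "F a (\<lambda>i. \<xi> i z) z i = \<eta> i (z ^ d)" if "z \<in> ball 0 \<rho>" "i < N" for z i
      using l that by (simp add: is_lift_def fibre_def)
    have pow: "\<xi> i 0 ^ d = \<omega> i" if "i < N" for i
      using fib[of 0 i] that \<rho>(2) s1(3)[OF that] unfolding z0 by (simp add: mapc_at_0)
    have one: "cmod (\<xi> i 0) = 1" if "i < N" for i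
    proof -
      have "cmod (\<xi> i 0) ^ d = 1" using pow[OF that] s1(1)[OF that] by (metis norm_power)
      then show ?thesis using d_ge_2 power_eq_imp_eq_base[of "cmod (\<xi> i 0)" d 1] by simp
    qed
    have step: "it a (Suc j) (\<lambda>i. \<xi> i z) z = it a j (\<lambda>i. \<eta> i (z ^ d)) (z ^ d)" if "z \<in> ball 0 \<rho>" for z j
      unfolding itc_Suc by (rule itc_cong) (rule fib[OF that])
    have exp: "\<xi> i 0 ^ (d ^ Suc j) = \<omega> i ^ (d ^ j)" if "i < N" for i j
      by (simp add: power_mult pow[OF that])
    have S: "\<forall>z\<in>ball 0 \<rho>. \<forall>i<N. it a n (\<lambda>i. \<eta> i z) z i = \<omega> i ^ (d ^ n)"
      "\<forall>z\<in>ball 0 \<rho>. \<forall>j\<le>n. \<forall>i<N. cmod (it a j (\<lambda>i. \<eta> i z) z i - \<omega> i ^ (d ^ j)) \<le> \<kappa>"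
      using s unfolding slice_def by blast+
    show ?thesis
      unfolding slice_def
    proof (intro conjI allI impI ballI)
      fix i assume i: "i < N"
      show "\<xi> i holomorphic_on ball 0 \<rho>" using l i by (simp add: is_lift_def)
    next
      fix z :: complex and i assume z: "z \<in> ball 0 \<rho>" and i: "i < N"
      show "it a (Suc n) (\<lambda>i. \<xi> i z) z i = \<xi> i 0 ^ (d ^ Suc n)"
        unfolding step[OF z] exp[OF i] using S(1) pw[OF z] i by blast
    next
      fix z :: complex and j i assume z: "z \<in> ball 0 \<rho>" and j: "j \<le> Suc n" and i: "i < N"
      show "cmod (it a j (\<lambda>i. \<xi> i z) z i - \<xi> i 0 ^ (d ^ j)) \<le> \<kappa>"
      proof (cases j)
        case 0
        have "cmod (\<xi> i z - \<xi> i 0) \<le> \<kappa>"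
        proof (rule lift_stays_near[OF a \<rho>(1) one _ l _ z i])
          show "cmod (\<eta> k (y ^ d) - \<xi> k 0 ^ d) \<le> \<kappa>" if "k < N" "y \<in> ball 0 \<rho>" for k y
            unfolding pow[OF that(1)] by (rule near[OF that(2,1)])
        qed simp_all
        then show ?thesis using i 0 by (simp add: itc_0)
      next
        case (Suc k)
        have "k \<le> n" using j Suc by simp
        then show ?thesis
          unfolding Suc step[OF z] exp[OF i] using S(2) pw[OF z] i by blast
      qed
    qed (use one in auto)
  qed
qed

lemma slice_exists:
  assumes a: "coef_bound N d R a" "0 \<le> R" and \<rho>: "R * \<rho> \<le> \<delta>" "0 < \<rho>" "\<rho> \<le> 1"
    and \<omega>: "\<And>i. i < N \<Longrightarrow> cmod (\<omega> i) = 1"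
  shows "\<exists>\<eta>. slice a \<rho> n \<omega> \<eta>"
  using \<omega>
proof (induction n arbitrary: \<omega>)
  case 0
  have "slice a \<rho> 0 \<omega> (\<lambda>i z. \<omega> i)"
    unfolding slice_def using 0 kappa(1) by (auto simp: itc_0)
  then show ?case by blast
next
  case (Suc n)
  have "\<exists>\<eta>. slice a \<rho> n (\<lambda>i. \<omega> i ^ d) \<eta>" by (rule Suc.IH) (simp add: norm_power Suc.prems)
  then obtain \<eta> where \<eta>: "slice a \<rho> n (\<lambda>i. \<omega> i ^ d) \<eta>" ..
  have "\<exists>\<xi>. is_lift a (\<lambda>i z. \<eta> i (z ^ d)) (ball 0 \<rho>) \<xi> \<and> (\<forall>i<N. \<xi> i 0 = \<omega> i)"
    by (rule slice_pullback_lift[OF a \<rho> \<eta>]) simp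
  then obtain \<xi> where \<xi>: "is_lift a (\<lambda>i z. \<eta> i (z ^ d)) (ball 0 \<rho>) \<xi>" "\<forall>i<N. \<xi> i 0 = \<omega> i" by blast
  have "slice a \<rho> (Suc n) (\<lambda>i. \<xi> i 0) \<xi>" by (rule slice_pullback_slice[OF a \<rho> \<eta> \<xi>(1)])
  then have "slice a \<rho> (Suc n) \<omega> \<xi>" unfolding slice_def using \<xi>(2) by simp
  then show ?case by blast
qed

text \<open>Converse of \<open>slice_exists\<close>: the lifts of a slice exhaust the fibres over
  it, by \<open>fibre_point_on_lift\<close>, so induction on n puts a slice through every point with
  |z| < \<rho> that is on the torus at time n. At level 0 it is the constant disc through v.\<close>

lemma point_on_slice:
  assumes a: "coef_bound N d R a" "0 \<le> R" and \<rho>: "R * \<rho> \<le> \<delta>" "0 < \<rho>" "\<rho> \<le> 1"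
    and z: "z \<in> ball 0 \<rho>" and v: "\<And>i. i < N \<Longrightarrow> cmod (it a n v z i) = 1"
  shows "\<exists>\<omega> \<eta>. slice a \<rho> n \<omega> \<eta> \<and> (\<forall>i<N. \<eta> i z = v i)"
  using z v
proof (induction n arbitrary: v z)
  case 0
  have "slice a \<rho> 0 v (\<lambda>i z. v i)"
    unfolding slice_def using 0 kappa(1) by (auto simp: itc_0)
  then show ?case by blast
next
  case (Suc n)
  have "\<exists>\<omega> \<eta>. slice a \<rho> n \<omega> \<eta> \<and> (\<forall>i<N. \<eta> i (z ^ d) = F a v z i)"
  proof (rule Suc.IH)
    show "z ^ d \<in> ball 0 \<rho>" by (rule ball_power_subset[OF Suc.prems(1) \<rho>(3)])
    show "cmod (it a n (F a v z) (z ^ d) i) = 1" if "i < N" for i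
      using Suc.prems(2)[OF that] by (simp add: itc_Suc)
  qed
  then obtain \<omega> \<eta> where \<eta>: "slice a \<rho> n \<omega> \<eta>" "\<forall>i<N. \<eta> i (z ^ d) = F a v z i" by blast
  have \<eta>0: "\<eta> i 0 = \<omega> i" "cmod (\<omega> i) = 1" if "i < N" for i using \<eta>(1) that unfolding slice_def by auto
  have "\<exists>\<xi>. is_lift a (\<lambda>i z. \<eta> i (z ^ d)) (ball 0 \<rho>) \<xi> \<and> (\<forall>i<N. \<xi> i z = v i) \<and> True"
  proof (rule fibre_point_on_lift[where u = "\<lambda>i z. \<eta> i (z ^ d)" and Q = "\<lambda>_. True"])
    show "(\<lambda>z. \<eta> i (z ^ d)) holomorphic_on ball 0 \<rho>" if "i < N" for i
      by (rule slice_pullback_hol[OF a \<rho> \<eta>(1) that])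
    show "cmod (\<eta> i (0 ^ d)) = 1" if "i < N" for i using \<eta>0[OF that] d_ge_2 by (simp add: zero_power)
    show "\<exists>\<xi>. is_lift a (\<lambda>i z. \<eta> i (z ^ d)) (ball 0 \<rho>) \<xi> \<and> (\<forall>i<N. \<xi> i 0 = x i) \<and> True"
      if "\<And>i. i < N \<Longrightarrow> x i ^ d = \<eta> i (0 ^ d)" for x
      unfolding simp_thms by (rule slice_pullback_lift[OF a \<rho> \<eta>(1)]) (use that \<eta>0 d_ge_2 in \<open>simp add: zero_power\<close>)
    show "fibre a (\<lambda>i z. \<eta> i (z ^ d)) z v" unfolding fibre_def using \<eta>(2) by simp
  qed (rule Suc.prems(1))
  then obtain \<xi> where \<xi>: "is_lift a (\<lambda>i z. \<eta> i (z ^ d)) (ball 0 \<rho>) \<xi>" "\<forall>i<N. \<xi> i z = v i" by blast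
  have "slice a \<rho> (Suc n) (\<lambda>i. \<xi> i 0) \<xi>" by (rule slice_pullback_slice[OF a \<rho> \<eta>(1) \<xi>(1)])
  then show ?case using \<xi>(2) by blast
qed

end

section \<open>Limits of discs\<close>

text \<open>Montel's theorem upgrades the pointwise limit to a locally uniform one. Hurwitz's
  theorem needs a nonconstant limit; a constant one is nonzero because of its value at 0.\<close>

lemma hurwitz_pointwise:
  fixes h :: "nat \<Rightarrow> complex \<Rightarrow> complex"
  assumes hol: "\<And>k. h k holomorphic_on ball 0 \<rho>" and bd: "\<And>k z. z \<in> ball 0 \<rho> \<Longrightarrow> cmod (h k z) \<le> M"
    and lim: "\<And>z. z \<in> ball 0 \<rho> \<Longrightarrow> (\<lambda>k. h k z) \<longlonglongrightarrow> g z"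
    and nz: "\<And>k z. z \<in> ball 0 \<rho> \<Longrightarrow> h k z \<noteq> 0" and g0: "g 0 \<noteq> 0" and z: "z \<in> ball 0 \<rho>"
  shows "g z \<noteq> 0"
proof -
  have \<rho>: "0 < \<rho>" using z by (metis mem_ball_0 norm_ge_zero le_less_trans)
  obtain G r where G: "G holomorphic_on ball 0 \<rho>" "strict_mono (r :: nat \<Rightarrow> nat)"
    "\<And>x. x \<in> ball 0 \<rho> \<Longrightarrow> ((\<lambda>k. h (r k) x) \<longlongrightarrow> G x) sequentially"
    "\<And>K. compact K \<Longrightarrow> K \<subseteq> ball 0 \<rho> \<Longrightarrow> uniform_limit K (h \<circ> r) G sequentially"
    by (rule Montel[of "ball 0 \<rho>" "range h" h]) (use hol bd in \<open>auto intro!: exI[of _ M]\<close>)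
  have Gg: "G x = g x" if "x \<in> ball 0 \<rho>" for x
  proof (rule LIMSEQ_unique[OF G(3)[OF that]])
    from LIMSEQ_subseq_LIMSEQ[OF lim[OF that] G(2)] show "(\<lambda>k. h (r k) x) \<longlonglongrightarrow> g x" by (simp add: o_def)
  qed
  show ?thesis
  proof (cases "G constant_on ball 0 \<rho>")
    case True
    then obtain c where "\<forall>x\<in>ball 0 \<rho>. G x = c" unfolding constant_on_def by blast
    then have "G z = G 0" using z \<rho> by simp
    then show ?thesis using Gg[OF z] Gg[of 0] g0 \<rho> by simp
  next
    case False
    have "G z \<noteq> 0"
    proof (rule Hurwitz_no_zeros[of "ball 0 \<rho>" "h \<circ> r" G])
      show "(h \<circ> r) k holomorphic_on ball 0 \<rho>" for k using hol by simp
      show "(h \<circ> r) k x \<noteq> 0" if "x \<in> ball 0 \<rho>" for k x using nz[OF that] by simp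
    qed (use G False z in auto)
    then show ?thesis using Gg[OF z] by simp
  qed
qed

context regular_family
begin

text \<open>A convergent sequence is bounded, and for R >= 1 the inequality R \<le> R^(I_N) absorbs
  the weights.\<close>

lemma coef_bound_uniform:
  assumes lim: "\<And>i I. (\<lambda>k. a k i I) \<longlonglongrightarrow> a' i I"
  obtains R where "1 \<le> R" "\<And>k. coef_bound N d R (a k)" "coef_bound N d R a'"
proof -
  have "\<forall>i I. \<exists>B. \<forall>k. cmod (a k i I) \<le> B"
    using lim Bseq_iff2 convergentI convergent_imp_Bseq BseqE by metis
  then obtain B where B: "\<forall>i I k. cmod (a k i I) \<le> B i I" by metis
  have B0: "0 \<le> B i I" for i I using B norm_ge_zero order_trans by blast
  have B': "cmod (a' i I) \<le> B i I" for i I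
    by (rule Lim_norm_ubound[OF _ lim]) (use B in auto)
  define R where "R = 1 + (\<Sum>i<N. \<Sum>I\<in>IndStar N d. B i I)"
  have R1: "1 \<le> R" unfolding R_def using B0 by (simp add: sum_nonneg)
  have "B i I \<le> R ^ I N" if "i < N" "I \<in> IndStar N d" for i I
  proof -
    have "B i I \<le> (\<Sum>I\<in>IndStar N d. B i I)"
      using that B0 by (intro member_le_sum) (auto simp: finite_IndStar)
    also have "\<dots> \<le> (\<Sum>i<N. \<Sum>I\<in>IndStar N d. B i I)"
      using that B0 by (intro member_le_sum[of i "{..<N}" "\<lambda>i. \<Sum>I\<in>IndStar N d. B i I"]) (auto intro!: sum_nonneg)
    also have "\<dots> \<le> R ^ 1" by (simp add: R_def)
    also have "\<dots> \<le> R ^ I N" using R1 that by (intro power_increasing) (auto simp: IndStar_def)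
    finally show ?thesis .
  qed
  then have "coef_bound N d R (a k)" "coef_bound N d R a'" for k
    unfolding coef_bound_def using B B' order_trans by blast+
  then show thesis using that R1 by blast
qed

lemma coef_bound_exists: obtains R where "1 \<le> R" "coef_bound N d R a"
  by (rule coef_bound_uniform[of "\<lambda>_. a" a]) auto

text \<open>The point \<open>(p, z)\<close> lies on a limit of discs that \<open>n k\<close> iterates of \<open>b k\<close> map into the unit torus.\<close>

definition limit_disc :: "(nat \<Rightarrow> nat \<Rightarrow> (nat \<Rightarrow> nat) \<Rightarrow> complex) \<Rightarrow> (nat \<Rightarrow> nat) \<Rightarrow> real \<Rightarrow> (nat \<Rightarrow> complex)
    \<Rightarrow> complex \<Rightarrow> bool" where
  "limit_disc b n \<rho> p z \<longleftrightarrow> (\<exists>s y y' \<omega> U. strict_mono (s :: nat \<Rightarrow> nat)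
     \<and> (\<forall>k. \<forall>i<N. y k i holomorphic_on ball 0 \<rho>) \<and> (\<forall>i<N. y' i holomorphic_on ball 0 \<rho>)
     \<and> (\<forall>i<N. \<forall>x\<in>ball 0 \<rho>. (\<lambda>k. y k i x) \<longlonglongrightarrow> y' i x)
     \<and> (\<forall>i<N. cmod (\<omega> i) = 1) \<and> (\<forall>k. \<forall>i<N. y k i 0 = \<omega> i)
     \<and> (\<forall>k. \<forall>i<N. \<forall>x\<in>ball 0 \<rho>. cmod (y k i x) \<le> U)
     \<and> (\<forall>k. \<forall>i<N. \<forall>x\<in>ball 0 \<rho>. cmod (it (b (s k)) (n (s k)) (\<lambda>i. y k i x) x i) = 1)
     \<and> (\<forall>i<N. y' i z = p i))"

text \<open>By \<open>nc\<close> critical points are off the torus at time n_k + 1, so none lies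
  over the discs and each b_k has all its lifts; they are bounded by \<open>fibre_bound\<close> and
  converge along a subsequence. Hurwitz's theorem keeps the Jacobian of the limit map nonzero on the
  limit lifts, and since these exhaust the fibre, v lies on one of them.\<close>

lemma limit_disc_pullback:
  assumes R: "1 \<le> R" "\<And>k. coef_bound N d R (b k)" "coef_bound N d R a"
    and lim: "\<And>i I. (\<lambda>k. b k i I) \<longlonglongrightarrow> a i I" and \<rho>: "0 < \<rho>" "\<rho> \<le> 1"
    and disc: "limit_disc b n (\<rho> ^ d) (F a v z) (z ^ d)" and z: "z \<in> ball 0 \<rho>"
    and nc: "\<And>k x w. x \<in> ball 0 \<rho> \<Longrightarrow> Jac (b k) w x = 0 \<Longrightarrow> \<exists>i<N. cmod (it (b k) (Suc (n k)) w x i) \<noteq> 1"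
  shows "Jac a v z \<noteq> 0 \<and> limit_disc b (\<lambda>k. Suc (n k)) \<rho> v z"
proof -
  obtain s y y' \<omega> U where s: "strict_mono (s :: nat \<Rightarrow> nat)"
     and y: "\<forall>k. \<forall>i<N. y k i holomorphic_on ball 0 (\<rho> ^ d)" "\<forall>i<N. y' i holomorphic_on ball 0 (\<rho> ^ d)"
     and ylim: "\<forall>i<N. \<forall>x\<in>ball 0 (\<rho> ^ d). (\<lambda>k. y k i x) \<longlonglongrightarrow> y' i x"
     and \<omega>: "\<forall>i<N. cmod (\<omega> i) = 1" and y0: "\<forall>k. \<forall>i<N. y k i 0 = \<omega> i"
     and U: "\<forall>k. \<forall>i<N. \<forall>x\<in>ball 0 (\<rho> ^ d). cmod (y k i x) \<le> U"
     and one: "\<forall>k. \<forall>i<N. \<forall>x\<in>ball 0 (\<rho> ^ d). cmod (it (b (s k)) (n (s k)) (\<lambda>i. y k i x) x i) = 1"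
     and p: "\<forall>i<N. y' i (z ^ d) = F a v z i"
    using disc unfolding limit_disc_def by blast
  define u where "u k = (\<lambda>i x. y k i (x ^ d))" for k
  define u' where "u' = (\<lambda>i x. y' i (x ^ d))"
  have R0: "0 \<le> R" using R(1) by simp
  have d0: "0 < d" using d_ge_2 by simp
  have z0: "(0::complex) ^ d = 0" using d0 by (simp add: zero_power)
  have pw: "x ^ d \<in> ball 0 (\<rho> ^ d)" if "x \<in> ball 0 \<rho>" for x :: complex
    using that d0 by (simp add: norm_power power_strict_mono)
  have hol: "u k i holomorphic_on ball 0 \<rho>" "u' i holomorphic_on ball 0 \<rho>" if i: "i < N" for i k
  proof -
    have h: "(\<lambda>x. x ^ d) holomorphic_on ball 0 \<rho>" "(\<lambda>x. x ^ d) ` ball 0 \<rho> \<subseteq> ball (0::complex) (\<rho> ^ d)"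
      using pw by (auto intro!: holomorphic_intros)
    have "y k i \<circ> (\<lambda>x. x ^ d) holomorphic_on ball 0 \<rho>" "y' i \<circ> (\<lambda>x. x ^ d) holomorphic_on ball 0 \<rho>"
      using holomorphic_on_compose_gen[OF h(1) _ h(2)] y i by blast+
    then show "u k i holomorphic_on ball 0 \<rho>" "u' i holomorphic_on ball 0 \<rho>"
      unfolding u_def u'_def o_def by simp_all
  qed
  have ulim: "(\<lambda>k. u k i x) \<longlonglongrightarrow> u' i x" if "i < N" "x \<in> ball 0 \<rho>" for i x
    using ylim pw that unfolding u_def u'_def by blast
  have Ub: "cmod (u k i x) \<le> U" if "i < N" "x \<in> ball 0 \<rho>" for i x k
    using U pw that unfolding u_def by blast
  have jac: "Jac (b (s k)) w x \<noteq> 0" if x: "x \<in> ball 0 \<rho>" and f: "fibre (b (s k)) (u k) x w" for k x w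
  proof
    assume "Jac (b (s k)) w x = 0"
    then obtain i where i: "i < N" "cmod (it (b (s k)) (Suc (n (s k))) w x i) \<noteq> 1" using nc[OF x] by blast
    have "it (b (s k)) (Suc (n (s k))) w x = it (b (s k)) (n (s k)) (\<lambda>i. y k i (x ^ d)) (x ^ d)"
      unfolding itc_Suc by (rule itc_cong) (use f in \<open>simp add: fibre_def u_def\<close>)
    then show False using i one pw[OF x] by simp
  qed
  define C where "C = max 1 (2 * U) + 2 * q * R"
  have C1: "1 \<le> C" unfolding C_def using R0 q_ge_1 by (simp add: add_increasing2)
  have C: "cmod (w i) \<le> C" if x: "x \<in> ball 0 \<rho>" and f: "fibre (b (s k)) (u k) x w" and i: "i < N" for k x w i
  proof -
    have "cmod (w i) \<le> max 1 (2 * U) + 2 * q * R * cmod x"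
      by (rule fibre_bound[OF R(2)[of "s k"] R0 _ i]) (use f Ub[OF _ x] in \<open>simp add: fibre_def\<close>)
    also have "2 * q * R * cmod x \<le> 2 * q * R * 1"
      using x \<rho> R0 q_ge_1 by (intro mult_left_mono) auto
    finally show ?thesis by (simp add: C_def)
  qed
  \<comment> \<open>What has to be known of the branch through v, handed to
    \<open>fibre_point_on_lift\<close> as its side condition.\<close>
  define Q where "Q \<xi>' \<longleftrightarrow> (\<forall>x\<in>ball 0 \<rho>. Jac a (\<lambda>i. \<xi>' i x) x \<noteq> 0) \<and> limit_disc b (\<lambda>k. Suc (n k)) \<rho> (\<lambda>i. \<xi>' i z) z" for \<xi>'
  have lifts: "\<exists>\<xi>'. is_lift a u' (ball 0 \<rho>) \<xi>' \<and> (\<forall>i<N. \<xi>' i 0 = x i) \<and> Q \<xi>'" if x: "\<And>i. i < N \<Longrightarrow> x i ^ d = u' i 0" for x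
  proof -
    have u'0: "u' i 0 = \<omega> i" if "i < N" for i
    proof (rule LIMSEQ_unique[OF ulim[OF that, of 0]])
      show "(\<lambda>k. u k i 0) \<longlonglongrightarrow> \<omega> i" unfolding u_def z0 using y0 that by simp
    qed (use \<rho> in simp)
    have x1: "cmod (x i) = 1" if "i < N" for i
    proof -
      have "cmod (x i) ^ d = 1" using x[OF that] u'0[OF that] \<omega> that by (simp add: norm_power[symmetric])
      then show ?thesis using d0 power_eq_imp_eq_base[of "cmod (x i)" d 1] by simp
    qed
    have "\<exists>\<xi>. is_lift (b (s k)) (u k) (ball 0 \<rho>) \<xi> \<and> (\<forall>i<N. \<xi> i 0 = x i)" for k
    proof (rule lift_exists[where u = "u k", OF R(2) R0 hol(1) \<rho>(1) jac])
      show "fibre (b (s k)) (u k) 0 x"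
        unfolding fibre_def using x u'0 y0 by (simp add: mapc_at_0 u_def z0)
    qed
    then have "\<forall>k. \<exists>\<xi>. is_lift (b (s k)) (u k) (ball 0 \<rho>) \<xi> \<and> (\<forall>i<N. \<xi> i 0 = x i)" by blast
    from choice[OF this] obtain X where X: "\<forall>k. is_lift (b (s k)) (u k) (ball 0 \<rho>) (X k) \<and> (\<forall>i<N. X k i 0 = x i)" ..
    have Xhol: "X k i holomorphic_on ball 0 \<rho>" if "i < N" for k i using X that unfolding is_lift_def by blast
    have Xfib: "fibre (b (s k)) (u k) y (\<lambda>i. X k i y)" if "y \<in> ball 0 \<rho>" for k y using X that unfolding is_lift_def by blast
    have XC: "cmod (X k i y) \<le> C" if "i < N" "y \<in> ball 0 \<rho>" for k i y
      using C[OF that(2) Xfib[OF that(2)] that(1)] .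
    obtain r g where r: "strict_mono (r :: nat \<Rightarrow> nat)" and g: "\<And>i. i < N \<Longrightarrow> g i holomorphic_on ball 0 \<rho>"
      and glim: "\<And>i y. i < N \<Longrightarrow> y \<in> ball 0 \<rho> \<Longrightarrow> (\<lambda>k. X (r k) i y) \<longlonglongrightarrow> g i y"
      by (rule montel_tuple[of "ball 0 \<rho>" N X C]) (use Xhol XC in auto)
    have blim: "(\<lambda>k. b (s (r k)) i I) \<longlonglongrightarrow> a i I" for i I
      using LIMSEQ_subseq_LIMSEQ[OF lim strict_mono_o[OF s r]] by (simp add: o_def)
    have gfib: "fibre a u' y (\<lambda>i. g i y)" if yb: "y \<in> ball 0 \<rho>" for y
      unfolding fibre_def
    proof (intro allI impI)
      fix i assume i: "i < N"
      have 1: "(\<lambda>k. F (b (s (r k))) (\<lambda>i. X (r k) i y) y i) \<longlonglongrightarrow> F a (\<lambda>i. g i y) y i"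
        by (rule tendsto_mapc[OF blim glim[OF _ yb] tendsto_const i])
      have 2: "F (b (s (r k))) (\<lambda>i. X (r k) i y) y i = u (r k) i y" for k
        using Xfib[OF yb, of "r k"] i unfolding fibre_def by blast
      have "(\<lambda>k. u (r k) i y) \<longlonglongrightarrow> u' i y"
        using LIMSEQ_subseq_LIMSEQ[OF ulim[OF i yb] r] by (simp add: o_def)
      with 1 show "F a (\<lambda>i. g i y) y i = u' i y" unfolding 2 by (rule LIMSEQ_unique)
    qed
    have g0: "g i 0 = x i" if "i < N" for i
    proof (rule LIMSEQ_unique[OF glim[OF that, of 0]])
      show "(\<lambda>k. X (r k) i 0) \<longlonglongrightarrow> x i" using X that by simp
    qed (use \<rho> in simp)
    have gjac: "Jac a (\<lambda>i. g i y) y \<noteq> 0" if yb: "y \<in> ball 0 \<rho>" for y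
    proof (rule hurwitz_pointwise[where h = "\<lambda>k y. Jac (b (s (r k))) (\<lambda>i. X (r k) i y) y" and g = "\<lambda>y. Jac a (\<lambda>i. g i y) y" and \<rho> = \<rho>])
      show "(\<lambda>y. Jac (b (s (r k))) (\<lambda>i. X (r k) i y) y) holomorphic_on ball 0 \<rho>" for k
        by (rule holomorphic_jac) (simp_all add: Xhol)
      show "cmod (Jac (b (s (r k))) (\<lambda>i. X (r k) i y) y) \<le> fact N * ((q + 1) * (R ^ d * (real d * C ^ d))) ^ N"
        if "y \<in> ball 0 \<rho>" for k y
      proof (rule jac_bound[OF R(2) R0 XC[OF _ that] C1 _ R(1)])
        have "R * cmod y \<le> R * 1" using that \<rho> R0 by (intro mult_left_mono) auto
        then show "R * cmod y \<le> R" by simp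
      qed
      show "(\<lambda>k. Jac (b (s (r k))) (\<lambda>i. X (r k) i y) y) \<longlonglongrightarrow> Jac a (\<lambda>i. g i y) y" if "y \<in> ball 0 \<rho>" for y
        by (rule tendsto_jac[OF blim glim[OF _ that] tendsto_const])
      show "Jac (b (s (r k))) (\<lambda>i. X (r k) i y) y \<noteq> 0" if "y \<in> ball 0 \<rho>" for k y
        by (rule jac[OF that Xfib[OF that]])
      \<comment> \<open>The nonzero value required by \<open>hurwitz_pointwise\<close> is found at
        the centre of the lift, a torus point over t = 0.\<close>
      show "Jac a (\<lambda>i. g i 0) 0 \<noteq> 0"
      proof (rule near_torus_jac[OF R(3) R0, where \<omega> = x])
        show "cmod (g i 0 - x i) \<le> \<kappa>" if "i < N" for i using g0[OF that] kappa(1) by simp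
      qed (use x1 delta(1) in auto)
    qed (rule yb)
    have it1: "cmod (it (b (s (r k))) (Suc (n (s (r k)))) (\<lambda>i. X (r k) i w) w i) = 1" if "i < N" "w \<in> ball 0 \<rho>" for k i w
    proof -
      have "it (b (s (r k))) (Suc (n (s (r k)))) (\<lambda>i. X (r k) i w) w
          = it (b (s (r k))) (n (s (r k))) (\<lambda>i. y (r k) i (w ^ d)) (w ^ d)"
        unfolding itc_Suc by (rule itc_cong) (use Xfib[OF that(2), of "r k"] in \<open>simp add: fibre_def u_def\<close>)
      then show ?thesis using one that pw[OF that(2)] by simp
    qed
    have "limit_disc b (\<lambda>k. Suc (n k)) \<rho> (\<lambda>i. g i z) z"
      unfolding limit_disc_def
      by (rule exI[of _ "s \<circ> r"], rule exI[of _ "\<lambda>k. X (r k)"], rule exI[of _ g], rule exI[of _ x], rule exI[of _ C])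
        (use strict_mono_o[OF s r] Xhol g glim x1 X XC it1 in auto)
    then show ?thesis
      using gjac g gfib g0 unfolding Q_def is_lift_def by blast
  qed
  have u'1: "cmod (u' i 0) = 1" if "i < N" for i
  proof -
    have "(\<lambda>k. u k i 0) \<longlonglongrightarrow> \<omega> i" unfolding u_def z0 using y0 that by simp
    then have "u' i 0 = \<omega> i" using LIMSEQ_unique[OF ulim[OF that, of 0]] \<rho> by simp
    then show ?thesis using \<omega> that by simp
  qed
  have fv: "fibre a u' z v" unfolding fibre_def u'_def using p by simp
  have "\<exists>\<xi>'. is_lift a u' (ball 0 \<rho>) \<xi>' \<and> (\<forall>i<N. \<xi>' i z = v i) \<and> Q \<xi>'"
    by (rule fibre_point_on_lift[where u = u' and Q = Q, OF hol(2) u'1 lifts z fv])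
  then obtain \<xi>' where \<xi>': "\<forall>i<N. \<xi>' i z = v i" "Q \<xi>'" by blast
  have "Jac a (\<lambda>i. \<xi>' i z) z \<noteq> 0" using \<xi>'(2) z unfolding Q_def by blast
  moreover have "pt N (\<lambda>i. \<xi>' i z) z = pt N v z" by (rule pt_cong) (use \<xi>'(1) in simp)
  moreover have "limit_disc b (\<lambda>k. Suc (n k)) \<rho> v z"
    using \<xi>' unfolding Q_def limit_disc_def by simp
  ultimately show ?thesis by simp
qed

section \<open>Heights of the critical locus\<close>

definition Lam :: "(nat \<Rightarrow> (nat \<Rightarrow> nat) \<Rightarrow> complex) \<Rightarrow> nat \<Rightarrow> real" where
  "Lam a n = lambda_inf N ((polymap N d a ^^ n) ` critcone N d a) / real d ^ n"

lemma itc_zero: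
  assumes "\<And>i. i < N \<Longrightarrow> v i = 0" "i < N"
  shows "it a n v 0 i = 0"
  using assms
proof (induction n arbitrary: v)
  case 0
  then show ?case by (simp add: itc_0)
next
  case (Suc n)
  have "it a n (F a v 0) 0 i = 0"
    by (rule Suc.IH) (use Suc.prems d_ge_2 in \<open>simp_all add: mapc_at_0 zero_power\<close>)
  then show ?case using d_ge_2 by (simp add: itc_Suc zero_power)
qed

text \<open>If |t| < \<delta> / R, a point that is on the torus at time n lies on a slice, hence is
  itself near the torus, where the Jacobian is nonzero. The bound does not depend on n.\<close>

lemma critical_depth:
  assumes a: "coef_bound N d R a" "1 \<le> R" and J: "Jac a v t = 0"
    and one: "\<And>i. i < N \<Longrightarrow> cmod (it a n v t i) = 1"
  shows "\<delta> / R \<le> cmod t"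
proof (rule ccontr)
  assume "\<not> ?thesis"
  then have t: "t \<in> ball 0 (\<delta> / R)" by simp
  have R: "0 \<le> R" "R * (\<delta> / R) \<le> \<delta>" "0 < \<delta> / R" "\<delta> / R \<le> 1"
    using a(2) delta(1,2) by (auto simp: field_simps)
  obtain \<omega> \<eta> where \<eta>: "slice a (\<delta> / R) n \<omega> \<eta>" "\<forall>i<N. \<eta> i t = v i"
    using point_on_slice[OF a(1) R t one] by blast
  have "Jac a v t \<noteq> 0"
  proof (rule near_torus_jac[OF a(1) R(1), where \<omega> = \<omega>])
    have "R * cmod t \<le> R * (\<delta> / R)" using t R(1) by (intro mult_left_mono) auto
    then show "R * cmod t \<le> \<delta>" using R(2) by linarith
    show "cmod (v i - \<omega> i) \<le> \<kappa>" if "i < N" for i using slice_near[OF \<eta>(1) t that] \<eta>(2) that by simp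
    show "cmod (\<omega> i) = 1" if "i < N" for i using \<eta>(1) that unfolding slice_def by blast
  qed
  then show False using J by simp
qed

definition crit_heights :: "(nat \<Rightarrow> (nat \<Rightarrow> nat) \<Rightarrow> complex) \<Rightarrow> nat \<Rightarrow> real set" where
  "crit_heights a n = {0} \<union> {max 0 (ln (inverse (cmod (b N)))) | b.
     b \<in> (polymap N d a ^^ n) ` critcone N d a \<and> (\<forall>i<N. cmod (b i) = 1)}"

lemma crit_heights_eq:
  "crit_heights a n = {0} \<union> {max 0 (ln (inverse (cmod t ^ d ^ n))) | v t.
     Jac a v t = 0 \<and> (\<forall>i<N. cmod (it a n v t i) = 1)}"
proof -
  have "h \<in> crit_heights a n" if "Jac a v t = 0" "\<forall>i<N. cmod (it a n v t i) = 1" "h = max 0 (ln (inverse (cmod t ^ d ^ n)))" for h v t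
  proof -
    \<comment> \<open>\<open>critcone\<close> excludes the origin; it is fixed by the iteration and
      never reaches the torus.\<close>
    have "\<exists>j\<le>N. pt N v t j \<noteq> 0"
    proof (rule ccontr)
      assume "\<not> ?thesis"
      then have z: "pt N v t j = 0" if "j \<le> N" for j using that by blast
      have "v i = 0" if "i < N" for i using z[of i] that by simp
      moreover have "t = 0" using z[of N] by simp
      ultimately have "it a n v t 0 = 0" using itc_zero[of v 0 a n] N_pos by simp
      then show False using that(2) N_pos by force
    qed
    then have "pt N v t \<in> critcone N d a" using that(1) by (simp add: critcone_def)
    then have "pt N (it a n v t) (t ^ d ^ n) \<in> (polymap N d a ^^ n) ` critcone N d a"
      by (metis image_eqI polymap_funpow_pt)
    moreover have "\<forall>i<N. cmod (pt N (it a n v t) (t ^ d ^ n) i) = 1" using that(2) by simp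
    moreover have "h = max 0 (ln (inverse (cmod (pt N (it a n v t) (t ^ d ^ n) N))))"
      using that(3) by (simp add: norm_power)
    ultimately show ?thesis unfolding crit_heights_def by blast
  qed
  moreover have "\<exists>v t. h = max 0 (ln (inverse (cmod t ^ d ^ n))) \<and> Jac a v t = 0 \<and> (\<forall>i<N. cmod (it a n v t i) = 1)"
    if b: "b = (polymap N d a ^^ n) x" "x \<in> critcone N d a" "\<forall>i<N. cmod (b i) = 1" "h = max 0 (ln (inverse (cmod (b N))))" for h b x
  proof -
    have x: "x = pt N x (x N)" using b(2) by (auto simp: critcone_def pt_def fun_eq_iff)
    have bx: "b = pt N (it a n x (x N)) (x N ^ d ^ n)" unfolding b(1) by (subst x) (rule polymap_funpow_pt)
    have "h = max 0 (ln (inverse (cmod (x N) ^ d ^ n)))" unfolding b(4) bx by (simp add: norm_power)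
    moreover have "Jac a x (x N) = 0" using b(2) unfolding critcone_def x[symmetric] by blast
    moreover have "\<forall>i<N. cmod (it a n x (x N) i) = 1" using b(3) unfolding bx by simp
    ultimately show ?thesis by blast
  qed
  ultimately show ?thesis unfolding crit_heights_def by blast
qed

lemma Lam_eq: "Lam a n = Sup (crit_heights a n) / real d ^ n"
  unfolding Lam_def lambda_inf_def crit_heights_def ..

text \<open>The exponent d^n of the last coordinate cancels the normalization of the height.\<close>

lemma crit_height_le:
  assumes "0 < t" "0 \<le> L"
  shows "max 0 (ln (inverse (t ^ d ^ n))) \<le> L * real d ^ n \<longleftrightarrow> exp (- L) \<le> t"
proof -
  have d0: "real d ^ n > 0" using d_ge_2 by simp
  have "ln (inverse (t ^ d ^ n)) = real d ^ n * (- ln t)"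
    using assms(1) by (simp add: ln_inverse ln_realpow)
  then have "max 0 (ln (inverse (t ^ d ^ n))) \<le> L * real d ^ n \<longleftrightarrow> real d ^ n * (- ln t) \<le> real d ^ n * L"
    using assms(2) d0 by (simp add: mult.commute)
  also have "\<dots> \<longleftrightarrow> - ln t \<le> L" using d0 by (rule mult_le_cancel_left_pos)
  also have "\<dots> \<longleftrightarrow> - L \<le> ln t" by linarith
  also have "\<dots> \<longleftrightarrow> exp (- L) \<le> t" using assms(1) by (rule ln_ge_iff)
  finally show ?thesis .
qed

lemma crit_heights_bounded:
  assumes a: "coef_bound N d R a" "1 \<le> R" and x: "x \<in> crit_heights a n"
  shows "x \<le> ln (R / \<delta>) * real d ^ n"
proof -
  have R: "0 < \<delta> / R" "0 \<le> ln (R / \<delta>)"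
    using a(2) delta(1,2) by (auto simp: field_simps)
  have e: "exp (- ln (R / \<delta>)) = \<delta> / R" using a(2) delta(1) by (simp add: exp_minus)
  show ?thesis
  proof (cases "x = 0")
    case True
    then show ?thesis using R by simp
  next
    case False
    then obtain v t where vt: "Jac a v t = 0" "\<forall>i<N. cmod (it a n v t i) = 1" "x = max 0 (ln (inverse (cmod t ^ d ^ n)))"
      using x unfolding crit_heights_eq by blast
    have "\<delta> / R \<le> cmod t" by (rule critical_depth[OF a vt(1)]) (use vt(2) in blast)
    then show ?thesis unfolding vt(3) using R by (subst crit_height_le) (auto simp: e)
  qed
qed

text \<open>The form in which heights are used: n occurs only in the torus condition.
  \<open>critical_depth\<close> enters twice, to bound the supremum and to exclude t = 0, where
  \<open>ln (inverse 0)\<close> would be a meaningless height.\<close>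

lemma Lam_le_iff:
  assumes L: "0 \<le> L"
  shows "Lam a n \<le> L \<longleftrightarrow> (\<forall>v t. Jac a v t = 0 \<longrightarrow> (\<forall>i<N. cmod (it a n v t i) = 1) \<longrightarrow> exp (- L) \<le> cmod t)"
proof -
  obtain R where a: "1 \<le> R" "coef_bound N d R a" by (rule coef_bound_exists)
  have d0: "real d ^ n > 0" using d_ge_2 by simp
  have "Lam a n \<le> L \<longleftrightarrow> Sup (crit_heights a n) \<le> L * real d ^ n"
    unfolding Lam_eq using d0 by (rule pos_divide_le_eq)
  also have "\<dots> \<longleftrightarrow> (\<forall>x\<in>crit_heights a n. x \<le> L * real d ^ n)"
  proof (rule cSup_le_iff)
    show "crit_heights a n \<noteq> {}" by (simp add: crit_heights_def)
    show "bdd_above (crit_heights a n)" using crit_heights_bounded[OF a(2,1)] by (rule bdd_aboveI)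
  qed
  also have "\<dots> \<longleftrightarrow> (\<forall>v t. Jac a v t = 0 \<longrightarrow> (\<forall>i<N. cmod (it a n v t i) = 1) \<longrightarrow>
      max 0 (ln (inverse (cmod t ^ d ^ n))) \<le> L * real d ^ n)"
  proof -
    have "0 \<le> L * real d ^ n" using L d0 by simp
    then show ?thesis unfolding crit_heights_eq by blast
  qed
  also have "\<dots> \<longleftrightarrow> (\<forall>v t. Jac a v t = 0 \<longrightarrow> (\<forall>i<N. cmod (it a n v t i) = 1) \<longrightarrow> exp (- L) \<le> cmod t)"
  proof -
    have "0 < cmod t" if "Jac a v t = 0" "\<forall>i<N. cmod (it a n v t i) = 1" for v t
    proof -
      have "\<delta> / R \<le> cmod t" by (rule critical_depth[OF a(2,1) that(1)]) (use that(2) in blast)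
      moreover have "0 < \<delta> / R" using a delta(1) by simp
      ultimately show ?thesis by linarith
    qed
    then have "max 0 (ln (inverse (cmod t ^ d ^ n))) \<le> L * real d ^ n \<longleftrightarrow> exp (- L) \<le> cmod t"
      if "Jac a v t = 0" "\<forall>i<N. cmod (it a n v t i) = 1" for v t using crit_height_le[OF _ L] that by blast
    then show ?thesis by blast
  qed
  finally show ?thesis .
qed

lemma Lam_nonneg: "0 \<le> Lam a n"
proof -
  obtain R where a: "1 \<le> R" "coef_bound N d R a" by (rule coef_bound_exists)
  have "bdd_above (crit_heights a n)" using crit_heights_bounded[OF a(2,1)] by (rule bdd_aboveI)
  moreover have "0 \<in> crit_heights a n" by (simp add: crit_heights_def)
  ultimately have "0 \<le> Sup (crit_heights a n)" by (rule cSup_upper[rotated])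
  then show ?thesis unfolding Lam_eq by simp
qed

lemma Lam_bounded: "\<exists>B. \<forall>n. Lam a n \<le> B"
proof -
  obtain R where a: "1 \<le> R" "coef_bound N d R a" by (rule coef_bound_exists)
  have R: "0 \<le> ln (R / \<delta>)" "exp (- ln (R / \<delta>)) = \<delta> / R"
    using a(1) delta(1,2) by (auto simp: exp_minus field_simps)
  have "Lam a n \<le> ln (R / \<delta>)" for n
    unfolding Lam_le_iff[OF R(1)] R(2) using critical_depth[OF a(2,1)] by blast
  then show ?thesis by blast
qed

section \<open>Limits of heights\<close>

lemma preimage_bounded:
  assumes a: "coef_bound N d R a" "0 \<le> R"
  shows "\<exists>C. \<forall>v t. cmod t \<le> 1 \<longrightarrow> (\<forall>i<N. cmod (it a n v t i) \<le> U) \<longrightarrow> (\<forall>i<N. cmod (v i) \<le> C)"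
proof (induction n)
  case 0
  show ?case by (intro exI[of _ U]) (simp add: itc_0)
next
  case (Suc n)
  then obtain C where C: "\<And>v t. cmod t \<le> 1 \<Longrightarrow> \<forall>i<N. cmod (it a n v t i) \<le> U \<Longrightarrow> \<forall>i<N. cmod (v i) \<le> C" by blast
  have "cmod (v i) \<le> max 1 (2 * C) + 2 * q * R" if t: "cmod t \<le> 1" and v: "\<forall>i<N. cmod (it a (Suc n) v t i) \<le> U" and i: "i < N" for v t i
  proof -
    have "cmod (t ^ d) \<le> 1" using t by (simp add: norm_power power_le_one)
    from C[OF this, of "F a v t"] v have "\<forall>i<N. cmod (F a v t i) \<le> C" by (simp add: itc_Suc)
    then have "cmod (v i) \<le> max 1 (2 * C) + 2 * q * R * cmod t"
      by (intro fibre_bound[OF a _ i]) blast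
    also have "2 * q * R * cmod t \<le> 2 * q * R * 1" using t a q_ge_1 by (intro mult_left_mono) auto
    finally show ?thesis by simp
  qed
  then show ?case by blast
qed

text \<open>Suppose critical points of a' with |t| < exp(- L') are on the torus at arbitrarily late
  times. A limit of them is a critical point (v', t') with |t'| < exp(- L) whose m-th image shadows
  a torus orbit forever. Slices of the maps a k through the same centre converge to a disc through
  that image, and m pullbacks bring it back to (v', t'), where the Jacobian must then be nonzero. H
  excludes the critical points that would obstruct the pullback to level j; L < L' makes up for the
  strict inequality lost in the limit.\<close>

lemma Lam_limit_transfer:
  assumes lim: "\<And>i I. (\<lambda>k. a k i I) \<longlonglongrightarrow> a' i I" and L: "0 < L" "L < L'"
    and H: "\<And>m n0. \<exists>k\<ge>n0. \<exists>n\<ge>n0. m \<le> n \<and> (\<forall>j\<le>m. Lam (a k) (n - j) \<le> real d ^ j * L)"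
  shows "\<forall>\<^sub>F m in sequentially. Lam a' m \<le> L'"
proof (rule ccontr)
  assume contra: "\<not> ?thesis"
  obtain R where R: "1 \<le> R" "\<And>k. coef_bound N d R (a k)" "coef_bound N d R a'"
    by (rule coef_bound_uniform[of a a', OF lim]) blast
  have R0: "0 \<le> R" using R(1) by simp
  define r r' where "r = exp (- L)" and "r' = exp (- L')"
  have r: "0 < r'" "r' < r" "r < 1" "0 < r" using L by (auto simp: r_def r'_def)
  have d0: "0 < d" using d_ge_2 by simp
  \<comment> \<open>The number m of iterates is chosen so that r^(d^m) \<le> \<delta> / R, a radius
    in which slices exist.\<close>
  obtain m1 where m1: "r ^ m1 < \<delta> / R" using real_arch_pow_inv[of "\<delta> / R" r] r delta(1) R(1) by auto
  define m where "m = Suc m1"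
  have "m1 \<le> d ^ m" using less_exp[of m] d_ge_2 power_mono[of 2 d m] by (simp add: m_def)
  then have "r ^ (d ^ m) \<le> r ^ m1" using r by (intro power_decreasing) auto
  then have "R * r ^ (d ^ m) \<le> R * r ^ m1" using R0 by (rule mult_left_mono)
  moreover have "R * r ^ m1 < \<delta>" using m1 R(1) by (simp add: field_simps)
  ultimately have \<rho>: "R * r ^ (d ^ m) \<le> \<delta>" by linarith
  have "\<exists>M\<ge>l. \<exists>v t. Jac a' v t = 0 \<and> (\<forall>i<N. cmod (it a' M v t i) = 1) \<and> cmod t < r'" for l
  proof -
    obtain M where "M \<ge> l" "\<not> Lam a' M \<le> L'" using contra unfolding eventually_sequentially by blast
    moreover have "0 \<le> L'" using L by simp
    ultimately show ?thesis unfolding Lam_le_iff[OF \<open>0 \<le> L'\<close>] r'_def by (metis not_le)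
  qed
  then have "\<forall>l. \<exists>x. l + m \<le> fst x \<and> Jac a' (fst (snd x)) (snd (snd x)) = 0 \<and>
      (\<forall>i<N. cmod (it a' (fst x) (fst (snd x)) (snd (snd x)) i) = 1) \<and> cmod (snd (snd x)) < r'"
    by (metis fst_conv snd_conv)
  from choice[OF this] obtain x where x: "\<forall>l. l + m \<le> fst (x l) \<and> Jac a' (fst (snd (x l))) (snd (snd (x l))) = 0 \<and>
      (\<forall>i<N. cmod (it a' (fst (x l)) (fst (snd (x l))) (snd (snd (x l))) i) = 1) \<and> cmod (snd (snd (x l))) < r'" ..
  define M v t where "M l = fst (x l)" and "v l = fst (snd (x l))" and "t l = snd (snd (x l))" for l
  have vt: "\<And>l. l + m \<le> M l" "\<And>l. Jac a' (v l) (t l) = 0" "\<And>l i. i < N \<Longrightarrow> cmod (it a' (M l) (v l) (t l) i) = 1" "\<And>l. cmod (t l) < r'"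
    using x unfolding M_def v_def t_def by blast+
  have t1: "cmod (t l) \<le> 1" for l using vt(4)[of l] r by simp
  define y where "y l = it a' m (v l) (t l)" for l
  have tpow: "cmod (t l ^ (d ^ m)) < r' ^ (d ^ m)" for l
    using vt(4)[of l] d0 by (simp add: norm_power power_strict_mono)
  have rpow: "r' ^ (d ^ m) < r ^ (d ^ m)" using r d0 by (intro power_strict_mono) auto
  have rm: "0 < r ^ (d ^ m)" "r ^ (d ^ m) \<le> 1" using r by (auto simp: power_le_one)
  \<comment> \<open>The torus condition at time M l is traded for shadowing up to time l, which
    survives the limit in l.\<close>
  have "\<exists>\<omega>. (\<forall>i<N. cmod (\<omega> i) = 1) \<and> (\<forall>j\<le>l. \<forall>i<N. cmod (it a' j (y l) (t l ^ (d ^ m)) i - \<omega> i ^ (d ^ j)) \<le> \<kappa>)" for l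
  proof -
    have tb: "t l ^ (d ^ m) \<in> ball 0 (r ^ (d ^ m))" using tpow[of l] rpow by simp
    have "cmod (it a' (M l - m) (y l) (t l ^ (d ^ m)) i) = 1" if "i < N" for i
      unfolding y_def itc_add[symmetric] using vt(1)[of l] vt(3)[OF that, of l] by simp
    from point_on_slice[OF R(3) R0 \<rho> rm tb this] obtain \<omega> \<eta> where
      \<eta>: "slice a' (r ^ (d ^ m)) (M l - m) \<omega> \<eta>" "\<forall>i<N. \<eta> i (t l ^ (d ^ m)) = y l i" by blast
    have "it a' j (\<lambda>i. \<eta> i (t l ^ (d ^ m))) (t l ^ (d ^ m)) = it a' j (y l) (t l ^ (d ^ m))" for j
      by (rule itc_cong) (use \<eta>(2) in simp)
    moreover have "\<forall>j\<le>M l - m. \<forall>i<N. cmod (it a' j (\<lambda>i. \<eta> i (t l ^ (d ^ m))) (t l ^ (d ^ m)) i - \<omega> i ^ (d ^ j)) \<le> \<kappa>"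
      using \<eta>(1) tb unfolding slice_def by blast
    moreover have "l \<le> M l - m" using vt(1)[of l] by simp
    moreover have "\<forall>i<N. cmod (\<omega> i) = 1" using \<eta>(1) unfolding slice_def by blast
    ultimately show ?thesis by (intro exI[of _ \<omega>]) simp
  qed
  then have "\<forall>l. \<exists>\<omega>. (\<forall>i<N. cmod (\<omega> i) = 1) \<and> (\<forall>j\<le>l. \<forall>i<N. cmod (it a' j (y l) (t l ^ (d ^ m)) i - \<omega> i ^ (d ^ j)) \<le> \<kappa>)" by blast
  from choice[OF this] obtain \<omega> where
    \<omega>: "\<forall>l. (\<forall>i<N. cmod (\<omega> l i) = 1) \<and> (\<forall>j\<le>l. \<forall>i<N. cmod (it a' j (y l) (t l ^ (d ^ m)) i - \<omega> l i ^ (d ^ j)) \<le> \<kappa>)" ..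
  obtain C where C: "\<And>v t. cmod t \<le> 1 \<Longrightarrow> \<forall>i<N. cmod (it a' m v t i) \<le> 2 \<Longrightarrow> \<forall>i<N. cmod (v i) \<le> C"
    using preimage_bounded[OF R(3) R0, of m 2] by blast
  have vC: "cmod (v l i) \<le> C" if "i < N" for l i
  proof -
    have "cmod (y l i) \<le> 2" if i: "i < N" for i
    proof -
      have "cmod (it a' 0 (y l) (t l ^ (d ^ m)) i - \<omega> l i ^ (d ^ 0)) \<le> \<kappa>" using \<omega> i by blast
      then have "cmod (y l i - \<omega> l i) \<le> \<kappa>" using i by (simp add: itc_0)
      moreover have "cmod (\<omega> l i) = 1" using \<omega> i by blast
      ultimately show ?thesis using norm_triangle_ineq[of "y l i - \<omega> l i" "\<omega> l i"] kappa(2) by simp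
    qed
    then show ?thesis using C[OF t1[of l], of "v l"] that unfolding y_def by blast
  qed
  \<comment> \<open>Point, centre and parameter form one tuple of length 2 N + 1, so that all
    converge along one subsequence.\<close>
  define w where "w l j = (if j < N then v l j else if j < 2 * N then \<omega> l (j - N) else t l)" for l j
  have wb: "cmod (w l j) \<le> max C 1" for l j
  proof -
    consider "j < N" | "N \<le> j" "j < 2 * N" | "2 * N \<le> j" by linarith
    then show ?thesis
    proof cases
      case 1
      then show ?thesis using vC[OF 1, of l] by (simp add: w_def)
    next
      case 2
      then have "cmod (\<omega> l (j - N)) = 1" using \<omega> by simp
      then show ?thesis using 2 by (simp add: w_def)
    next
      case 3
      then show ?thesis using t1[of l] by (simp add: w_def)
    qed
  qed
  obtain s w' where s: "strict_mono (s :: nat \<Rightarrow> nat)" "\<And>j. j < Suc (2 * N) \<Longrightarrow> (\<lambda>k. w (s k) j) \<longlonglongrightarrow> w' j"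
    by (rule bounded_sequence_extract[of "Suc (2 * N)" w "max C 1"]) (use wb in auto)
  define v' \<omega>' t' where "v' = w'" and "\<omega>' i = w' (i + N)" and "t' = w' (2 * N)" for i
  have vl: "(\<lambda>k. v (s k) i) \<longlonglongrightarrow> v' i" if "i < N" for i
    using s(2)[of i] that by (simp add: w_def v'_def)
  have \<omega>l: "(\<lambda>k. \<omega> (s k) i) \<longlonglongrightarrow> \<omega>' i" if "i < N" for i
    using s(2)[of "i + N"] that by (simp add: w_def \<omega>'_def)
  have tl: "(\<lambda>k. t (s k)) \<longlonglongrightarrow> t'"
    using s(2)[of "2 * N"] by (simp add: w_def t'_def)
  have "cmod (t (s k)) \<le> r'" for k using vt(4)[of "s k"] by simp
  then have "cmod t' \<le> r'" by (intro Lim_norm_ubound[OF _ tl]) auto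
  then have t'1: "cmod t' < r" using r by simp
  have jac0: "Jac a' v' t' = 0"
  proof (rule LIMSEQ_unique)
    show "(\<lambda>k. Jac a' (v (s k)) (t (s k))) \<longlonglongrightarrow> Jac a' v' t'"
      by (rule tendsto_jac[OF tendsto_const vl tl])
    show "(\<lambda>k. Jac a' (v (s k)) (t (s k))) \<longlonglongrightarrow> 0" unfolding vt(2) by (rule tendsto_const)
  qed
  have \<omega>'1: "cmod (\<omega>' i) = 1" if "i < N" for i
  proof (rule LIMSEQ_unique)
    show "(\<lambda>k. cmod (\<omega> (s k) i)) \<longlonglongrightarrow> cmod (\<omega>' i)" by (rule tendsto_norm[OF \<omega>l[OF that]])
    show "(\<lambda>k. cmod (\<omega> (s k) i)) \<longlonglongrightarrow> 1" using \<omega> that by simp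
  qed
  define y' where "y' = it a' m v' t'"
  \<comment> \<open>For fixed j the estimate holds as soon as s k >= j, so the limit point shadows
    \<omega>' at all times.\<close>
  have orbit: "cmod (it a' j y' (t' ^ (d ^ m)) i - \<omega>' i ^ (d ^ j)) \<le> \<kappa>" if i: "i < N" for j i
  proof (rule Lim_norm_ubound[OF sequentially_bot])
    have yl: "(\<lambda>k. y (s k) i) \<longlonglongrightarrow> y' i" if "i < N" for i
      unfolding y_def y'_def by (rule tendsto_itc[OF tendsto_const vl tl that])
    show "(\<lambda>k. it a' j (y (s k)) (t (s k) ^ (d ^ m)) i - \<omega> (s k) i ^ (d ^ j)) \<longlonglongrightarrow> it a' j y' (t' ^ (d ^ m)) i - \<omega>' i ^ (d ^ j)"
      by (intro tendsto_diff tendsto_power tendsto_itc[OF tendsto_const yl] tl \<omega>l i)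
    show "\<forall>\<^sub>F k in sequentially. cmod (it a' j (y (s k)) (t (s k) ^ (d ^ m)) i - \<omega> (s k) i ^ (d ^ j)) \<le> \<kappa>"
      using eventually_ge_at_top[of j]
    proof eventually_elim
      case (elim k)
      have "j \<le> s k" using elim seq_suble[OF s(1), of k] by linarith
      then show ?case using \<omega> i by blast
    qed
  qed
  \<comment> \<open>Map and level are selected together and both tend to infinity: b l tends to a',
    and n l - m exceeds every fixed time.\<close>
  have "\<forall>l. \<exists>kn. l \<le> fst kn \<and> l + m \<le> snd kn \<and> (\<forall>j\<le>m. Lam (a (fst kn)) (snd kn - j) \<le> real d ^ j * L)"
  proof
    fix l
    obtain k n where "l + m \<le> k" "l + m \<le> n" "\<forall>j\<le>m. Lam (a k) (n - j) \<le> real d ^ j * L" using H[of "l + m" m] by blast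
    then show "\<exists>kn. l \<le> fst kn \<and> l + m \<le> snd kn \<and> (\<forall>j\<le>m. Lam (a (fst kn)) (snd kn - j) \<le> real d ^ j * L)"
      by (intro exI[of _ "(k, n)"]) simp
  qed
  from choice[OF this] obtain kn where
    kn: "\<forall>l. l \<le> fst (kn l) \<and> l + m \<le> snd (kn l) \<and> (\<forall>j\<le>m. Lam (a (fst (kn l))) (snd (kn l) - j) \<le> real d ^ j * L)" ..
  define b n where "b l = a (fst (kn l))" and "n l = snd (kn l)" for l
  have nb: "\<And>l. l + m \<le> n l" "\<And>l j. j \<le> m \<Longrightarrow> Lam (b l) (n l - j) \<le> real d ^ j * L"
    using kn unfolding b_def n_def by blast+
  have bR: "coef_bound N d R (b l)" for l unfolding b_def by (rule R(2))
  have "filterlim (\<lambda>l. fst (kn l)) at_top sequentially"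
    by (rule filterlim_at_top_mono[OF filterlim_ident]) (use kn in simp)
  then have blim: "(\<lambda>l. b l i I) \<longlonglongrightarrow> a' i I" for i I
    unfolding b_def using filterlim_compose[OF lim] by blast
  have rd: "(r ^ (d ^ j)) ^ d = r ^ (d ^ Suc j)" for j by (simp add: power_mult[symmetric] mult.commute)
  have td: "(t' ^ (d ^ j)) ^ d = t' ^ (d ^ Suc j)" for j by (simp add: power_mult[symmetric] mult.commute)
  have tball: "t' ^ (d ^ j) \<in> ball 0 (r ^ (d ^ j))" for j
    using t'1 d0 by (simp add: norm_power power_strict_mono)
  have top: "limit_disc b (\<lambda>l. n l - m) (r ^ (d ^ m)) (it a' m v' t') (t' ^ (d ^ m))"
  proof -
    have "\<forall>l. \<exists>\<eta>. slice (b l) (r ^ (d ^ m)) (n l - m) \<omega>' \<eta>"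
      by (intro allI slice_exists[where \<omega> = \<omega>', OF bR R0 \<rho> rm \<omega>'1])
    from choice[OF this] obtain \<eta> where \<eta>: "\<forall>l. slice (b l) (r ^ (d ^ m)) (n l - m) \<omega>' (\<eta> l)" ..
    have \<eta>hol: "\<eta> l i holomorphic_on ball 0 (r ^ (d ^ m))" if "i < N" for l i using \<eta> that unfolding slice_def by blast
    have \<eta>near: "cmod (it (b l) j (\<lambda>i. \<eta> l i z) z i - \<omega>' i ^ (d ^ j)) \<le> \<kappa>" if "z \<in> ball 0 (r ^ (d ^ m))" "j \<le> n l - m" "i < N" for l z j i
      using \<eta> that unfolding slice_def by blast
    have \<eta>2: "cmod (\<eta> l i z) \<le> 2" if "i < N" "z \<in> ball 0 (r ^ (d ^ m))" for l i z
      using slice_near[OF \<eta>[rule_format, of l] that(2,1)] \<omega>'1[OF that(1)] kappa(2)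
        norm_triangle_ineq[of "\<eta> l i z - \<omega>' i" "\<omega>' i"] by simp
    obtain p g where p: "strict_mono (p :: nat \<Rightarrow> nat)" and g: "\<And>i. i < N \<Longrightarrow> g i holomorphic_on ball 0 (r ^ (d ^ m))"
      and glim: "\<And>i z. i < N \<Longrightarrow> z \<in> ball 0 (r ^ (d ^ m)) \<Longrightarrow> (\<lambda>l. \<eta> (p l) i z) \<longlonglongrightarrow> g i z"
      by (rule montel_tuple[of "ball 0 (r ^ (d ^ m))" N \<eta> 2]) (use \<eta>hol \<eta>2 in auto)
    have gnear: "cmod (it a' j (\<lambda>i. g i z) z i - \<omega>' i ^ (d ^ j)) \<le> \<kappa>" if z: "z \<in> ball 0 (r ^ (d ^ m))" and i: "i < N" for z j i
    proof (rule Lim_norm_ubound[OF sequentially_bot])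
      have bl: "(\<lambda>l. b (p l) i I) \<longlonglongrightarrow> a' i I" for i I
        using LIMSEQ_subseq_LIMSEQ[OF blim p] by (simp add: o_def)
      show "(\<lambda>l. it (b (p l)) j (\<lambda>i. \<eta> (p l) i z) z i - \<omega>' i ^ (d ^ j)) \<longlonglongrightarrow> it a' j (\<lambda>i. g i z) z i - \<omega>' i ^ (d ^ j)"
        by (intro tendsto_diff tendsto_const tendsto_itc[OF bl glim[OF _ z] tendsto_const i])
      show "\<forall>\<^sub>F l in sequentially. cmod (it (b (p l)) j (\<lambda>i. \<eta> (p l) i z) z i - \<omega>' i ^ (d ^ j)) \<le> \<kappa>"
        using eventually_ge_at_top[of j]
      proof eventually_elim
        case (elim l)
        have "j \<le> n (p l) - m" using elim seq_suble[OF p, of l] nb(1)[of "p l"] by linarith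
        then show ?case using \<eta>near[OF z _ i] by blast
      qed
    qed
    have tm: "R * cmod (t' ^ (d ^ m)) \<le> \<delta>" "cmod (t' ^ (d ^ m)) \<le> 1"
    proof -
      have "cmod (t' ^ (d ^ m)) \<le> r ^ (d ^ m)" using tball[of m] by simp
      then have "R * cmod (t' ^ (d ^ m)) \<le> R * r ^ (d ^ m)" using R0 by (rule mult_left_mono)
      then show "R * cmod (t' ^ (d ^ m)) \<le> \<delta>" using \<rho> by linarith
      show "cmod (t' ^ (d ^ m)) \<le> 1" using \<open>cmod (t' ^ (d ^ m)) \<le> r ^ (d ^ m)\<close> rm by linarith
    qed
    \<comment> \<open>Both points shadow \<omega>' over the same parameter, so by uniqueness the
      limit disc passes through the m-th image of (v', t').\<close>
    have gy: "g i (t' ^ (d ^ m)) = y' i" if "i < N" for i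
      by (rule near_orbit_unique[where \<omega> = \<omega>' and v = "\<lambda>i. g i (t' ^ (d ^ m))" and w = y', OF R(3) R0 tm \<omega>'1 gnear[OF tball] orbit that])
    have one: "cmod (it (b (p l)) (n (p l) - m) (\<lambda>i. \<eta> (p l) i z) z i) = 1" if "i < N" "z \<in> ball 0 (r ^ (d ^ m))" for l i z
    proof -
      have "it (b (p l)) (n (p l) - m) (\<lambda>i. \<eta> (p l) i z) z i = \<omega>' i ^ (d ^ (n (p l) - m))"
        using \<eta> that unfolding slice_def by blast
      then show ?thesis using \<omega>'1[OF that(1)] by (simp add: norm_power)
    qed
    have \<eta>0: "\<eta> (p l) i 0 = \<omega>' i" if "i < N" for l i using \<eta> that unfolding slice_def by blast
    show ?thesis
      unfolding limit_disc_def
      by (rule exI[of _ p], rule exI[of _ "\<lambda>l. \<eta> (p l)"], rule exI[of _ g], rule exI[of _ \<omega>'], rule exI[of _ 2])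
        (use p \<eta>hol g glim \<omega>'1 \<eta>0 \<eta>2 one gy in \<open>simp add: y'_def\<close>)
  qed
  have stepdown: "Jac a' (it a' j v' t') (t' ^ (d ^ j)) \<noteq> 0 \<and> limit_disc b (\<lambda>l. n l - j) (r ^ (d ^ j)) (it a' j v' t') (t' ^ (d ^ j))"
    if j: "j < m" and D: "limit_disc b (\<lambda>l. n l - Suc j) (r ^ (d ^ Suc j)) (it a' (Suc j) v' t') (t' ^ (d ^ Suc j))" for j
  proof -
    have nj: "Suc (n l - Suc j) = n l - j" for l using nb(1)[of l] j by simp
    have "Jac a' (it a' j v' t') (t' ^ (d ^ j)) \<noteq> 0 \<and> limit_disc b (\<lambda>l. Suc (n l - Suc j)) (r ^ (d ^ j)) (it a' j v' t') (t' ^ (d ^ j))"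
    proof (rule limit_disc_pullback[OF R(1) bR R(3) blim])
      show "0 < r ^ (d ^ j)" "r ^ (d ^ j) \<le> 1" using r by (auto simp: power_le_one)
      have "\<forall>i<N. F a' (it a' j v' t') (t' ^ (d ^ j)) i = it a' (Suc j) v' t' i" by (simp add: itc_Suc')
      then show "limit_disc b (\<lambda>l. n l - Suc j) ((r ^ (d ^ j)) ^ d) (F a' (it a' j v' t') (t' ^ (d ^ j))) ((t' ^ (d ^ j)) ^ d)"
        using D unfolding rd td limit_disc_def by simp
      show "t' ^ (d ^ j) \<in> ball 0 (r ^ (d ^ j))" by (rule tball)
      \<comment> \<open>The bound d^j L at level n k - j says that critical points on the torus at
        that time have |x| >= r^(d^j), outside the disc.\<close>
      show "\<exists>i<N. cmod (it (b k) (Suc (n k - Suc j)) w x i) \<noteq> 1" if x: "x \<in> ball 0 (r ^ (d ^ j))" and J0: "Jac (b k) w x = 0" for k x w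
      proof (rule ccontr)
        assume "\<not> ?thesis"
        then have one: "\<forall>i<N. cmod (it (b k) (n k - j) w x i) = 1" unfolding nj by blast
        have L0: "0 \<le> real d ^ j * L" using L by simp
        have "exp (- (real d ^ j * L)) \<le> cmod x"
          using nb(2)[of j k] j one J0 unfolding Lam_le_iff[OF L0] by simp
        moreover have "exp (- (real d ^ j * L)) = r ^ (d ^ j)"
          unfolding r_def exp_of_nat_mult[symmetric] by simp
        ultimately show False using x by simp
      qed
    qed
    then show ?thesis unfolding nj .
  qed
  have all: "limit_disc b (\<lambda>l. n l - j) (r ^ (d ^ j)) (it a' j v' t') (t' ^ (d ^ j))" if "j \<le> m" for j
    using that
  proof (induction rule: inc_induct)
    case base
    show ?case by (rule top)
  next
    case (step k)
    then show ?case using stepdown[of k] by simp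
  qed
  \<comment> \<open>The Jacobian at level 0 is obtained from the last pullback, which starts at
    level 1; so m must be positive.\<close>
  have "0 < m" by (simp add: m_def)
  have "limit_disc b (\<lambda>l. n l - Suc 0) (r ^ (d ^ Suc 0)) (it a' (Suc 0) v' t') (t' ^ (d ^ Suc 0))"
    by (rule all) (simp add: m_def)
  from stepdown[OF \<open>0 < m\<close> this] have "Jac a' (it a' 0 v' t') (t' ^ (d ^ 0)) \<noteq> 0" by blast
  moreover have "pt N (it a' 0 v' t') t' = pt N v' t'" by (rule pt_cong) (simp add: itc_0)
  ultimately show False using jac0 by simp
qed

text \<open>Let u be the upper limit and suppose values at most v < u occur infinitely often. With L
  = max v (3/4 u) one has L < u < 2 L. At such a late time n the height is at most L, and at the m
  levels before it at most 2 L \<le> d^j L. The transfer lemma for a constant sequence then bounds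
  all late heights by (L + u) / 2 < u.\<close>

lemma Lam_convergent: "convergent (Lam a)"
proof -
  obtain B where B: "\<And>n. Lam a n \<le> B" using Lam_bounded by blast
  define V where "V = {v. \<forall>\<^sub>F n in sequentially. Lam a n \<le> v}"
  have V: "B \<in> V" using B by (simp add: V_def)
  have V0: "0 \<le> v" if v: "v \<in> V" for v
  proof -
    obtain n where "Lam a n \<le> v" using v unfolding V_def eventually_sequentially by blast
    then show ?thesis using Lam_nonneg[of a n] by linarith
  qed
  then have bdd: "bdd_below V" by (rule bdd_belowI)
  define u where "u = Inf V"
  have above: "\<forall>\<^sub>F n in sequentially. Lam a n \<le> v" if "u < v" for v
  proof -
    obtain x where "x \<in> V" "x < v" using cInf_lessD[of V v] V \<open>u < v\<close> unfolding u_def by blast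
    then show ?thesis unfolding V_def by (auto elim: eventually_mono)
  qed
  have notbelow: "\<not> (\<forall>\<^sub>F n in sequentially. Lam a n \<le> v)" if "v < u" for v
    using cInf_lower[OF _ bdd, of v] that unfolding u_def V_def by auto
  have below: "\<forall>\<^sub>F n in sequentially. v < Lam a n" if "v < u" for v
  proof (rule ccontr)
    assume "\<not> ?thesis"
    then have freq: "\<exists>n\<ge>n0. Lam a n \<le> v" for n0 unfolding eventually_sequentially by (meson not_le)
    have v0: "0 \<le> v"
    proof (rule ccontr)
      assume "\<not> 0 \<le> v"
      then have "\<not> Lam a n \<le> v" for n using Lam_nonneg[of a n] by linarith
      then show False using freq[of 0] by simp
    qed
    then have upos: "0 < u" using that by simp
    define L where "L = max v (3 / 4 * u)"
    have L: "0 < L" "L < u" "v \<le> L" "u < 2 * L" using that upos v0 by (auto simp: L_def)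
    have "\<forall>\<^sub>F n in sequentially. Lam a n \<le> 2 * L" by (rule above[OF L(4)])
    then obtain n1 where n1: "\<And>n. n \<ge> n1 \<Longrightarrow> Lam a n \<le> 2 * L" unfolding eventually_sequentially by blast
    have "\<forall>\<^sub>F n in sequentially. Lam a n \<le> (L + u) / 2"
    proof (rule Lam_limit_transfer[where a = "\<lambda>_. a" and L = L])
      show "\<exists>k\<ge>n0. \<exists>n\<ge>n0. m \<le> n \<and> (\<forall>j\<le>m. Lam a (n - j) \<le> real d ^ j * L)" for m n0
      proof -
        obtain n where n: "n \<ge> n0 + m + n1" "Lam a n \<le> v" using freq by blast
        have "Lam a (n - j) \<le> real d ^ j * L" if "j \<le> m" for j
        proof (cases j)
          case 0
          then show ?thesis using n L by simp
        next
          case (Suc i)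
          have "2 ^ 1 \<le> (2::real) ^ j" using Suc by (intro power_increasing) auto
          also have "\<dots> \<le> real d ^ j" using d_ge_2 by (intro power_mono) auto
          finally have "2 * L \<le> real d ^ j * L" using L by (intro mult_right_mono) auto
          moreover have "Lam a (n - j) \<le> 2 * L" by (rule n1) (use n that in simp)
          ultimately show ?thesis by linarith
        qed
        then show ?thesis using n by (intro exI[of _ n0] exI[of _ n] conjI) auto
      qed
    qed (use L in auto)
    then show False using notbelow[of "(L + u) / 2"] L by simp
  qed
  have "Lam a \<longlonglongrightarrow> u"
  proof (rule order_tendstoI)
    show "\<forall>\<^sub>F n in sequentially. v < Lam a n" if "v < u" for v by (rule below[OF that])
    show "\<forall>\<^sub>F n in sequentially. Lam a n < v" if "u < v" for v
      using above[of "(u + v) / 2"] that by (auto elim!: eventually_mono)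
  qed
  then show ?thesis by (rule convergentI)
qed

lemma Lam_tendsto: "Lam a \<longlonglongrightarrow> G_inf_crit N d a"
  using Lam_convergent[of a] unfolding convergent_LIMSEQ_iff G_inf_crit_def Lam_def[abs_def] .

lemma G_inf_crit_closed:
  assumes lim: "\<And>i I. (\<lambda>k. a k i I) \<longlonglongrightarrow> a' i I" and B: "\<And>k. G_inf_crit N d (a k) \<le> B"
  shows "G_inf_crit N d a' \<le> B"
proof (rule ccontr)
  assume contra: "\<not> ?thesis"
  define g where "g = G_inf_crit N d a'"
  have g: "B < g" using contra by (simp add: g_def)
  have "0 \<le> G_inf_crit N d (a 0)" by (rule LIMSEQ_le_const[OF Lam_tendsto]) (use Lam_nonneg in blast)
  then have B0: "0 \<le> B" using B[of 0] by linarith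
  \<comment> \<open>The points at one and two thirds between B and g: L exceeds the limits for all a
    k, and L' lies strictly between L and the limit for a'.\<close>
  define L L' where "L = (2 * B + g) / 3" and "L' = (B + 2 * g) / 3"
  have L: "0 < L" "L < L'" "B < L" "L' < g" using g B0 by (auto simp: L_def L'_def)
  have "\<forall>\<^sub>F m in sequentially. Lam a' m \<le> L'"
  proof (rule Lam_limit_transfer[OF lim L(1,2)])
    fix m n0
    have "\<forall>\<^sub>F n in sequentially. Lam (a n0) n < L"
      by (rule order_tendstoD(2)[OF Lam_tendsto]) (use B[of n0] L in linarith)
    then obtain n1 where n1: "\<And>n. n \<ge> n1 \<Longrightarrow> Lam (a n0) n < L" unfolding eventually_sequentially by blast
    define n where "n = n0 + n1 + m"
    have "Lam (a n0) (n - j) \<le> real d ^ j * L" if "j \<le> m" for j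
    proof -
      have "1 * L \<le> real d ^ j * L" using L d_ge_2 by (intro mult_right_mono one_le_power) auto
      moreover have "Lam (a n0) (n - j) < L" by (rule n1) (use that in \<open>simp add: n_def\<close>)
      ultimately show ?thesis by linarith
    qed
    then show "\<exists>k\<ge>n0. \<exists>n\<ge>n0. m \<le> n \<and> (\<forall>j\<le>m. Lam (a k) (n - j) \<le> real d ^ j * L)"
      by (intro exI[of _ n0] exI[of _ n] conjI) (auto simp: n_def)
  qed
  then have "g \<le> L'"
    unfolding g_def by (intro tendsto_upperbound[OF Lam_tendsto]) auto
  then show False using L by simp
qed

end

section \<open>Maps constant along affine lines\<close>

lemma one_islimpt_circle: "(1::complex) islimpt sphere 0 1"
proof (rule connected_imp_perfect)
  show "connected (sphere (0::complex) 1)" by (rule connected_sphere) simp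
  show "(1::complex) \<in> sphere 0 1" by simp
  show "sphere 0 1 \<noteq> {x}" for x :: complex
  proof
    assume "sphere 0 1 = {x}"
    moreover have "(1::complex) \<in> sphere 0 1" "(-1::complex) \<in> sphere 0 1" by simp_all
    ultimately have "(1::complex) = x" "(-1::complex) = x" by blast+
    then show False by simp
  qed
qed

lemma zero_on_circle_imp_zero:
  assumes "f holomorphic_on S" "open S" "connected S" "sphere 0 1 \<subseteq> S"
    and "\<And>z. cmod z = 1 \<Longrightarrow> f z = 0" "w \<in> S"
  shows "f w = 0"
  by (rule analytic_continuation[OF assms(1,2,3,4) _ one_islimpt_circle _ assms(6)]) (use assms in auto)

text \<open>The singularity at 0 is removable, and Liouville's theorem applies to the
  extension.\<close>

lemma bounded_punctured_plane_constant:
  assumes f: "f holomorphic_on (- {0})" and B: "\<And>w. w \<noteq> 0 \<Longrightarrow> cmod (f w) \<le> B"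
  shows "w \<noteq> 0 \<Longrightarrow> f w = f 1"
proof -
  assume w: "w \<noteq> 0"
  have "f holomorphic_on UNIV - {0}" using f by (simp add: Compl_eq_Diff_UNIV)
  moreover have "0 \<in> interior (UNIV :: complex set)" by simp
  moreover have "\<forall>\<^sub>F z in at 0. cmod (f z) \<le> B"
    unfolding eventually_at_topological using B by (intro exI[of _ UNIV]) simp
  ultimately obtain g where g: "g holomorphic_on UNIV" "\<forall>z\<in>UNIV - {0}. g z = f z"
    using holomorphic_on_extend_bounded[of f UNIV 0] by blast
  have "continuous_on UNIV g" using g(1) by (rule holomorphic_on_imp_continuous_on)
  then have "continuous_on (cball 0 1) g" by (rule continuous_on_subset) simp
  then have "compact (g ` cball 0 1)" by (rule compact_continuous_image) simp
  then have "bounded (g ` cball 0 1)" by (rule compact_imp_bounded)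
  then obtain C where C: "\<And>z. z \<in> cball 0 1 \<Longrightarrow> cmod (g z) \<le> C" unfolding bounded_iff by blast
  have "cmod (g z) \<le> max B C" for z
  proof (cases "z = 0")
    case True
    then show ?thesis using C[of 0] by simp
  next
    case False
    then show ?thesis using B[OF False] g(2) by simp
  qed
  then have "bounded (range g)" unfolding bounded_iff by blast
  from Liouville_theorem[OF g(1) this] obtain c where "\<And>z. g z = c" unfolding constant_on_def by blast
  then have "f w = c" "f 1 = c" using g(2) w by (metis DiffI UNIV_I singletonD, metis DiffI UNIV_I singletonD zero_neq_one)
  then show "f w = f 1" by simp
qed

lemma fun_upd_holomorphic:
  "(\<lambda>w. (x(j := w)) i) holomorphic_on S" for x :: "nat \<Rightarrow> complex"
  by (cases "i = j") (auto intro!: holomorphic_intros)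

context regular_family
begin

text \<open>Solution m_i of the first-order part in z of F(\<omega> + m z, z) = \<omega>^d; only
  terms with I_N = 1 contribute to it.\<close>

definition slope :: "(nat \<Rightarrow> (nat \<Rightarrow> nat) \<Rightarrow> complex) \<Rightarrow> (nat \<Rightarrow> complex) \<Rightarrow> nat \<Rightarrow> complex" where
  "slope b x i = - (\<Sum>I\<in>IndStar N d. b i I * (if I N = 1 then \<Prod>j<N. x j ^ I j else 0)) / (of_nat d * x i ^ (d - 1))"

lemma line_slope:
  assumes line: "\<And>z. F b (\<lambda>i. \<omega> i + m i * z) z i = \<omega> i ^ d" and \<omega>: "\<omega> i \<noteq> 0" and i: "i < N"
  shows "m i = slope b \<omega> i"
proof -
  have tm: "((\<lambda>z. b i I * z ^ I N * (\<Prod>j<N. (\<omega> j + m j * z) ^ I j)) has_field_derivative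
      b i I * (if I N = 1 then \<Prod>j<N. \<omega> j ^ I j else 0)) (at 0)" if I: "I \<in> IndStar N d" for I
  proof -
    have lin: "((\<lambda>z. \<omega> j + m j * z) has_field_derivative m j) (at 0)" for j
      by (auto intro!: derivative_eq_intros)
    define D where "D = (\<Sum>j<N. dmonc N I (\<lambda>j. \<omega> j + m j * 0) j * m j)"
    have "((\<lambda>z. \<Prod>j<N. (\<omega> j + m j * z) ^ I j) has_field_derivative D) (at 0)"
      unfolding D_def by (rule dmonc_has_derivative) (rule lin)
    moreover have "((\<lambda>z. b i I * z ^ I N) has_field_derivative b i I * (of_nat (I N) * (1 * 0 ^ (I N - Suc 0)))) (at 0)"
      by (intro DERIV_cmult DERIV_power DERIV_ident)
    ultimately have *: "((\<lambda>z. b i I * z ^ I N * (\<Prod>j<N. (\<omega> j + m j * z) ^ I j)) has_field_derivative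
        b i I * (of_nat (I N) * (1 * 0 ^ (I N - Suc 0))) * (\<Prod>j<N. (\<omega> j + m j * 0) ^ I j) + D * (b i I * 0 ^ I N)) (at 0)"
      by (rule DERIV_mult[rotated])
    have pos: "0 < I N" using I by (simp add: IndStar_def)
    have "b i I * (of_nat (I N) * (1 * 0 ^ (I N - Suc 0))) * (\<Prod>j<N. (\<omega> j + m j * 0) ^ I j) + D * (b i I * 0 ^ I N)
        = b i I * (if I N = 1 then \<Prod>j<N. \<omega> j ^ I j else 0)"
    proof (cases "I N = 1")
      case False
      then have "0 < I N - Suc 0" using pos by simp
      then have z: "(0::complex) ^ (I N - Suc 0) = 0" "(0::complex) ^ I N = 0" using pos by (simp_all add: zero_power)
      show ?thesis unfolding z using False by simp
    qed simp
    with * show ?thesis by simp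
  qed
  have "((\<lambda>z. F b (\<lambda>i. \<omega> i + m i * z) z i) has_field_derivative
      of_nat d * (m i * (\<omega> i + m i * 0) ^ (d - Suc 0)) + (\<Sum>I\<in>IndStar N d. b i I * (if I N = 1 then \<Prod>j<N. \<omega> j ^ I j else 0))) (at 0)"
    unfolding mapc_def
    by (intro DERIV_add DERIV_power DERIV_sum tm) (auto intro!: derivative_eq_intros)
  moreover have "((\<lambda>z. F b (\<lambda>i. \<omega> i + m i * z) z i) has_field_derivative 0) (at 0)"
    unfolding line by simp
  ultimately have "of_nat d * (m i * (\<omega> i + m i * 0) ^ (d - Suc 0)) + (\<Sum>I\<in>IndStar N d. b i I * (if I N = 1 then \<Prod>j<N. \<omega> j ^ I j else 0)) = 0"
    by (rule DERIV_unique)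
  moreover have "of_nat d * \<omega> i ^ (d - 1) \<noteq> 0" using \<omega> d_ge_2 by simp
  ultimately show ?thesis
    unfolding slope_def by (simp add: field_simps eq_neg_iff_add_eq_0)
qed

lemma mapc_scale:
  assumes "i < N"
  shows "F b (\<lambda>j. c * v j) (c * t) i = c ^ d * F b v t i"
proof -
  have "b i I * (c * t) ^ I N * (\<Prod>j<N. (c * v j) ^ I j) = c ^ d * (b i I * t ^ I N * (\<Prod>j<N. v j ^ I j))"
    if I: "I \<in> IndStar N d" for I
  proof -
    have "(\<Prod>j<N. (c * v j) ^ I j) = c ^ (\<Sum>j<N. I j) * (\<Prod>j<N. v j ^ I j)"
      by (simp add: power_mult_distrib prod.distrib power_sum)
    moreover have "c ^ d = c ^ I N * c ^ (\<Sum>j<N. I j)"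
      unfolding IndStar_sum[OF I, symmetric] by (simp add: power_add mult.commute)
    ultimately show ?thesis by (simp add: power_mult_distrib mult_ac)
  qed
  then have eq: "(\<Sum>I\<in>IndStar N d. b i I * (c * t) ^ I N * (\<Prod>j<N. (c * v j) ^ I j))
      = (\<Sum>I\<in>IndStar N d. c ^ d * (b i I * t ^ I N * (\<Prod>j<N. v j ^ I j)))"
    by (intro sum.cong refl)
  show ?thesis unfolding mapc_def distrib_left sum_distrib_left eq power_mult_distrib[of c "v i" d] ..
qed

text \<open>By homogeneity the line can be followed to its point at infinity: (c \<omega> + m, 1) is
  mapped to c^d \<omega>^d, and c -> 0. Hence all slopes lie in the zero set of F(., 1), which is
  bounded by \<open>fibre_bound\<close>.\<close>

lemma line_base_point:
  assumes line: "\<And>z. F b (\<lambda>i. \<omega> i + m i * z) z i = \<omega> i ^ d" and i: "i < N"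
  shows "F b m 1 i = 0"
proof -
  have eq: "F b (\<lambda>j. c * \<omega> j + m j) 1 i = c ^ d * \<omega> i ^ d" if c: "c \<noteq> 0" for c
  proof -
    have "F b (\<lambda>j. c * \<omega> j + m j) 1 i = F b (\<lambda>j. c * (\<omega> j + m j * (1 / c))) (c * (1 / c)) i"
      using c by (simp add: distrib_left)
    also have "\<dots> = c ^ d * \<omega> i ^ d" unfolding mapc_scale[OF i] line ..
    finally show ?thesis .
  qed
  have 0: "(\<lambda>n. inverse (of_nat (Suc n)) :: complex) \<longlonglongrightarrow> 0"
    by (rule LIMSEQ_Suc[OF lim_inverse_n])
  have "(\<lambda>n. F b (\<lambda>j. inverse (of_nat (Suc n)) * \<omega> j + m j) 1 i) \<longlonglongrightarrow> F b (\<lambda>j. 0 * \<omega> j + m j) 1 i"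
    by (intro tendsto_mapc tendsto_intros 0 i)
  moreover have "(\<lambda>n. inverse (of_nat (Suc n)) ^ d * \<omega> i ^ d) \<longlonglongrightarrow> 0 ^ d * \<omega> i ^ d"
    by (intro tendsto_intros 0)
  moreover have "F b (\<lambda>j. inverse (of_nat (Suc n)) * \<omega> j + m j) 1 i = inverse (of_nat (Suc n)) ^ d * \<omega> i ^ d" for n
    by (rule eq) (simp del: of_nat_Suc)
  ultimately have "F b (\<lambda>j. 0 * \<omega> j + m j) 1 i = 0 ^ d * \<omega> i ^ d" by (simp only: LIMSEQ_unique)
  then show ?thesis using d_ge_2 by (simp add: zero_power)
qed

text \<open>With t as an additional variable every exponent is below d, since also I_N < d; so
  Fourier inversion in N + 1 variables recovers each coefficient.\<close>

lemma monomials_independent: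
  fixes c :: "(nat \<Rightarrow> nat) \<Rightarrow> complex"
  assumes zero: "\<And>v t. (\<Sum>I\<in>IndStar N d. c I * t ^ I N * (\<Prod>j<N. v j ^ I j)) = 0" and I: "I \<in> IndStar N d"
  shows "c I = 0"
proof -
  interpret big: regular_family "Suc N" d by unfold_locales (use N_pos d_ge_2 in auto)
  let ?D = "{..<Suc N} \<rightarrow>\<^sub>E {..<d}"
  \<comment> \<open>Elements of an extensional product are \<open>undefined\<close> outside its
    domain, so multi-indices are restricted before they index the Fourier sum.\<close>
  define res where "res I = restrict I {..<Suc N}" for I :: "nat \<Rightarrow> nat"
  have inD: "res I \<in> ?D" if I: "I \<in> IndStar N d" for I
  proof -
    have "I j < d" if "j < Suc N" for j
    proof (cases "j = N")
      case True
      then show ?thesis using I by (simp add: IndStar_def)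
    next
      case False
      then have "I j \<le> (\<Sum>j<N. I j)" using that by (intro member_le_sum) auto
      then show ?thesis using IndStar_sum[OF I] I by (auto simp: IndStar_def)
    qed
    then show ?thesis by (auto simp: res_def)
  qed
  have inj: "inj_on res (IndStar N d)"
  proof (rule inj_onI)
    fix I I' assume I: "I \<in> IndStar N d" "I' \<in> IndStar N d" and eq: "res I = res I'"
    show "I = I'"
    proof
      fix j
      show "I j = I' j"
      proof (cases "j < Suc N")
        case True
        then show ?thesis using fun_cong[OF eq, of j] by (simp add: res_def)
      next
        case False
        then show ?thesis using I by (simp add: IndStar_def)
      qed
    qed
  qed
  define c' where "c' K = (if K \<in> res ` IndStar N d then c (the_inv_into (IndStar N d) res K) else 0)" for K
  have c': "c' (res I) = c I" if "I \<in> IndStar N d" for I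
    using that by (simp add: c'_def the_inv_into_f_f[OF inj])
  have vanish: "(\<Sum>K\<in>?D. c' K * (\<Prod>i<Suc N. x i ^ K i)) = 0" for x :: "nat \<Rightarrow> complex"
  proof -
    have "(\<Sum>K\<in>?D. c' K * (\<Prod>i<Suc N. x i ^ K i)) = (\<Sum>K\<in>res ` IndStar N d. c' K * (\<Prod>i<Suc N. x i ^ K i))"
      using inD by (intro sum.mono_neutral_right) (auto simp: c'_def intro!: finite_PiE)
    also have "\<dots> = (\<Sum>I\<in>IndStar N d. c' (res I) * (\<Prod>i<Suc N. x i ^ res I i))"
      by (simp add: sum.reindex[OF inj])
    also have "\<dots> = (\<Sum>I\<in>IndStar N d. c I * x N ^ I N * (\<Prod>j<N. x j ^ I j))"
    proof (rule sum.cong[OF refl])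
      fix I assume I: "I \<in> IndStar N d"
      have "(\<Prod>i<Suc N. x i ^ res I i) = x N ^ I N * (\<Prod>j<N. x j ^ I j)"
        by (simp add: res_def mult.commute)
      then show "c' (res I) * (\<Prod>i<Suc N. x i ^ res I i) = c I * x N ^ I N * (\<Prod>j<N. x j ^ I j)"
        unfolding c'[OF I] by (simp add: mult.assoc)
    qed
    finally show ?thesis using zero by simp
  qed
  have "of_nat (d ^ Suc N) * (c' (res I) * (\<Prod>i<Suc N. 1 ^ res I i)) = 0"
    unfolding big.fourier_coefficient[OF inD[OF I], symmetric, of c' "\<lambda>_. 1"] vanish by simp
  then show ?thesis using c'[OF I] d_ge_2 by simp
qed

text \<open>The slope of the line through a torus point \<open>\<omega>\<close> is a Laurent polynomial in \<open>\<omega>\<close> with values in the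
  bounded zero set of the map, hence constant by Liouville's theorem.\<close>

lemma lines_imp_trivial:
  assumes b: "coef_bound N d 1 b"
    and lines: "\<And>\<omega>. (\<And>i. i < N \<Longrightarrow> cmod (\<omega> i) = 1) \<Longrightarrow>
      \<exists>m. \<forall>z\<in>ball 0 1. \<forall>i<N. F b (\<lambda>i. \<omega> i + m i * z) z i = \<omega> i ^ d"
    and i: "i < N" and I: "I \<in> IndStar N d"
  shows "b i I = 0"
proof -
  define T where "T = {\<omega>::nat \<Rightarrow> complex. \<forall>i<N. cmod (\<omega> i) = 1}"
  have nz: "\<omega> i \<noteq> 0" if "\<omega> \<in> T" "i < N" for \<omega> i using that by (auto simp: T_def)
  have line: "F b (\<lambda>i. \<omega> i + slope b \<omega> i * z) z i = \<omega> i ^ d" if \<omega>: "\<omega> \<in> T" and i: "i < N" for \<omega> z i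
  proof -
    obtain m where m: "\<forall>z\<in>ball 0 1. \<forall>i<N. F b (\<lambda>i. \<omega> i + m i * z) z i = \<omega> i ^ d"
      using lines[of \<omega>] \<omega> unfolding T_def by blast
    \<comment> \<open>The identity on the unit disc extends to all z, as is needed to follow the
      line to infinity.\<close>
    have all: "F b (\<lambda>i. \<omega> i + m i * z) z i = \<omega> i ^ d" if i: "i < N" for z i
    proof (rule analytic_continuation_open[of "ball 0 1" UNIV "\<lambda>z. F b (\<lambda>i. \<omega> i + m i * z) z i" "\<lambda>_. \<omega> i ^ d"])
      show "(\<lambda>z. F b (\<lambda>i. \<omega> i + m i * z) z i) holomorphic_on UNIV"
        by (rule holomorphic_mapc[OF _ _ i]) (auto intro!: holomorphic_intros)
      show "F b (\<lambda>i. \<omega> i + m i * z) z i = \<omega> i ^ d" if "z \<in> ball 0 1" for z using m that i by blast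
    qed auto
    have "m i = slope b \<omega> i" if "i < N" for i
      by (rule line_slope[OF all[OF that] nz[OF \<omega> that] that])
    then have "F b (\<lambda>i. \<omega> i + slope b \<omega> i * z) z i = F b (\<lambda>i. \<omega> i + m i * z) z i"
      by (intro mapc_cong[OF _ i]) simp
    then show ?thesis using all[OF i] by simp
  qed
  have base: "F b (slope b \<omega>) 1 i = 0" if "\<omega> \<in> T" "i < N" for \<omega> i
    by (rule line_base_point[OF line[OF that] that(2)])
  \<comment> \<open>One coordinate w of \<omega> varies. The slope extends holomorphically to w
    \<noteq> 0 and stays a zero of F(., 1) by the identity theorem; so it is bounded, hence
    constant.\<close>
  have slope_upd: "slope b ((\<omega>)(j := w)) i = slope b \<omega> i"
    if \<omega>: "\<omega> \<in> T" and j: "j < N" and i: "i < N" and w: "cmod w = 1" for \<omega> j i w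
  proof -
    define g where "g w = slope b ((\<omega>)(j := w))" for w
    have ghol: "(\<lambda>w. g w i) holomorphic_on (- {0})" if "i < N" for i
    proof -
      have "((\<omega>)(j := w)) i \<noteq> 0" if "w \<in> - {0}" for w
        using nz[OF \<omega> \<open>i < N\<close>] that by (cases "i = j") auto
      then have den: "of_nat d * ((\<omega>)(j := w)) i ^ (d - 1) \<noteq> 0" if "w \<in> - {0}" for w
        using that d_ge_2 by simp
      have num: "(\<lambda>w. if I N = 1 then \<Prod>k<N. ((\<omega>)(j := w)) k ^ I k else 0) holomorphic_on (- {0})" for I :: "nat \<Rightarrow> nat"
      proof -
        have "(\<lambda>w. \<Prod>k<N. ((\<omega>)(j := w)) k ^ I k) holomorphic_on (- {0})"
          by (intro holomorphic_intros fun_upd_holomorphic)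
        then show ?thesis
          by (cases "I N = 1") (simp_all only: if_True if_False refl simp_thms holomorphic_on_const)
      qed
      show ?thesis
        unfolding g_def slope_def
        by (intro holomorphic_intros num fun_upd_holomorphic den)
    qed
    have zero: "F b (g w) 1 i = 0" if "w \<noteq> 0" "i < N" for w i
    proof (rule zero_on_circle_imp_zero[of "\<lambda>w. F b (g w) 1 i" "- {0}"])
      show "(\<lambda>w. F b (g w) 1 i) holomorphic_on (- {0})"
        by (rule holomorphic_mapc[OF ghol _ that(2)]) (auto intro!: holomorphic_intros)
      show "connected (- {0::complex})" by (rule connected_punctured_universe) simp
      show "F b (g z) 1 i = 0" if "cmod z = 1" for z
      proof -
        have "(\<omega>)(j := z) \<in> T" using \<omega> that by (simp add: T_def)
        then show ?thesis unfolding g_def by (rule base[OF _ \<open>i < N\<close>])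
      qed
    qed (use that in auto)
    have "cmod (g w i) \<le> max 1 (2 * 0) + 2 * q * 1 * cmod 1" if "w \<noteq> 0" for w
      by (rule fibre_bound[OF b _ _ i]) (use zero[OF that] in auto)
    then have "g w' i = g 1 i" if "w' \<noteq> 0" for w'
      using bounded_punctured_plane_constant[OF ghol[OF i]] that by blast
    moreover have "w \<noteq> 0" "\<omega> j \<noteq> 0" using w nz[OF \<omega> j] by auto
    ultimately have "g w i = g (\<omega> j) i" by metis
    then show ?thesis unfolding g_def by simp
  qed
  define c where "c = slope b (\<lambda>_. 1)"
  have slope_const: "slope b \<omega> i = c i" if \<omega>: "\<omega> \<in> T" and i: "i < N" for \<omega> i
  proof -
    \<comment> \<open>The coordinates of \<omega> are replaced by 1 one after the other.\<close>
    define x where "x n = (\<lambda>j. if j < n then 1 else \<omega> j)" for n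
    have xT: "x n \<in> T" for n using \<omega> by (auto simp: T_def x_def)
    have "slope b (x n) i = slope b \<omega> i" if "n \<le> N" for n
      using that
    proof (induction n)
      case 0
      then show ?case by (simp add: x_def)
    next
      case (Suc n)
      have "x (Suc n) = (x n)(n := 1)" by (auto simp: x_def fun_eq_iff less_Suc_eq)
      then have "slope b (x (Suc n)) i = slope b ((x n)(n := 1)) i" by (simp only:)
      also have "\<dots> = slope b (x n) i" by (rule slope_upd[OF xT]) (use Suc.prems i in auto)
      also have "\<dots> = slope b \<omega> i" by (rule Suc.IH) (use Suc.prems in simp)
      finally show ?case .
    qed
    then have "slope b (x N) i = slope b \<omega> i" by simp
    moreover have "slope b (x N) i = c i"
      unfolding c_def slope_def x_def using i by (intro arg_cong2[of _ _ _ _ "(/)"] arg_cong[of _ _ uminus] sum.cong refl) auto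
    ultimately show ?thesis by simp
  qed
  \<comment> \<open>With a constant slope the line identity is polynomial in the base point and
    extends from the torus to all x, one coordinate at a time.\<close>
  have shift: "F b (\<lambda>i. x i + c i * z) z i = x i ^ d" if i: "i < N" for x z i
  proof -
    have "\<forall>x. (\<forall>j<N. n \<le> j \<longrightarrow> cmod (x j) = 1) \<longrightarrow> F b (\<lambda>i. x i + c i * z) z i = x i ^ d" if "n \<le> N" for n
      using that
    proof (induction n)
      case 0
      show ?case
      proof (intro allI impI)
        fix x :: "nat \<Rightarrow> complex" assume "\<forall>j<N. 0 \<le> j \<longrightarrow> cmod (x j) = 1"
        then have x: "x \<in> T" by (simp add: T_def)
        have "F b (\<lambda>i. x i + c i * z) z i = F b (\<lambda>i. x i + slope b x i * z) z i"
          by (rule mapc_cong[OF _ i]) (simp add: slope_const[OF x])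
        then show "F b (\<lambda>i. x i + c i * z) z i = x i ^ d" using line[OF x i] by simp
      qed
    next
      case (Suc n)
      show ?case
      proof (intro allI impI)
        fix x :: "nat \<Rightarrow> complex" assume x: "\<forall>j<N. Suc n \<le> j \<longrightarrow> cmod (x j) = 1"
        define f where "f w = F b (\<lambda>i. (x(n := w)) i + c i * z) z i - (x(n := w)) i ^ d" for w
        have "f (x n) = 0"
        proof (rule zero_on_circle_imp_zero[of f UNIV])
          show "f holomorphic_on UNIV"
            unfolding f_def by (intro holomorphic_intros holomorphic_mapc fun_upd_holomorphic i)
          show "f w = 0" if "cmod w = 1" for w
          proof -
            have "\<forall>j<N. n \<le> j \<longrightarrow> cmod ((x(n := w)) j) = 1" using x that by auto
            then show ?thesis unfolding f_def using Suc by simp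
          qed
        qed auto
        then show "F b (\<lambda>i. x i + c i * z) z i = x i ^ d" by (simp add: f_def)
      qed
    qed
    from this[of N] show ?thesis by simp
  qed
  have zero0: "F b (\<lambda>_. 0) 1 i = 0" if "i < N" for i
  proof -
    have pz: "(\<Prod>j<N. (0::complex) ^ I j) = 0" if I: "I \<in> IndStar N d" for I
    proof -
      have "I N < d" using I by (simp add: IndStar_def)
      then have "(\<Sum>j<N. I j) \<noteq> 0" using IndStar_sum[OF I] by linarith
      then obtain j where "j < N" "I j \<noteq> 0" by (meson lessThan_iff sum.neutral)
      then show ?thesis by (intro prod_zero) (auto simp: zero_power)
    qed
    have "(\<Sum>I\<in>IndStar N d. b i I * 1 ^ I N * (\<Prod>j<N. 0 ^ I j)) = 0"
    proof (rule sum.neutral, rule ballI)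
      fix I assume I: "I \<in> IndStar N d"
      show "b i I * 1 ^ I N * (\<Prod>j<N. 0 ^ I j) = 0" unfolding pz[OF I] by simp
    qed
    then show ?thesis using d_ge_2 unfolding mapc_def by (simp only: zero_power add_0)
  qed
  \<comment> \<open>The base point x = - c is carried to the origin at z = 1, and F(0, 1) = 0
    because every lower term contains some v_j.\<close>
  have c0: "c i = 0" if "i < N" for i
  proof -
    have "(- c i) ^ d = F b (\<lambda>i. - c i + c i * 1) 1 i" using shift[OF that, of "\<lambda>i. - c i" 1] by simp
    also have "\<dots> = 0" using zero0[OF that] by simp
    finally show ?thesis by simp
  qed
  show ?thesis
  proof (rule monomials_independent[OF _ I])
    fix v :: "nat \<Rightarrow> complex" and t :: complex
    have "F b v t i = F b (\<lambda>i. v i + c i * t) t i" by (rule mapc_cong[OF _ i]) (simp add: c0)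
    also have "\<dots> = v i ^ d" by (rule shift[OF i])
    finally show "(\<Sum>I\<in>IndStar N d. b i I * t ^ I N * (\<Prod>j<N. v j ^ I j)) = 0" by (simp add: mapc_def)
  qed
qed

end

section \<open>Boundedness and compactness\<close>

text \<open>Schwarz's lemma after rescaling; dividing by 2 K makes the rescaled function strictly
  smaller than 1, as that lemma requires.\<close>

lemma schwarz_ball:
  assumes hol: "f holomorphic_on ball 0 s" and f0: "f 0 = 0" and K: "\<And>z. z \<in> ball 0 s \<Longrightarrow> cmod (f z) \<le> K"
    and pos: "0 < K" "0 < s"
  shows "\<And>z. z \<in> ball 0 s \<Longrightarrow> cmod (f z) \<le> 2 * K * cmod z / s" and "cmod (deriv f 0) \<le> 2 * K / s"
proof -
  define g where "g w = f (of_real s * w) / of_real (2 * K)" for w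
  have sw: "of_real s * w \<in> ball 0 s" if "cmod w < 1" for w :: complex
    using that pos by (simp add: norm_mult)
  have "f \<circ> (\<lambda>w. of_real s * w) holomorphic_on ball 0 1"
    by (rule holomorphic_on_compose_gen[OF _ hol]) (use sw in \<open>auto intro!: holomorphic_intros\<close>)
  then have "(\<lambda>w. f (of_real s * w)) holomorphic_on ball 0 1" by (simp add: o_def)
  then have ghol: "g holomorphic_on ball 0 1"
    unfolding g_def using pos by (intro holomorphic_on_divide holomorphic_on_const) auto
  have g0: "g 0 = 0" by (simp add: g_def f0)
  have g1: "cmod (g w) < 1" if "cmod w < 1" for w
  proof -
    have "cmod (g w) = cmod (f (of_real s * w)) / (2 * K)" using pos by (simp add: g_def norm_divide)
    also have "\<dots> \<le> K / (2 * K)" using K[OF sw[OF that]] pos by (intro divide_right_mono) auto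
    also have "\<dots> < 1" using pos by simp
    finally show ?thesis .
  qed
  show "cmod (f z) \<le> 2 * K * cmod z / s" if z: "z \<in> ball 0 s" for z
  proof -
    have "cmod (z / of_real s) < 1" using z pos by (simp add: norm_divide)
    from Schwarz_Lemma(1)[OF ghol g0 g1 this] have "cmod (g (z / of_real s)) \<le> cmod (z / of_real s)" .
    moreover have "cmod (g (z / of_real s)) = cmod (f z) / (2 * K)" using pos by (simp add: g_def norm_divide)
    ultimately show ?thesis using pos by (simp add: norm_divide field_simps)
  qed
  have "(f has_field_derivative deriv f 0) (at (of_real s * 0))"
    using holomorphic_derivI[OF hol open_ball, of 0] pos by simp
  then have "((\<lambda>w. f (of_real s * w)) has_field_derivative deriv f 0 * of_real s) (at 0)"
    by (rule DERIV_chain2) (auto intro!: derivative_eq_intros)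
  then have "(g has_field_derivative deriv f 0 * of_real s / of_real (2 * K)) (at 0)"
    unfolding g_def by (rule DERIV_cdivide)
  then have "deriv g 0 = deriv f 0 * of_real s / of_real (2 * K)" by (rule DERIV_imp_deriv)
  moreover have "cmod (deriv g 0) \<le> 1" using Schwarz_Lemma(2)[OF ghol g0 g1, of 0] by simp
  ultimately have "cmod (deriv f 0) * s / (2 * K) \<le> 1" using pos by (simp add: norm_mult norm_divide)
  then show "cmod (deriv f 0) \<le> 2 * K / s" using pos by (simp add: field_simps)
qed

text \<open>The remainder is z times the increment of the difference quotient, to which Schwarz's
  lemma applies once more. If K grows only like s, the remainder is O(1/s) on bounded sets, which
  turns linear growth into exact linearity in the limit.\<close>

lemma linear_approximation:
  assumes hol: "h holomorphic_on ball 0 s" and K: "\<And>z. z \<in> ball 0 s \<Longrightarrow> cmod (h z - h 0) \<le> K"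
    and pos: "0 < K" "0 < s"
  shows "cmod (deriv h 0) \<le> 2 * K / s"
    and "\<And>z. z \<in> ball 0 s \<Longrightarrow> cmod (h z - (h 0 + deriv h 0 * z)) \<le> 8 * K / s\<^sup>2 * (cmod z)\<^sup>2"
proof -
  define f where "f z = h z - h 0" for z
  have fhol: "f holomorphic_on ball 0 s" unfolding f_def by (intro holomorphic_intros hol)
  have "((\<lambda>z. h z - h 0) has_field_derivative deriv h 0 - 0) (at 0)"
    using holomorphic_derivI[OF hol open_ball, of 0] pos by (intro DERIV_diff DERIV_const) auto
  then have df: "deriv f 0 = deriv h 0" unfolding f_def by (intro DERIV_imp_deriv) simp
  note S = schwarz_ball[OF fhol _ _ pos]
  have f0: "f 0 = 0" by (simp add: f_def)
  have fK: "cmod (f z) \<le> K" if "z \<in> ball 0 s" for z using K[OF that] by (simp add: f_def)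
  show d: "cmod (deriv h 0) \<le> 2 * K / s" using S(2)[OF f0 fK] by (simp add: df)
  have fle: "cmod (f z) \<le> 2 * K * cmod z / s" if "z \<in> ball 0 s" for z using S(1)[OF f0 fK that] .
  define h1 where "h1 z = (if z = 0 then deriv h 0 else (h z - h 0) / (z - 0))" for z
  have h1hol: "h1 holomorphic_on ball 0 s" unfolding h1_def by (rule pole_lemma_open[OF hol open_ball])
  have h1: "cmod (h1 z) \<le> 2 * K / s" if z: "z \<in> ball 0 s" for z
  proof (cases "z = 0")
    case True
    then show ?thesis using d by (simp add: h1_def)
  next
    case False
    have "cmod (h1 z) = cmod (f z) / cmod z" using False by (simp add: h1_def f_def norm_divide)
    also have "\<dots> \<le> (2 * K * cmod z / s) / cmod z" by (intro divide_right_mono fle z) simp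
    also have "\<dots> = 2 * K / s" using False by simp
    finally show ?thesis .
  qed
  define f1 where "f1 z = h1 z - h1 0" for z
  have f1hol: "f1 holomorphic_on ball 0 s" unfolding f1_def by (intro holomorphic_intros h1hol)
  have f1K: "cmod (f1 z) \<le> 4 * K / s" if "z \<in> ball 0 s" for z
    using norm_triangle_ineq4[of "h1 z" "h1 0"] h1[OF that] h1[of 0] pos by (simp add: f1_def)
  have f10: "f1 0 = 0" by (simp add: f1_def)
  have K4: "0 < 4 * K / s" using pos by simp
  show "cmod (h z - (h 0 + deriv h 0 * z)) \<le> 8 * K / s\<^sup>2 * (cmod z)\<^sup>2" if z: "z \<in> ball 0 s" for z
  proof -
    have "h z - (h 0 + deriv h 0 * z) = f1 z * z"
      by (cases "z = 0") (simp_all add: f1_def h1_def field_simps)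
    moreover have "cmod (f1 z) \<le> 2 * (4 * K / s) * cmod z / s"
      by (rule schwarz_ball(1)[OF f1hol f10 f1K K4 pos(2) z])
    then have "cmod (f1 z) * cmod z \<le> 2 * (4 * K / s) * cmod z / s * cmod z" by (rule mult_right_mono) simp
    ultimately show ?thesis by (simp add: norm_mult power2_eq_square)
  qed
qed

context regular_family
begin

text \<open>A slice of radius \<rho> = \<delta> / R is lifted once more, to |t| < r = c / R, that is
  |z| < c for z = R t. The lift exists because r \<le> exp(- L). Its image uses only parameters
  below r^d \<le> r^2 \<le> \<rho> / (c \<delta>), the last inequality being c^3 \<le> R. There the
  slice is almost constant: by Schwarz's lemma the target differs from \<omega>^d by a quantity that
  tends to 0 as c grows.\<close>

lemma approximate_lines:
  assumes a: "coef_bound N d R a" and c: "1 \<le> c" "c ^ 3 \<le> R" "1 / \<delta> \<le> c" "exp L \<le> c" and L: "0 \<le> L"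
    and Lam: "Lam a (Suc n) \<le> L" and \<omega>: "\<And>i. i < N \<Longrightarrow> cmod (\<omega> i) = 1"
    and b: "\<And>i I. b i I = a i I / of_real R ^ I N"
  shows "\<exists>\<zeta>. (\<forall>i<N. \<zeta> i holomorphic_on ball 0 c) \<and> (\<forall>i<N. \<zeta> i 0 = \<omega> i) \<and>
    (\<forall>i<N. \<forall>z\<in>ball 0 c. cmod (\<zeta> i z) \<le> 4 + 2 * q * cmod z) \<and>
    (\<forall>i<N. \<forall>z\<in>ball 0 c. cmod (F b (\<lambda>i. \<zeta> i z) z i - \<omega> i ^ d) \<le> 2 * \<kappa> / (c * \<delta>))"
proof -
  have c0: "0 < c" using c(1) by simp
  have "1 \<le> c ^ 3" using c(1) by (rule one_le_power)
  then have R1: "1 \<le> R" and R0: "0 \<le> R" and Rp: "0 < R" using c(2) by auto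
  define r \<rho> where "r = c / R" and "\<rho> = \<delta> / R"
  have r: "0 < r" using c0 Rp by (simp add: r_def)
  have c3: "c * (c * c) \<le> R" using c(2) by (simp add: power3_eq_cube)
  have rc: "r * (c * c) \<le> 1"
  proof -
    have "r * (c * c) = c * (c * c) / R" by (simp add: r_def)
    also have "\<dots> \<le> 1" using c3 Rp by simp
    finally show ?thesis .
  qed
  have "r * c * 1 \<le> r * c * c" using r c0 c(1) by (intro mult_left_mono) auto
  then have rc1: "r * c \<le> 1" using rc by (simp add: mult.assoc)
  have "r * 1 \<le> r * c" using r c(1) by (intro mult_left_mono) auto
  then have r1: "r \<le> 1" using rc1 by simp
  have "r \<le> 1 / c" using rc1 c0 by (simp add: field_simps)
  also have "\<dots> \<le> 1 / exp L" using c(4) c0 by (intro divide_left_mono) auto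
  finally have rL: "r \<le> exp (- L)" by (simp add: exp_minus field_simps)
  have \<rho>: "0 < \<rho>" "R * \<rho> \<le> \<delta>" "\<rho> \<le> 1" using delta(1,2) Rp R1 by (auto simp: \<rho>_def field_simps)
  have dc: "1 \<le> \<delta> * c" using c(3) delta(1) by (simp add: field_simps)
  have rd: "r ^ d \<le> r * r"
    using power_decreasing[of 2 d r] r r1 d_ge_2 by (simp add: power2_eq_square)
  have rr: "r * r \<le> \<rho> / (c * \<delta>)"
  proof -
    have "r * r * (c * \<delta>) = (r * (c * c)) * (\<delta> / R)" by (simp add: r_def field_simps)
    also have "\<dots> \<le> 1 * (\<delta> / R)" using rc delta(1) Rp by (intro mult_right_mono) auto
    finally have "r * r * (c * \<delta>) \<le> \<rho>" by (simp add: \<rho>_def)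
    then show ?thesis using c0 delta(1) by (subst pos_le_divide_eq) auto
  qed
  have "\<rho> / (c * \<delta>) \<le> \<rho> / 1" using dc \<rho>(1) by (intro divide_left_mono) (auto simp: mult.commute)
  then have rd\<rho>: "r ^ d \<le> \<rho>" using rd rr by linarith
  obtain \<eta> where \<eta>: "slice a \<rho> n (\<lambda>i. \<omega> i ^ d) \<eta>"
    using slice_exists[OF a R0 \<rho>(2,1,3), of "\<lambda>i. \<omega> i ^ d" n] \<omega> by (auto simp: norm_power)
  have \<eta>hol: "\<eta> i holomorphic_on ball 0 \<rho>" if "i < N" for i using \<eta> that unfolding slice_def by blast
  have \<eta>0: "\<eta> i 0 = \<omega> i ^ d" if "i < N" for i using \<eta> that unfolding slice_def by blast
  have \<eta>near: "cmod (\<eta> i x - \<omega> i ^ d) \<le> \<kappa>" if "i < N" "x \<in> ball 0 \<rho>" for i x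
    by (rule slice_near[OF \<eta> that(2,1)])
  have \<eta>one: "cmod (it a n (\<lambda>i. \<eta> i x) x i) = 1" if "i < N" "x \<in> ball 0 \<rho>" for i x
  proof -
    have "it a n (\<lambda>i. \<eta> i x) x i = (\<omega> i ^ d) ^ (d ^ n)" using \<eta> that unfolding slice_def by blast
    then show ?thesis using \<omega>[OF that(1)] by (simp add: norm_power)
  qed
  have d0: "0 < d" using d_ge_2 by simp
  have pwr: "cmod (x ^ d) < r ^ d" if "x \<in> ball 0 r" for x :: complex
    using that d0 by (simp add: norm_power power_strict_mono)
  then have pw: "x ^ d \<in> ball 0 \<rho>" if "x \<in> ball 0 r" for x :: complex
    using rd\<rho> that by fastforce
  define u where "u i x = \<eta> i (x ^ d)" for i x
  have uhol: "u i holomorphic_on ball 0 r" if i: "i < N" for i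
  proof -
    have "\<eta> i \<circ> (\<lambda>x. x ^ d) holomorphic_on ball 0 r"
      by (rule holomorphic_on_compose_gen[OF _ \<eta>hol[OF i]]) (use pw in \<open>auto intro!: holomorphic_intros\<close>)
    then show ?thesis unfolding u_def o_def .
  qed
  \<comment> \<open>Fibre points over the slice are on the torus at time n + 1, so the bound on
    \<open>Lam a (Suc n)\<close> keeps critical points away from them.\<close>
  have ujac: "Jac a v x \<noteq> 0" if x: "x \<in> ball 0 r" and f: "fibre a u x v" for x v
  proof
    assume J0: "Jac a v x = 0"
    have "it a (Suc n) v x = it a n (\<lambda>i. \<eta> i (x ^ d)) (x ^ d)"
      unfolding itc_Suc by (rule itc_cong) (use f in \<open>simp add: fibre_def u_def\<close>)
    then have "\<forall>i<N. cmod (it a (Suc n) v x i) = 1" using \<eta>one[OF _ pw[OF x]] by simp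
    then have "exp (- L) \<le> cmod x" using Lam J0 unfolding Lam_le_iff[OF L] by blast
    then show False using rL x by simp
  qed
  have f0: "fibre a u 0 \<omega>"
    unfolding fibre_def u_def using \<eta>0 d0 by (simp add: mapc_at_0 zero_power)
  obtain \<xi> where \<xi>: "is_lift a u (ball 0 r) \<xi>" "\<forall>i<N. \<xi> i 0 = \<omega> i"
    using lift_exists[where u = u, OF a R0 uhol r ujac f0] by blast
  define \<zeta> where "\<zeta> i z = \<xi> i (z / of_real R)" for i z
  have zR: "z / of_real R \<in> ball 0 r" if "z \<in> ball 0 c" for z :: complex
    using that Rp by (simp add: r_def norm_divide divide_strict_right_mono)
  have fibz: "F a (\<lambda>i. \<xi> i x) x i = u i x" if "x \<in> ball 0 r" "i < N" for x i
    using \<xi>(1) that unfolding is_lift_def fibre_def by blast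
  have "\<zeta> i holomorphic_on ball 0 c" if i: "i < N" for i
  proof -
    have "\<xi> i holomorphic_on ball 0 r" using \<xi>(1) i unfolding is_lift_def by blast
    then have "\<xi> i \<circ> (\<lambda>z. z / of_real R) holomorphic_on ball 0 c"
      by (rule holomorphic_on_compose_gen[rotated]) (use zR Rp in \<open>auto intro!: holomorphic_intros\<close>)
    then show ?thesis unfolding \<zeta>_def o_def .
  qed
  moreover have "\<zeta> i 0 = \<omega> i" if "i < N" for i using \<xi>(2) that by (simp add: \<zeta>_def)
  moreover have "cmod (\<zeta> i z) \<le> 4 + 2 * q * cmod z" if i: "i < N" and z: "z \<in> ball 0 c" for i z
  proof -
    have "cmod (\<xi> i (z / of_real R)) \<le> max 1 (2 * 2) + 2 * q * R * cmod (z / of_real R)"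
    proof (rule fibre_bound[OF a R0 _ i])
      fix j assume j: "j < N"
      show "cmod (F a (\<lambda>i. \<xi> i (z / of_real R)) (z / of_real R) j) \<le> 2"
        unfolding fibz[OF zR[OF z] j] u_def
        using \<eta>near[OF j pw[OF zR[OF z]]] norm_triangle_ineq[of "\<eta> j ((z / of_real R) ^ d) - \<omega> j ^ d" "\<omega> j ^ d"] \<omega>[OF j] kappa(2)
        by (simp add: norm_power)
    qed
    also have "2 * q * R * cmod (z / of_real R) = 2 * q * cmod z" using Rp by (simp add: norm_divide)
    finally show ?thesis by (simp add: \<zeta>_def)
  qed
  moreover have "cmod (F b (\<lambda>i. \<zeta> i z) z i - \<omega> i ^ d) \<le> 2 * \<kappa> / (c * \<delta>)" if i: "i < N" and z: "z \<in> ball 0 c" for i z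
  proof -
    define x where "x = z / of_real R"
    have x: "x \<in> ball 0 r" unfolding x_def by (rule zR[OF z])
    have "F b (\<lambda>i. \<zeta> i z) z i = F a (\<lambda>i. \<xi> i x) x i"
      unfolding mapc_def \<zeta>_def x_def b by (simp add: power_divide)
    then have "F b (\<lambda>i. \<zeta> i z) z i = \<eta> i (x ^ d)" using fibz[OF x i] by (simp add: u_def)
    moreover have "cmod (\<eta> i (x ^ d) - \<omega> i ^ d) \<le> 2 * \<kappa> * cmod (x ^ d) / \<rho>"
      by (rule schwarz_ball(1)[of "\<lambda>y. \<eta> i y - \<omega> i ^ d" \<rho>])
        (use \<eta>0[OF i] \<eta>near[OF i] \<eta>hol[OF i] pw[OF x] kappa(1) \<rho>(1) in \<open>auto intro!: holomorphic_intros\<close>)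
    moreover have "2 * \<kappa> * cmod (x ^ d) / \<rho> \<le> 2 * \<kappa> * (\<rho> / (c * \<delta>)) / \<rho>"
      using pwr[OF x] rd rr kappa(1) \<rho>(1) by (intro divide_right_mono mult_left_mono) auto
    moreover have "2 * \<kappa> * (\<rho> / (c * \<delta>)) / \<rho> = 2 * \<kappa> / (c * \<delta>)" using \<rho>(1) by simp
    ultimately show ?thesis by simp
  qed
  ultimately show ?thesis by blast
qed

section \<open>Normalization of unbounded coefficients\<close>

lemma coefficients_extract:
  assumes C: "\<And>k i I. cmod (b k i I) \<le> C" and supp: "\<And>k i I. \<not> (i < N \<and> I \<in> IndStar N d) \<Longrightarrow> b k i I = 0"
  obtains s b' where "strict_mono (s :: nat \<Rightarrow> nat)" "\<And>i I. (\<lambda>k. b (s k) i I) \<longlonglongrightarrow> b' i I"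
proof -
  define idx where "idx = {..<N} \<times> IndStar N d"
  have "finite idx" by (simp add: idx_def finite_IndStar)
  then obtain h where h: "bij_betw h {0..<card idx} idx" using ex_bij_betw_nat_finite by blast
  define v where "v k j = b k (fst (h j)) (snd (h j))" for k j
  obtain s v' where s: "strict_mono (s :: nat \<Rightarrow> nat)" "\<And>j. j < card idx \<Longrightarrow> (\<lambda>k. v (s k) j) \<longlonglongrightarrow> v' j"
    by (rule bounded_sequence_extract[of "card idx" v C]) (use C in \<open>auto simp: v_def\<close>)
  have "\<exists>l. (\<lambda>k. b (s k) i I) \<longlonglongrightarrow> l" for i I
  proof (cases "i < N \<and> I \<in> IndStar N d")
    case True
    then have "(i, I) \<in> h ` {0..<card idx}" using h by (auto simp: bij_betw_def idx_def)
    then obtain j where j: "j < card idx" "h j = (i, I)" by auto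
    show ?thesis using s(2)[OF j(1)] j(2) by (auto simp: v_def)
  next
    case False
    then have "b (s k) i I = 0" for k using supp by blast
    then show ?thesis by (auto intro!: exI[of _ 0])
  qed
  then have "\<forall>i. \<forall>I. \<exists>l. (\<lambda>k. b (s k) i I) \<longlonglongrightarrow> l" by blast
  then obtain b' where "\<forall>i I. (\<lambda>k. b (s k) i I) \<longlonglongrightarrow> b' i I" by metis
  then show thesis using that s(1) by blast
qed

lemma IndStar_nonempty: "IndStar N d \<noteq> {}"
proof -
  define I where "I = (\<lambda>j. if j = 0 then d - 1 else if j = N then 1 else (0::nat))"
  have "(\<Sum>j\<le>N. I j) = (\<Sum>j\<in>{0, N}. I j)"
    by (rule sum.mono_neutral_right) (auto simp: I_def)
  also have "\<dots> = d" using N_pos d_ge_2 by (simp add: I_def)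
  finally have "I \<in> IndStar N d" using N_pos d_ge_2 by (auto simp: IndStar_def I_def)
  then show ?thesis by blast
qed

text \<open>R is the maximum of the numbers |a_I|^(1/I_N). That it is attained keeps limits of the
  rescaled maps different from v -> v^d.\<close>

lemma coef_bound_tight:
  obtains R i I where "0 \<le> R" "coef_bound N d R a" "i < N" "I \<in> IndStar N d" "cmod (a i I) = R ^ I N"
proof -
  define f where "f = (\<lambda>(i, I). root (I N) (cmod (a i I)))"
  define X where "X = f ` ({..<N} \<times> IndStar N d)"
  have "{..<N} \<noteq> {}" using N_pos by (auto simp: lessThan_empty_iff)
  then have X: "finite X" "X \<noteq> {}" using IndStar_nonempty by (simp_all add: X_def finite_IndStar Times_empty)
  have pow: "f (i, I) ^ I N = cmod (a i I)" "0 \<le> f (i, I)" if "I \<in> IndStar N d" for i I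
    using that by (auto simp: f_def IndStar_def)
  from Max_in[OF X] obtain i I where iI: "i < N" "I \<in> IndStar N d" "Max X = f (i, I)" unfolding X_def by auto
  show thesis
  proof (rule that[of "Max X" i I])
    show "0 \<le> Max X" using iI pow by simp
    show "cmod (a i I) = Max X ^ I N" using iI pow by simp
    show "coef_bound N d (Max X) a"
      unfolding coef_bound_def
    proof (intro allI impI ballI)
      fix i I assume i: "i < N" "I \<in> IndStar N d"
      have "f (i, I) \<le> Max X" using X(1) i by (intro Max_ge) (auto simp: X_def)
      then show "cmod (a i I) \<le> Max X ^ I N" using pow[OF i(2), of i] power_mono by metis
    qed
  qed (use iI in auto)
qed

lemma coef_bound_mono: "coef_bound N d R a \<Longrightarrow> 0 \<le> R \<Longrightarrow> R \<le> R' \<Longrightarrow> coef_bound N d R' a"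
  unfolding coef_bound_def by (meson order_trans power_mono)

lemma bounded_G_imp_coef_bound:
  "\<exists>R\<ge>1. \<forall>a\<in>PolySpace N d. G_inf_crit N d a \<le> B \<longrightarrow> coef_bound N d R a"
proof (rule ccontr)
  assume contra: "\<not> ?thesis"
  \<comment> \<open>Radius of the disc in the rescaled coordinate for the k-th map; its cube is the
    lower bound on R that \<open>approximate_lines\<close> asks for.\<close>
  define c where "c k = real (Suc k)" for k
  have c1: "1 \<le> c k" for k by (simp add: c_def)
  have "\<exists>a. a \<in> PolySpace N d \<and> G_inf_crit N d a \<le> B \<and> \<not> coef_bound N d (c k ^ 3) a" for k
    using contra one_le_power[OF c1, of k 3] by blast
  then have "\<forall>k. \<exists>a. a \<in> PolySpace N d \<and> G_inf_crit N d a \<le> B \<and> \<not> coef_bound N d (c k ^ 3) a" by blast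
  from choice[OF this] obtain a where
    a: "\<forall>k. a k \<in> PolySpace N d \<and> G_inf_crit N d (a k) \<le> B \<and> \<not> coef_bound N d (c k ^ 3) (a k)" ..
  have "\<exists>R. coef_bound N d R (a k) \<and> c k ^ 3 \<le> R \<and> (\<exists>i<N. \<exists>I\<in>IndStar N d. cmod (a k i I) = R ^ I N)" for k
  proof -
    obtain R i I where R: "0 \<le> R" "coef_bound N d R (a k)" "i < N" "I \<in> IndStar N d" "cmod (a k i I) = R ^ I N"
      by (rule coef_bound_tight)
    have "\<not> R \<le> c k ^ 3" using coef_bound_mono[OF R(2,1)] a by blast
    then have "c k ^ 3 \<le> R" by simp
    then show ?thesis using R by blast
  qed
  then have "\<forall>k. \<exists>R. coef_bound N d R (a k) \<and> c k ^ 3 \<le> R \<and> (\<exists>i<N. \<exists>I\<in>IndStar N d. cmod (a k i I) = R ^ I N)" by blast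
  from choice[OF this] obtain R where
    R: "\<forall>k. coef_bound N d (R k) (a k) \<and> c k ^ 3 \<le> R k \<and> (\<exists>i<N. \<exists>I\<in>IndStar N d. cmod (a k i I) = R k ^ I N)" ..
  have Rpos: "0 < R k" for k
  proof -
    have "c k ^ 3 \<le> R k" using R by blast
    then show ?thesis using one_le_power[OF c1, of k 3] by linarith
  qed
  define L where "L = \<bar>B\<bar> + 1"
  have L0: "0 \<le> L" by (simp add: L_def)
  have "\<exists>n. Lam (a k) (Suc n) \<le> L" for k
  proof -
    have "G_inf_crit N d (a k) < L" using a by (auto simp: L_def intro: le_less_trans)
    then have "\<forall>\<^sub>F n in sequentially. Lam (a k) n < L" by (rule order_tendstoD(2)[OF Lam_tendsto])
    then obtain n0 where "\<forall>n\<ge>n0. Lam (a k) n < L" unfolding eventually_sequentially by blast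
    then have "Lam (a k) (Suc n0) < L" by simp
    then show ?thesis by (intro exI[of _ n0]) simp
  qed
  then have "\<forall>k. \<exists>n. Lam (a k) (Suc n) \<le> L" by blast
  from choice[OF this] obtain n where n: "\<forall>k. Lam (a k) (Suc (n k)) \<le> L" ..
  define b where "b k i I = a k i I / of_real (R k) ^ I N" for k i I
  have bn: "cmod (b k i I) = cmod (a k i I) / R k ^ I N" for k i I
    using Rpos[of k] by (simp add: b_def norm_divide norm_power)
  have b0: "b k i I = 0" if "\<not> (i < N \<and> I \<in> IndStar N d)" for k i I
  proof -
    have "a k i I = 0" using a that unfolding PolySpace_def by (auto simp: not_less)
    then show ?thesis by (simp add: b_def)
  qed
  have b1: "cmod (b k i I) \<le> 1" for k i I
  proof (cases "i < N \<and> I \<in> IndStar N d")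
    case True
    then have "cmod (a k i I) \<le> R k ^ I N" using R unfolding coef_bound_def by blast
    then show ?thesis unfolding bn using Rpos[of k] by simp
  qed (simp add: b0)
  obtain s b' where s: "strict_mono (s :: nat \<Rightarrow> nat)" and blim: "\<And>i I. (\<lambda>k. b (s k) i I) \<longlonglongrightarrow> b' i I"
    by (rule coefficients_extract[of b 1]) (use b1 b0 in auto)
  have b'1: "coef_bound N d 1 b'"
    unfolding coef_bound_def
  proof (intro allI impI ballI)
    fix i I
    have "cmod (b' i I) \<le> 1" by (rule Lim_norm_ubound[OF _ blim]) (use b1 in auto)
    then show "cmod (b' i I) \<le> 1 ^ I N" by simp
  qed
  \<comment> \<open>Some normalized coefficient has modulus 1. The sum over all of them preserves
    this in the limit without tracking the index.\<close>
  have norm1: "1 \<le> (\<Sum>i<N. \<Sum>I\<in>IndStar N d. cmod (b k i I))" for k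
  proof -
    obtain i I where iI: "i < N" "I \<in> IndStar N d" "cmod (a k i I) = R k ^ I N" using R by blast
    have "1 = cmod (b k i I)" unfolding bn iI(3) using Rpos[of k] by simp
    also have "\<dots> \<le> (\<Sum>I\<in>IndStar N d. cmod (b k i I))"
      using iI by (intro member_le_sum) (auto simp: finite_IndStar)
    also have "\<dots> \<le> (\<Sum>i<N. \<Sum>I\<in>IndStar N d. cmod (b k i I))"
      using iI by (intro member_le_sum[of i "{..<N}" "\<lambda>i. \<Sum>I\<in>IndStar N d. cmod (b k i I)"]) (auto intro!: sum_nonneg)
    finally show ?thesis .
  qed
  have "(\<lambda>k. \<Sum>i<N. \<Sum>I\<in>IndStar N d. cmod (b (s k) i I)) \<longlonglongrightarrow> (\<Sum>i<N. \<Sum>I\<in>IndStar N d. cmod (b' i I))"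
    by (intro tendsto_sum tendsto_norm blim)
  then have "1 \<le> (\<Sum>i<N. \<Sum>I\<in>IndStar N d. cmod (b' i I))"
    by (rule LIMSEQ_le_const) (use norm1 in blast)
  moreover have "b' i I = 0" if i: "i < N" and I: "I \<in> IndStar N d" for i I
  proof (rule lines_imp_trivial[OF b'1 _ i I])
    fix \<omega> :: "nat \<Rightarrow> complex" assume \<omega>: "\<And>i. i < N \<Longrightarrow> cmod (\<omega> i) = 1"
    obtain k0 where k0: "max (1 / \<delta>) (exp L) \<le> real k0" using real_arch_simple by blast
    \<comment> \<open>The shift by k0 makes c (t k) at least 1/\<delta> and exp L from the first
      index on.\<close>
    define t where "t k = s (k + k0)" for k
    have tk: "k + k0 \<le> t k" for k unfolding t_def by (rule seq_suble[OF s])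
    have ct: "1 / \<delta> \<le> c (t k)" "exp L \<le> c (t k)" for k
      using k0 tk[of k] by (auto simp: c_def)
    have "\<exists>\<zeta>. (\<forall>i<N. \<zeta> i holomorphic_on ball 0 (c (t k))) \<and> (\<forall>i<N. \<zeta> i 0 = \<omega> i) \<and>
      (\<forall>i<N. \<forall>z\<in>ball 0 (c (t k)). cmod (\<zeta> i z) \<le> 4 + 2 * q * cmod z) \<and>
      (\<forall>i<N. \<forall>z\<in>ball 0 (c (t k)). cmod (F (b (t k)) (\<lambda>i. \<zeta> i z) z i - \<omega> i ^ d) \<le> 2 * \<kappa> / (c (t k) * \<delta>))" for k
      by (rule approximate_lines[where R = "R (t k)" and a = "a (t k)" and n = "n (t k)" and L = L])
        (use R c1 ct n \<omega> L0 in \<open>auto simp: b_def\<close>)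
    then have "\<forall>k. \<exists>\<zeta>. (\<forall>i<N. \<zeta> i holomorphic_on ball 0 (c (t k))) \<and> (\<forall>i<N. \<zeta> i 0 = \<omega> i) \<and>
      (\<forall>i<N. \<forall>z\<in>ball 0 (c (t k)). cmod (\<zeta> i z) \<le> 4 + 2 * q * cmod z) \<and>
      (\<forall>i<N. \<forall>z\<in>ball 0 (c (t k)). cmod (F (b (t k)) (\<lambda>i. \<zeta> i z) z i - \<omega> i ^ d) \<le> 2 * \<kappa> / (c (t k) * \<delta>))" by blast
    from choice[OF this] obtain \<zeta> where \<zeta>:
      "\<forall>k. (\<forall>i<N. \<zeta> k i holomorphic_on ball 0 (c (t k))) \<and> (\<forall>i<N. \<zeta> k i 0 = \<omega> i) \<and>
      (\<forall>i<N. \<forall>z\<in>ball 0 (c (t k)). cmod (\<zeta> k i z) \<le> 4 + 2 * q * cmod z) \<and>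
      (\<forall>i<N. \<forall>z\<in>ball 0 (c (t k)). cmod (F (b (t k)) (\<lambda>i. \<zeta> k i z) z i - \<omega> i ^ d) \<le> 2 * \<kappa> / (c (t k) * \<delta>))" ..
    define A where "A = 5 + 2 * q"
    have A: "0 < A" using q_ge_1 by (simp add: A_def)
    have cpos: "0 < c k" for k using c1[of k] by simp
    define m where "m k i = deriv (\<zeta> k i) 0" for k i
    \<comment> \<open>Linear growth of \<zeta>: on the disc of radius c the oscillation is O(c), so
      the quadratic remainder in \<open>linear_approximation\<close> is O(1/c).\<close>
    have osc: "cmod (\<zeta> k i z - \<zeta> k i 0) \<le> A * c (t k)" if i: "i < N" and z: "z \<in> ball 0 (c (t k))" for k i z
    proof -
      have "cmod (\<zeta> k i z) \<le> 4 + 2 * q * cmod z" "\<zeta> k i 0 = \<omega> i" using \<zeta> i z by blast+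
      moreover have "2 * q * cmod z \<le> 2 * q * c (t k)" using z q_ge_1 by (intro mult_left_mono) auto
      moreover have "5 * 1 \<le> 5 * c (t k)" using c1 by (intro mult_left_mono) auto
      ultimately have "cmod (\<zeta> k i z - \<zeta> k i 0) \<le> 5 * c (t k) + 2 * q * c (t k)"
        using norm_triangle_ineq4[of "\<zeta> k i z" "\<zeta> k i 0"] \<omega>[OF i] by simp
      then show ?thesis by (simp add: A_def distrib_right)
    qed
    have lin: "cmod (m k i) \<le> 2 * A"
      "\<And>z. z \<in> ball 0 (c (t k)) \<Longrightarrow> cmod (\<zeta> k i z - (\<omega> i + m k i * z)) \<le> 8 * A / c (t k) * (cmod z)\<^sup>2" if i: "i < N" for k i
    proof -
      have hol: "\<zeta> k i holomorphic_on ball 0 (c (t k))" and z0: "\<zeta> k i 0 = \<omega> i" using \<zeta> i by blast+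
      have pos: "0 < A * c (t k)" using A cpos by simp
      have o: "\<And>z. z \<in> ball 0 (c (t k)) \<Longrightarrow> cmod (\<zeta> k i z - \<zeta> k i 0) \<le> A * c (t k)" by (rule osc[OF i])
      show "cmod (m k i) \<le> 2 * A"
        using linear_approximation(1)[OF hol o pos cpos] cpos[of "t k"] by (simp add: m_def)
      show "cmod (\<zeta> k i z - (\<omega> i + m k i * z)) \<le> 8 * A / c (t k) * (cmod z)\<^sup>2" if "z \<in> ball 0 (c (t k))" for z
      proof -
        have "8 * (A * c (t k)) / (c (t k))\<^sup>2 = 8 * A / c (t k)" using cpos[of "t k"] by (simp add: power2_eq_square)
        then show ?thesis using linear_approximation(2)[OF hol o pos cpos that] by (simp only: m_def z0)
      qed
    qed
    obtain p m' where p: "strict_mono (p :: nat \<Rightarrow> nat)" and mlim: "\<And>i. i < N \<Longrightarrow> (\<lambda>k. m (p k) i) \<longlonglongrightarrow> m' i"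
      by (rule bounded_sequence_extract[of N m "2 * A"]) (use lin(1) in auto)
    have invc: "(\<lambda>k. C / c (t (p k))) \<longlonglongrightarrow> 0" for C
    proof -
      have "filterlim (\<lambda>k. c (t (p k))) at_top sequentially"
      proof (rule filterlim_at_top_mono[OF filterlim_real_sequentially])
        have "k \<le> t (p k)" for k using tk[of "p k"] seq_suble[OF p, of k] by linarith
        then have "real k \<le> c (t (p k))" for k unfolding c_def of_nat_le_iff by (rule le_SucI)
        then show "\<forall>\<^sub>F k in sequentially. real k \<le> c (t (p k))" by simp
      qed
      then show ?thesis by (rule tendsto_divide_0[OF tendsto_const filterlim_at_top_imp_at_infinity])
    qed
    show "\<exists>m. \<forall>z\<in>ball 0 1. \<forall>i<N. F b' (\<lambda>i. \<omega> i + m i * z) z i = \<omega> i ^ d"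
    proof (intro exI[of _ m'] ballI allI impI)
      fix z :: complex and i assume z: "z \<in> ball 0 1" and i: "i < N"
      have zc: "z \<in> ball 0 (c k)" for k using z c1[of k] by simp
      have \<zeta>lim: "(\<lambda>k. \<zeta> (p k) j z) \<longlonglongrightarrow> \<omega> j + m' j * z" if j: "j < N" for j
      proof -
        have "(\<lambda>k. \<zeta> (p k) j z - (\<omega> j + m (p k) j * z)) \<longlonglongrightarrow> 0"
        proof (rule Lim_null_comparison)
          show "\<forall>\<^sub>F k in sequentially. cmod (\<zeta> (p k) j z - (\<omega> j + m (p k) j * z)) \<le> 8 * A * (cmod z)\<^sup>2 / c (t (p k))"
            using lin(2)[OF j zc] by simp
          show "(\<lambda>k. 8 * A * (cmod z)\<^sup>2 / c (t (p k))) \<longlonglongrightarrow> 0" by (rule invc)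
        qed
        moreover have "(\<lambda>k. \<omega> j + m (p k) j * z) \<longlonglongrightarrow> \<omega> j + m' j * z" by (intro tendsto_intros mlim j)
        ultimately show ?thesis using tendsto_add by fastforce
      qed
      have btp: "(\<lambda>k. b (t (p k)) i I) \<longlonglongrightarrow> b' i I" for i I
      proof -
        have "strict_mono (\<lambda>k. p k + k0)" using p by (simp add: strict_mono_def)
        from LIMSEQ_subseq_LIMSEQ[OF blim this] show ?thesis by (simp add: t_def o_def)
      qed
      have 1: "(\<lambda>k. F (b (t (p k))) (\<lambda>j. \<zeta> (p k) j z) z i) \<longlonglongrightarrow> F b' (\<lambda>j. \<omega> j + m' j * z) z i"
        by (rule tendsto_mapc[OF btp \<zeta>lim tendsto_const i])
      have "(\<lambda>k. F (b (t (p k))) (\<lambda>j. \<zeta> (p k) j z) z i - \<omega> i ^ d) \<longlonglongrightarrow> 0"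
      proof (rule Lim_null_comparison)
        have "cmod (F (b (t k)) (\<lambda>j. \<zeta> k j z) z i - \<omega> i ^ d) \<le> 2 * \<kappa> / \<delta> / c (t k)" for k
        proof -
          have "cmod (F (b (t k)) (\<lambda>j. \<zeta> k j z) z i - \<omega> i ^ d) \<le> 2 * \<kappa> / (c (t k) * \<delta>)" using \<zeta> i zc by blast
          then show ?thesis by (simp add: mult.commute)
        qed
        then show "\<forall>\<^sub>F k in sequentially. cmod (F (b (t (p k))) (\<lambda>j. \<zeta> (p k) j z) z i - \<omega> i ^ d) \<le> 2 * \<kappa> / \<delta> / c (t (p k))" by simp
        show "(\<lambda>k. 2 * \<kappa> / \<delta> / c (t (p k))) \<longlonglongrightarrow> 0" by (rule invc)
      qed
      then have 2: "(\<lambda>k. F (b (t (p k))) (\<lambda>j. \<zeta> (p k) j z) z i) \<longlonglongrightarrow> \<omega> i ^ d" by (rule LIM_zero_cancel)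
      show "F b' (\<lambda>i. \<omega> i + m' i * z) z i = \<omega> i ^ d" using 1 2 by (rule LIMSEQ_unique)
    qed
  qed
  then have "(\<Sum>i<N. \<Sum>I\<in>IndStar N d. cmod (b' i I)) = 0" by simp
  ultimately show False by simp
qed

section \<open>Compactness in the product topology\<close>

lemma compact_box: "compact (PiE UNIV (\<lambda>_. cball 0 C) :: (nat \<Rightarrow> complex) set)"
proof -
  have "compactin (product_topology (\<lambda>_. euclidean) UNIV) (PiE UNIV (\<lambda>_::nat. cball 0 C :: complex set))"
    unfolding compactin_PiE by simp
  then show ?thesis by (simp add: euclidean_product_topology)
qed

text \<open>The ambient function space is a product over uncountably many multi-indices, where
  sequential closedness does not give closedness. The finitely many relevant coefficients are
  therefore encoded in nat => complex, where sequences suffice, and the compact set is carried back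
  by the continuous map \<Psi>.\<close>

lemma compact_bounded_G: "compact {a \<in> PolySpace N d. G_inf_crit N d a \<le> B}"
proof -
  define T where "T = {a \<in> PolySpace N d. G_inf_crit N d a \<le> B}"
  define idx where "idx = {..<N} \<times> IndStar N d"
  have "finite idx" by (simp add: idx_def finite_IndStar)
  then obtain h where h: "bij_betw h {0..<card idx} idx" using ex_bij_betw_nat_finite by blast
  define pos_of where "pos_of = inv_into {0..<card idx} h"
  have pos_of: "pos_of x < card idx" "h (pos_of x) = x" if "x \<in> idx" for x
  proof -
    have "x \<in> h ` {0..<card idx}" using h that by (simp add: bij_betw_def)
    from inv_into_into[OF this] f_inv_into_f[OF this] show "pos_of x < card idx" "h (pos_of x) = x" by (simp_all add: pos_of_def)
  qed
  have pos_of_h: "pos_of (h j) = j" "h j \<in> idx" if "j < card idx" for j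
    using h that by (auto simp: pos_of_def bij_betw_def inv_into_f_f)
  define \<Psi> :: "(nat \<Rightarrow> complex) \<Rightarrow> nat \<Rightarrow> (nat \<Rightarrow> nat) \<Rightarrow> complex" where
    "\<Psi> v = (\<lambda>i I. if (i, I) \<in> idx then v (pos_of (i, I)) else 0)" for v
  have cont: "continuous_on UNIV \<Psi>"
    unfolding \<Psi>_def
  proof (intro continuous_on_coordinatewise_then_product)
    fix i I
    show "continuous_on UNIV (\<lambda>v::nat \<Rightarrow> complex. if (i, I) \<in> idx then v (pos_of (i, I)) else 0)"
      by (cases "(i, I) \<in> idx") (simp_all add: continuous_on_product_coordinates)
  qed
  have Poly: "\<Psi> v \<in> PolySpace N d" for v by (auto simp: PolySpace_def \<Psi>_def idx_def)
  \<comment> \<open>The entries that \<Psi> ignores are fixed to 0, which keeps K inside a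
    box.\<close>
  define K where "K = {v. (\<forall>j. card idx \<le> j \<longrightarrow> v j = 0) \<and> \<Psi> v \<in> T}"
  obtain R where R: "1 \<le> R" "\<And>a. a \<in> T \<Longrightarrow> coef_bound N d R a"
    using bounded_G_imp_coef_bound[of B] unfolding T_def by blast
  have box: "K \<subseteq> PiE UNIV (\<lambda>_. cball 0 (R ^ d))"
  proof
    fix v assume v: "v \<in> K"
    have "cmod (v j) \<le> R ^ d" for j
    proof (cases "j < card idx")
      case True
      obtain i I where iI: "h j = (i, I)" by force
      have "(i, I) \<in> idx" using pos_of_h(2)[OF True] iI by simp
      then have "\<Psi> v i I = v j" using pos_of_h(1)[OF True] iI by (simp add: \<Psi>_def)
      moreover have "cmod (\<Psi> v i I) \<le> R ^ I N"
        using R(2)[of "\<Psi> v"] v \<open>(i, I) \<in> idx\<close> by (auto simp: K_def coef_bound_def idx_def)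
      moreover have "R ^ I N \<le> R ^ d"
        using \<open>(i, I) \<in> idx\<close> R(1) by (intro power_increasing) (auto simp: idx_def IndStar_def)
      ultimately show ?thesis by simp
    next
      case False
      then show ?thesis using v R(1) by (simp add: K_def)
    qed
    then show "v \<in> PiE UNIV (\<lambda>_. cball 0 (R ^ d))" by auto
  qed
  have "closed K"
    unfolding closed_sequential_limits
  proof (intro allI impI, elim conjE)
    fix x l assume x: "\<forall>n. x n \<in> K" and l: "x \<longlonglongrightarrow> l"
    have coord: "(\<lambda>n. x n j) \<longlonglongrightarrow> l j" for j :: nat
    proof -
      have "isCont (\<lambda>v::nat \<Rightarrow> complex. v j) l"
        by (rule continuous_on_interior[OF continuous_on_product_coordinates]) simp
      from isCont_tendsto_compose[OF this l] show ?thesis .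
    qed
    have "l j = 0" if j: "card idx \<le> j" for j
    proof (rule LIMSEQ_unique[OF coord[of j]])
      have "x n j = 0" for n using x j by (simp add: K_def)
      then show "(\<lambda>n. x n j) \<longlonglongrightarrow> 0" by simp
    qed
    moreover have "G_inf_crit N d (\<Psi> l) \<le> B"
    proof (rule G_inf_crit_closed[where a = "\<lambda>n. \<Psi> (x n)"])
      show "(\<lambda>n. \<Psi> (x n) i I) \<longlonglongrightarrow> \<Psi> l i I" for i I
        by (cases "(i, I) \<in> idx") (simp_all add: \<Psi>_def coord)
      show "G_inf_crit N d (\<Psi> (x n)) \<le> B" for n using x by (simp add: K_def T_def)
    qed
    ultimately show "l \<in> K" using Poly by (simp add: K_def T_def)
  qed
  then have "compact (PiE UNIV (\<lambda>_. cball 0 (R ^ d)) \<inter> K)" by (rule compact_Int_closed[OF compact_box])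
  moreover have "PiE UNIV (\<lambda>_. cball 0 (R ^ d)) \<inter> K = K" using box by blast
  ultimately have "compact K" by simp
  then have "compact (\<Psi> ` K)"
    by (rule compact_continuous_image[OF continuous_on_subset[OF cont subset_UNIV]])
  moreover have "\<Psi> ` K = T"
  proof
    show "\<Psi> ` K \<subseteq> T" by (auto simp: K_def)
    show "T \<subseteq> \<Psi> ` K"
    proof
      fix a assume a: "a \<in> T"
      define v where "v j = (if j < card idx then a (fst (h j)) (snd (h j)) else 0)" for j
      have "\<Psi> v = a"
      proof (intro ext)
        fix i I
        show "\<Psi> v i I = a i I"
        proof (cases "(i, I) \<in> idx")
          case True
          then show ?thesis using pos_of[OF True] by (simp add: \<Psi>_def v_def)
        next
          case False
          then have "a i I = 0" using a by (auto simp: T_def PolySpace_def idx_def)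
          then show ?thesis using False by (simp add: \<Psi>_def)
        qed
      qed
      moreover have "v \<in> K" using a \<open>\<Psi> v = a\<close> by (simp add: K_def v_def)
      ultimately show "a \<in> \<Psi> ` K" by blast
    qed
  qed
  ultimately show ?thesis unfolding T_def by simp
qed

end

theorem theorem1p5:
  fixes N d :: nat and B :: real
  assumes "N \<ge> 1" and "d \<ge> 2"
  shows "compact {a \<in> PolySpace N d. G_inf_crit N d a \<le> B}"
proof -
  interpret regular_family N d by unfold_locales (use assms in auto)
  show ?thesis by (rule compact_bounded_G)
qed

end
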